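(* Assume the Open Colouring Axiom $\mathrm{OCA}$ and $\mathrm{MA}_{\sigma\text{-linked}}$. Let $(M_n,d_n)_{n\in\mathbb N}$ and $(N_n,\partial_n)_{n\in\mathbb N}$ be sequences of separable metric spaces, each sequence of uniformly bounded diameter, and let $M=\prod_n M_n/\mathrm{Fin}$ and $N=\prod_n N_n/\mathrm{Fin}$ be their metric reduced products. Then every coordinate respecting function $\varphi\colon M\to N$ is trivial.
   Context: $\mathrm{OCA}$ (Open Colouring Axiom): for every separable metrizable space $X$ and every open $K_0\subseteq[X]^2$ (unordered pairs), either there is an uncountable $H\subseteq X$ with $[H]^2\subseteq K_0$, or $X$ is a countable union of sets $X_n$ with $[X_n]^2\cap K_0=\emptyset$. $\mathrm{MA}_{\sigma\text{-linked}}$ is Martin's Axiom (for $\aleph_1$ dense sets) restricted to $\sigma$-linked partial orders. Metric reduced product: for a sequence $(M_n,d_n)$ of metric spaces of uniformly bounded diameter, $\prod_n M_n/\mathrm{Fin}$ is the set of classes of $\prod_n M_n$ under $a\sim b\iff \lim_n d_n(a_n,b_n)=0$; the class of $a$ is $[a]$, with metric $d([a],[b])=\limsup_n d_n(a_n,b_n)$. For infinite $S\subseteq\mathbb N$ put $d^S([a],[b])=\limsup_{n\in S}d_n(a_n,b_n)$, and $d^S=0$ for finite $S$; this depends only on the class of $S$ in $\mathcal P(\mathbb N)/\mathrm{Fin}$. Write $x=_S y$ if $d^S(x,y)=0$ (and similarly with $\partial^S$ on $N$). A function $\varphi\colon M\to N$ is coordinate respecting if there is an automorphism $\alpha$ of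 the Boolean algebra $\mathcal P(\mathbb N)/\mathrm{Fin}$ such that for all $S\in\mathcal P(\mathbb N)/\mathrm{Fin}$ and all $a,b\in M$, $a=_S b$ implies $\varphi(a)=_{\alpha(S)}\varphi(b)$. $\varphi$ is trivial if there are an almost permutation $f$ of $\mathbb N$ (a bijection between two cofinite subsets of $\mathbb N$) and maps $h_n\colon M_{f(n)}\to N_n$ such that for every $a\in\prod_nM_n$, $\varphi([a])=[b]$ where $b_n=h_n(a_{f(n)})$ (for $n$ in the domain of $f$; the remaining finitely many coordinates are irrelevant). *)

theory Defs
  imports "HOL-Analysis.Analysis" "HOL-Library.Ramsey"
begin

unbundle cardinal_syntax

section \<open>The Open Colouring Axiom\<close>

text \<open>
  A subset \<open>K\<close> of \<open>[X]\<^bsup>2\<^esup>\<close> is open if the set of ordered pairs that it induces is open in the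
  square of \<open>X\<close>; this set never contains a point of the diagonal, since members of \<open>[X]\<^bsup>2\<^esup>\<close> have
  two elements.
\<close>

definition open_colouring :: "'a topology \<Rightarrow> 'a set set \<Rightarrow> bool" where
  "open_colouring X K \<longleftrightarrow>
     K \<subseteq> [topspace X]\<^bsup>2\<^esup> \<and> openin (prod_topology X X) {(x, y). {x, y} \<in> K}"

definition oca_dichotomy :: "'a topology \<Rightarrow> bool" where
  "oca_dichotomy X \<longleftrightarrow>
     (\<forall>K. open_colouring X K \<longrightarrow>
        (\<exists>H. H \<subseteq> topspace X \<and> uncountable H \<and> [H]\<^bsup>2\<^esup> \<subseteq> K) \<or>
        (\<exists>Y :: nat \<Rightarrow> 'a set. (\<Union>n. Y n) = topspace X \<and> (\<forall>n. [Y n]\<^bsup>2\<^esup> \<inter> K = {})))"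

text \<open>
  A separable metrizable space has at most continuum many points, so up to homeomorphism its
  points are real numbers and it suffices to quantify over all topologies on sets of reals
  (not just subspace topologies). Lemma \<open>OCA_all_types\<close> below recovers the axiom for spaces
  over an arbitrary type.
\<close>

definition OCA :: bool where
  "OCA \<longleftrightarrow>
     (\<forall>X :: real topology. separable_space X \<and> metrizable_space X \<longrightarrow> oca_dichotomy X)"


section \<open>Martin's Axiom for \<open>\<sigma>\<close>-linked partial orders\<close>

text \<open>A pair \<open>(p, q) \<in> r\<close> is read as \<open>p \<le> q\<close>, that is, \<open>p\<close> is the stronger condition.\<close>

definition compatible :: "'p set \<Rightarrow> 'p rel \<Rightarrow> 'p \<Rightarrow> 'p \<Rightarrow> bool" where
  "compatible P r p q \<longleftrightarrow> (\<exists>s\<in>P. (s, p) \<in> r \<and> (s, q) \<in> r)"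

definition sigma_linked :: "'p set \<Rightarrow> 'p rel \<Rightarrow> bool" where
  "sigma_linked P r \<longleftrightarrow>
     (\<exists>L :: nat \<Rightarrow> 'p set. P = (\<Union>n. L n) \<and> (\<forall>n. \<forall>p\<in>L n. \<forall>q\<in>L n. compatible P r p q))"

definition dense_subset :: "'p set \<Rightarrow> 'p rel \<Rightarrow> 'p set \<Rightarrow> bool" where
  "dense_subset P r D \<longleftrightarrow> D \<subseteq> P \<and> (\<forall>p\<in>P. \<exists>q\<in>D. (q, p) \<in> r)"

definition poset_filter :: "'p set \<Rightarrow> 'p rel \<Rightarrow> 'p set \<Rightarrow> bool" where
  "poset_filter P r G \<longleftrightarrow>
     G \<subseteq> P \<and> G \<noteq> {} \<and>
     (\<forall>p\<in>G. \<forall>q\<in>P. (p, q) \<in> r \<longrightarrow> q \<in> G) \<and>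
     (\<forall>p\<in>G. \<forall>q\<in>G. \<exists>s\<in>G. (s, p) \<in> r \<and> (s, q) \<in> r)"

text \<open>The cardinal \<open>cardSuc natLeq\<close> is \<open>\<aleph>\<^sub>1\<close>.\<close>

definition generic_filters_aleph1 :: "'p set \<Rightarrow> 'p rel \<Rightarrow> bool" where
  "generic_filters_aleph1 P r \<longleftrightarrow>
     (\<forall>\<D>. |\<D>| \<le>o cardSuc natLeq \<and> (\<forall>D\<in>\<D>. dense_subset P r D) \<longrightarrow>
        (\<exists>G. poset_filter P r G \<and> (\<forall>D\<in>\<D>. G \<inter> D \<noteq> {})))"

text \<open>
  Quantifying over partial orders on sets of reals is no restriction: given \<open>\<aleph>\<^sub>1\<close> dense sets in an
  arbitrary \<open>\<sigma>\<close>-linked partial order, one passes to a suborder of size at most \<open>\<aleph>\<^sub>1\<close> that is closed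
  under witnesses for compatibility and for density. Lemma \<open>MA_sigma_linked_all_types\<close> below
  carries this out.
\<close>

definition MA_sigma_linked :: bool where
  "MA_sigma_linked \<longleftrightarrow>
     (\<forall>(P :: real set) r. P \<noteq> {} \<and> partial_order_on P r \<and> sigma_linked P r \<longrightarrow>
        generic_filters_aleph1 P r)"


section \<open>The Boolean algebra of sets of natural numbers modulo finite sets\<close>

quotient_type nat_set_mod_fin = "nat set" / "\<lambda>A B. finite (sym_diff A B)"
  morphisms rep_mod_fin mod_fin
proof (rule equivpI)
  show "reflp (\<lambda>A B :: nat set. finite (sym_diff A B))"
    by (simp add: reflp_def)
  show "symp (\<lambda>A B :: nat set. finite (sym_diff A B))"
    by (simp add: symp_def)
  show "transp (\<lambda>A B :: nat set. finite (sym_diff A B))"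
  proof (rule transpI)
    fix A B C :: "nat set"
    assume "finite (sym_diff A B)" "finite (sym_diff B C)"
    then have "finite (sym_diff A B \<union> sym_diff B C)" by simp
    then show "finite (sym_diff A C)" by (rule rev_finite_subset) auto
  qed
qed

instantiation nat_set_mod_fin :: boolean_algebra
begin

lift_definition inf_nat_set_mod_fin ::
  "nat_set_mod_fin \<Rightarrow> nat_set_mod_fin \<Rightarrow> nat_set_mod_fin" is "(\<inter>)"
  subgoal premises fin
    by (rule finite_subset[OF _ finite_UnI[OF fin]]) auto
  done

lift_definition sup_nat_set_mod_fin ::
  "nat_set_mod_fin \<Rightarrow> nat_set_mod_fin \<Rightarrow> nat_set_mod_fin" is "(\<union>)"
  subgoal premises fin
    by (rule finite_subset[OF _ finite_UnI[OF fin]]) auto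
  done

lift_definition minus_nat_set_mod_fin ::
  "nat_set_mod_fin \<Rightarrow> nat_set_mod_fin \<Rightarrow> nat_set_mod_fin" is "(-)"
  subgoal premises fin
    by (rule finite_subset[OF _ finite_UnI[OF fin]]) auto
  done

lift_definition uminus_nat_set_mod_fin :: "nat_set_mod_fin \<Rightarrow> nat_set_mod_fin" is uminus
  by (erule finite_subset[rotated]) auto

lift_definition bot_nat_set_mod_fin :: nat_set_mod_fin is "{}" .

lift_definition top_nat_set_mod_fin :: nat_set_mod_fin is UNIV .

lift_definition less_eq_nat_set_mod_fin :: "nat_set_mod_fin \<Rightarrow> nat_set_mod_fin \<Rightarrow> bool"
  is "\<lambda>A B. finite (A - B)"
proof -
  fix A A' B B' :: "nat set"
  assume fin: "finite (sym_diff A A')" "finite (sym_diff B B')"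
  have "finite (A - B)" if "finite (A' - B')"
    by (rule finite_subset[OF _ finite_UnI[OF that finite_UnI[OF fin]]]) auto
  moreover have "finite (A' - B')" if "finite (A - B)"
    by (rule finite_subset[OF _ finite_UnI[OF that finite_UnI[OF fin]]]) auto
  ultimately show "finite (A - B) = finite (A' - B')" by blast
qed

definition less_nat_set_mod_fin :: "nat_set_mod_fin \<Rightarrow> nat_set_mod_fin \<Rightarrow> bool" where
  "less_nat_set_mod_fin S T \<longleftrightarrow> S \<le> T \<and> \<not> T \<le> S"

instance
proof
  fix x y z :: nat_set_mod_fin
  show "(x < y) = (x \<le> y \<and> \<not> y \<le> x)"
    by (simp add: less_nat_set_mod_fin_def)
  show "x \<le> x" by transfer simp
  show "x \<le> y \<Longrightarrow> y \<le> z \<Longrightarrow> x \<le> z"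
  proof transfer
    fix A B C :: "nat set"
    assume fin: "finite (A - B)" "finite (B - C)"
    show "finite (A - C)"
      by (rule finite_subset[OF _ finite_UnI[OF fin]]) auto
  qed
  show "x \<le> y \<Longrightarrow> y \<le> x \<Longrightarrow> x = y" by transfer simp
  show "inf x y \<le> x" by transfer (simp add: Int_Diff)
  show "inf x y \<le> y" by transfer (simp add: Int_Diff Diff_Int2)
  show "x \<le> y \<Longrightarrow> x \<le> z \<Longrightarrow> x \<le> inf y z" by transfer (simp add: Diff_Int)
  show "x \<le> sup x y" by transfer (simp add: Diff_eq_empty_iff[THEN iffD2])
  show "y \<le> sup x y" by transfer (simp add: Diff_eq_empty_iff[THEN iffD2])
  show "y \<le> x \<Longrightarrow> z \<le> x \<Longrightarrow> sup y z \<le> x" by transfer (simp add: Un_Diff)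
  show "bot \<le> x" by transfer simp
  show "x \<le> top" by transfer simp
  show "sup x (inf y z) = inf (sup x y) (sup x z)"
    by transfer (simp add: Un_Int_distrib)
  show "inf x (- x) = bot" by transfer simp
  show "sup x (- x) = top" by transfer simp
  show "x - y = inf x (- y)" by transfer (simp add: Diff_eq)
qed

end

definition boolean_automorphism :: "('b :: boolean_algebra \<Rightarrow> 'b) \<Rightarrow> bool" where
  "boolean_automorphism \<alpha> \<longleftrightarrow>
     bij \<alpha> \<and> (\<forall>S T. \<alpha> (inf S T) = inf (\<alpha> S) (\<alpha> T)) \<and>
     (\<forall>S T. \<alpha> (sup S T) = sup (\<alpha> S) (\<alpha> T)) \<and> (\<forall>S. \<alpha> (- S) = - \<alpha> S)"


section \<open>Metric reduced products\<close>

definition uniformly_bounded_diameter :: "(nat \<Rightarrow> 'a metric) \<Rightarrow> bool" where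
  "uniformly_bounded_diameter M \<longleftrightarrow>
     (\<exists>C. \<forall>n. \<forall>x\<in>mspace (M n). \<forall>y\<in>mspace (M n). mdist (M n) x y \<le> C)"

definition seq_product :: "(nat \<Rightarrow> 'a metric) \<Rightarrow> (nat \<Rightarrow> 'a) set" where
  "seq_product M = {a. \<forall>n. a n \<in> mspace (M n)}"

definition null_rel :: "(nat \<Rightarrow> 'a metric) \<Rightarrow> (nat \<Rightarrow> 'a) rel" where
  "null_rel M = {(a, b). a \<in> seq_product M \<and> b \<in> seq_product M \<and>
                         (\<lambda>n. mdist (M n) (a n) (b n)) \<longlonglongrightarrow> 0}"

definition reduced_product :: "(nat \<Rightarrow> 'a metric) \<Rightarrow> (nat \<Rightarrow> 'a) set set" where
  "reduced_product M = seq_product M // null_rel M"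

abbreviation null_class :: "(nat \<Rightarrow> 'a metric) \<Rightarrow> (nat \<Rightarrow> 'a) \<Rightarrow> (nat \<Rightarrow> 'a) set" where
  "null_class M a \<equiv> null_rel M `` {a}"

text \<open>
  The upper limit of \<open>d\<^sub>n(a\<^sub>n, b\<^sub>n)\<close> as \<open>n\<close> tends to infinity within \<open>S\<close>. It is formed in the
  extended reals, and it is finite if the diameters are uniformly bounded.
\<close>

lift_definition seq_dist_on ::
  "(nat \<Rightarrow> 'a metric) \<Rightarrow> nat_set_mod_fin \<Rightarrow> (nat \<Rightarrow> 'a) \<Rightarrow> (nat \<Rightarrow> 'a) \<Rightarrow> ereal" is
  "\<lambda>M S a b. if finite S then 0
             else Limsup (inf sequentially (principal S)) (\<lambda>n. ereal (mdist (M n) (a n) (b n)))"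
proof -
  fix M :: "nat \<Rightarrow> 'a metric" and S T :: "nat set"
  assume fin: "finite (sym_diff S T)"
  have "finite S \<longleftrightarrow> finite T"
    using fin by (metis Diff_infinite_finite finite_Un)
  moreover have "inf sequentially (principal S) = inf sequentially (principal T)"
  proof -
    have "eventually (\<lambda>n. n \<notin> sym_diff S T) cofinite"
      using fin unfolding eventually_cofinite by (rule rev_finite_subset) auto
    then have "eventually (\<lambda>n. n \<notin> sym_diff S T) sequentially"
      by (simp add: cofinite_eq_sequentially)
    then have ev: "eventually (\<lambda>n. n \<in> S \<longleftrightarrow> n \<in> T) sequentially"
      by eventually_elim auto
    have "eventually (\<lambda>n. n \<in> S \<longrightarrow> P n) sequentially \<longleftrightarrow>
          eventually (\<lambda>n. n \<in> T \<longrightarrow> P n) sequentially" for P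
      by (rule eventually_subst) (use ev in eventually_elim, auto)
    then show ?thesis
      by (simp add: filter_eq_iff eventually_inf_principal)
  qed
  ultimately show
    "(\<lambda>a b. if finite S then 0
            else Limsup (inf sequentially (principal S)) (\<lambda>n. ereal (mdist (M n) (a n) (b n)))) =
     (\<lambda>a b. if finite T then 0
            else Limsup (inf sequentially (principal T)) (\<lambda>n. ereal (mdist (M n) (a n) (b n))))"
    by (intro ext) simp
qed

text \<open>
  The pseudometric \<open>d\<^sup>S\<close> on the reduced product; the metric of the reduced product is \<open>d\<^sup>S\<close> for
  \<open>S = top\<close>. Lemma \<open>dist_on_classes\<close> shows that the choice of representatives does not matter.
\<close>

definition dist_on ::
  "(nat \<Rightarrow> 'a metric) \<Rightarrow> nat_set_mod_fin \<Rightarrow> (nat \<Rightarrow> 'a) set \<Rightarrow> (nat \<Rightarrow> 'a) set \<Rightarrow> ereal" where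
  "dist_on M S x y = seq_dist_on M S (SOME a. a \<in> x) (SOME b. b \<in> y)"

definition eq_on ::
  "(nat \<Rightarrow> 'a metric) \<Rightarrow> nat_set_mod_fin \<Rightarrow> (nat \<Rightarrow> 'a) set \<Rightarrow> (nat \<Rightarrow> 'a) set \<Rightarrow> bool" where
  "eq_on M S x y \<longleftrightarrow> dist_on M S x y = 0"


section \<open>Coordinate respecting and trivial functions\<close>

definition coordinate_respecting ::
  "(nat \<Rightarrow> 'a metric) \<Rightarrow> (nat \<Rightarrow> 'b metric) \<Rightarrow> ((nat \<Rightarrow> 'a) set \<Rightarrow> (nat \<Rightarrow> 'b) set) \<Rightarrow> bool" where
  "coordinate_respecting M N \<phi> \<longleftrightarrow>
     (\<exists>\<alpha> :: nat_set_mod_fin \<Rightarrow> nat_set_mod_fin. boolean_automorphism \<alpha> \<and>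
        (\<forall>S. \<forall>a\<in>reduced_product M. \<forall>b\<in>reduced_product M.
           eq_on M S a b \<longrightarrow> eq_on N (\<alpha> S) (\<phi> a) (\<phi> b)))"

text \<open>An almost permutation with domain \<open>A\<close>; its values outside \<open>A\<close> carry no meaning.\<close>

definition almost_permutation :: "nat set \<Rightarrow> (nat \<Rightarrow> nat) \<Rightarrow> bool" where
  "almost_permutation A f \<longleftrightarrow> finite (- A) \<and> finite (- (f ` A)) \<and> inj_on f A"

definition trivial_map ::
  "(nat \<Rightarrow> 'a metric) \<Rightarrow> (nat \<Rightarrow> 'b metric) \<Rightarrow> ((nat \<Rightarrow> 'a) set \<Rightarrow> (nat \<Rightarrow> 'b) set) \<Rightarrow> bool" where
  "trivial_map M N \<phi> \<longleftrightarrow>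
     (\<exists>A f h. almost_permutation A f \<and>
        (\<forall>n\<in>A. h n \<in> mspace (M (f n)) \<rightarrow> mspace (N n)) \<and>
        (\<forall>a\<in>seq_product M. \<exists>b\<in>seq_product N.
           (\<forall>n\<in>A. b n = h n (a (f n))) \<and> \<phi> (null_class M a) = null_class N b))"


section \<open>Adequacy of the definitions\<close>

lemma equiv_null_rel: "equiv (seq_product M) (null_rel M)"
proof (rule equivI)
  show "null_rel M \<subseteq> seq_product M \<times> seq_product M"
    by (auto simp: null_rel_def)
  show "refl_on (seq_product M) (null_rel M)"
    by (auto simp: refl_on_def null_rel_def seq_product_def mdist_zero[THEN iffD2, OF _ _ refl])
  show "sym (null_rel M)"
    by (auto simp: sym_def null_rel_def mdist_commute)
  show "trans (null_rel M)"
  proof (rule transI)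
    fix a b c assume ab: "(a, b) \<in> null_rel M" and bc: "(b, c) \<in> null_rel M"
    have mem: "a n \<in> mspace (M n)" "b n \<in> mspace (M n)" "c n \<in> mspace (M n)" for n
      using ab bc by (auto simp: null_rel_def seq_product_def)
    have "(\<lambda>n. mdist (M n) (a n) (b n) + mdist (M n) (b n) (c n)) \<longlonglongrightarrow> 0 + 0"
      using ab bc by (intro tendsto_add) (auto simp: null_rel_def)
    then have lim: "(\<lambda>n. mdist (M n) (a n) (b n) + mdist (M n) (b n) (c n)) \<longlonglongrightarrow> 0"
      by simp
    have "(\<lambda>n. mdist (M n) (a n) (c n)) \<longlonglongrightarrow> 0"
      by (rule tendsto_sandwich[OF _ _ tendsto_const lim])
        (use mem in \<open>auto intro!: always_eventually mdist_triangle\<close>)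
    then show "(a, c) \<in> null_rel M"
      using ab bc by (auto simp: null_rel_def)
  qed
qed

lemma seq_dist_on_mod_fin:
  "seq_dist_on M (mod_fin S) a b =
     (if finite S then 0
      else Limsup (inf sequentially (principal S)) (\<lambda>n. ereal (mdist (M n) (a n) (b n))))"
  by transfer simp

lemma seq_dist_on_le:
  assumes "(a, a') \<in> null_rel M" "(b, b') \<in> null_rel M"
  shows "seq_dist_on M S a b \<le> seq_dist_on M S a' b'"
proof -
  have "\<exists>A. S = mod_fin A"
    by (induct S rule: nat_set_mod_fin.abs_induct) blast
  then obtain A where S: "S = mod_fin A" ..
  show ?thesis
  proof (cases "finite A")
    case True
    then show ?thesis by (simp add: S seq_dist_on_mod_fin)
  next
    case False
    let ?F = "inf sequentially (principal A)"
    let ?d = "\<lambda>x y n. mdist (M n) (x n) (y n)"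
    have F: "?F \<noteq> bot"
      using False unfolding trivial_limit_def eventually_inf_principal eventually_sequentially
      by (metis infinite_nat_iff_unbounded_le)
    have "(\<lambda>n. ?d a a' n + ?d b b' n) \<longlonglongrightarrow> 0 + 0"
      using assms by (intro tendsto_add) (auto simp: null_rel_def)
    then have lim: "(\<lambda>n. ?d a a' n + ?d b b' n) \<longlonglongrightarrow> 0" by simp
    have "Limsup ?F (\<lambda>n. ereal (?d a b n)) \<le> Limsup ?F (\<lambda>n. ereal (?d a' b' n)) + ereal \<epsilon>"
      if \<epsilon>: "0 < \<epsilon>" for \<epsilon>
    proof -
      have "eventually (\<lambda>n. ?d a a' n + ?d b b' n < \<epsilon>) sequentially"
        using order_tendstoD(2)[OF lim \<epsilon>] .
      then have "eventually (\<lambda>n. ?d a a' n + ?d b b' n < \<epsilon>) ?F"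
        by (rule filter_leD[OF inf_le1])
      then have "eventually (\<lambda>n. ereal (?d a b n) \<le> ereal (?d a' b' n) + ereal \<epsilon>) ?F"
      proof eventually_elim
        case (elim n)
        have "a n \<in> mspace (M n)" "a' n \<in> mspace (M n)" "b n \<in> mspace (M n)" "b' n \<in> mspace (M n)"
          using assms by (auto simp: null_rel_def seq_product_def)
        then have "?d a b n \<le> ?d a a' n + ?d a' b' n + ?d b b' n"
          using mdist_triangle[of "a n" "M n" "a' n" "b n"]
            mdist_triangle[of "a' n" "M n" "b' n" "b n"] mdist_commute[of "M n" "b n" "b' n"]
          by linarith
        then show ?case using elim by simp
      qed
      then have "Limsup ?F (\<lambda>n. ereal (?d a b n)) \<le> Limsup ?F (\<lambda>n. ereal (?d a' b' n) + ereal \<epsilon>)"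
        by (rule Limsup_mono)
      also have "\<dots> = Limsup ?F (\<lambda>n. ereal (?d a' b' n)) + ereal \<epsilon>"
        by (rule Limsup_add_ereal_right[OF F]) simp
      finally show ?thesis .
    qed
    then have "Limsup ?F (\<lambda>n. ereal (?d a b n)) \<le> Limsup ?F (\<lambda>n. ereal (?d a' b' n))"
      by (rule ereal_le_epsilon2)
    then show ?thesis
      using False by (simp add: S seq_dist_on_mod_fin)
  qed
qed

lemma dist_on_classes:
  assumes "a \<in> seq_product M" "b \<in> seq_product M"
  shows "dist_on M S (null_class M a) (null_class M b) = seq_dist_on M S a b"
proof -
  have rep: "(c, SOME c'. c' \<in> null_class M c) \<in> null_rel M" if "c \<in> seq_product M" for c
    using someI[of "\<lambda>c'. c' \<in> null_class M c" c] equiv_class_self[OF equiv_null_rel that] by simp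
  have sym: "(d, c) \<in> null_rel M" if "(c, d) \<in> null_rel M" for c d
    using equiv_null_rel that by (meson equivE symD)
  show ?thesis
    unfolding dist_on_def
    by (intro antisym seq_dist_on_le rep assms sym[OF rep])
qed

lemma continuum_inj_on:
  assumes "A \<lesssim> (UNIV :: nat set set)"
  obtains h :: "'a \<Rightarrow> real" where "inj_on h A"
proof -
  have "A \<lesssim> (UNIV :: real set)"
    using assms nat_sets_eqpoll_reals by (meson eqpoll_imp_lepoll lepoll_trans)
  then obtain h :: "'a \<Rightarrow> real" where "inj_on h A"
    unfolding lepoll_def by blast
  then show thesis by (rule that)
qed

lemma separable_metrizable_lepoll:
  fixes X :: "'a topology"
  assumes "separable_space X" "metrizable_space X"
  shows "topspace X \<lesssim> (UNIV :: nat set set)"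
proof -
  obtain M d where "Metric_space M d" and X: "X = Metric_space.mtopology M d"
    using assms(2) by (auto simp: metrizable_space_def)
  interpret Metric_space M d by fact
  obtain C where C: "countable C" "C \<subseteq> M" "mtopology closure_of C = M"
    using assms(1) by (auto simp: separable_space_def X)
  define g where "g x = {prod_encode (to_nat_on C c, k) | c k. c \<in> C \<and> d x c < inverse (Suc k)}" for x
  have "inj_on g M"
  proof (rule inj_onI, rule ccontr)
    fix x y assume x: "x \<in> M" and y: "y \<in> M" and g: "g x = g y" and "x \<noteq> y"
    then have "0 < d x y / 2" by simp
    then obtain k where k: "inverse (real (Suc k)) < d x y / 2"
      using reals_Archimedean by blast
    have "x \<in> mtopology closure_of C" using C x by simp
    then obtain c where c: "c \<in> C" "d x c < inverse (Suc k)"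
      unfolding metric_closure_of
      by (auto simp: in_mball dest!: spec[of _ "inverse (real (Suc k))"])
    then have "prod_encode (to_nat_on C c, k) \<in> g x"
      unfolding g_def by blast
    then have "prod_encode (to_nat_on C c, k) \<in> g y"
      using g by simp
    then have "d y c < inverse (Suc k)"
      using c C by (auto simp: g_def prod_encode_eq)
    moreover have "d x y \<le> d x c + d y c"
      using triangle[of x c y] x y c C commute[of c y] by auto
    ultimately show False using c k by linarith
  qed
  then show ?thesis
    by (auto simp: lepoll_def X)
qed

lemma oca_dichotomy_homeomorphic:
  fixes X :: "'a topology" and Y :: "'b topology"
  assumes g: "homeomorphic_map Y X g" and "oca_dichotomy Y"
  shows "oca_dichotomy X"
  unfolding oca_dichotomy_def
proof (intro allI impI)
  fix K assume K: "open_colouring X K"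
  have inj: "inj_on g (topspace Y)" and img: "g ` topspace Y = topspace X"
    and cont: "continuous_map Y X g"
    using g by (auto simp: homeomorphic_eq_everything_map)
  define K' where "K' = {e \<in> [topspace Y]\<^bsup>2\<^esup>. g ` e \<in> K}"
  have nsets_image: "g ` e \<in> [g ` H]\<^bsup>2\<^esup>" if "e \<in> [H]\<^bsup>2\<^esup>" "H \<subseteq> topspace Y" for e H
    using that inj by (auto simp: nsets_def card_image inj_on_subset)
  have nsets_preimage: "\<exists>e'\<in>[H]\<^bsup>2\<^esup>. e = g ` e'" if e: "e \<in> [g ` H]\<^bsup>2\<^esup>" and H: "H \<subseteq> topspace Y" for e H
  proof -
    obtain e' where e': "e' \<subseteq> H" "e = g ` e'"
      using e unfolding nsets_def by (auto simp: subset_image_iff)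
    then have "inj_on g e'" using inj H inj_on_subset by blast
    then show ?thesis
      using e e' by (auto simp: nsets_def card_image finite_image_iff intro!: bexI[of _ e'])
  qed
  have eq: "{(x, y). {x, y} \<in> K'} =
        {p \<in> topspace (prod_topology Y Y). (case p of (x, y) \<Rightarrow> (g x, g y)) \<in> {(x, y). {x, y} \<in> K}}"
  proof -
    have "{x, y} \<in> [topspace Y]\<^bsup>2\<^esup>" if "x \<in> topspace Y" "y \<in> topspace Y" "{g x, g y} \<in> K" for x y
    proof -
      have "card {g x, g y} = 2"
        using K that by (auto simp: open_colouring_def nsets_def)
      then have "x \<noteq> y" by auto
      then show ?thesis using that by (simp add: nsets_def)
    qed
    then show ?thesis
      by (auto simp: K'_def nsets_def)
  qed
  have "continuous_map (prod_topology Y Y) (prod_topology X X) (\<lambda>(x, y). (g x, g y))"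
    using cont by (simp add: continuous_map_prod_top)
  then have "openin (prod_topology Y Y) {(x, y). {x, y} \<in> K'}"
    unfolding eq by (rule openin_continuous_map_preimage) (use K in \<open>simp add: open_colouring_def\<close>)
  then have "open_colouring Y K'"
    by (auto simp: open_colouring_def K'_def)
  then consider H where "H \<subseteq> topspace Y" "uncountable H" "[H]\<^bsup>2\<^esup> \<subseteq> K'"
    | Z :: "nat \<Rightarrow> 'b set" where "(\<Union>n. Z n) = topspace Y" "\<And>n. [Z n]\<^bsup>2\<^esup> \<inter> K' = {}"
    using assms(2) unfolding oca_dichotomy_def by metis
  then show "(\<exists>H. H \<subseteq> topspace X \<and> uncountable H \<and> [H]\<^bsup>2\<^esup> \<subseteq> K) \<or>
        (\<exists>Y :: nat \<Rightarrow> 'a set. (\<Union>n. Y n) = topspace X \<and> (\<forall>n. [Y n]\<^bsup>2\<^esup> \<inter> K = {}))"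
  proof cases
    case 1
    have "uncountable (g ` H)"
      using 1 inj countable_image_inj_on inj_on_subset by blast
    moreover have "[g ` H]\<^bsup>2\<^esup> \<subseteq> K"
    proof
      fix e assume "e \<in> [g ` H]\<^bsup>2\<^esup>"
      then obtain e' where "e' \<in> [H]\<^bsup>2\<^esup>" "e = g ` e'"
        using nsets_preimage 1(1) by blast
      then show "e \<in> K" using 1(3) by (auto simp: K'_def)
    qed
    moreover have "g ` H \<subseteq> topspace X"
      using 1(1) img by blast
    ultimately show ?thesis
      by (intro disjI1 exI[of _ "g ` H"] conjI)
  next
    case 2
    have "(\<Union>n. g ` Z n) = topspace X"
      unfolding img[symmetric] 2(1)[symmetric] by (rule image_UN[symmetric])
    moreover have "[g ` Z n]\<^bsup>2\<^esup> \<inter> K = {}" for n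
    proof -
      have Zn: "Z n \<subseteq> topspace Y" using 2(1) by auto
      have "g ` e \<notin> K" if e: "e \<in> [Z n]\<^bsup>2\<^esup>" for e
      proof
        assume "g ` e \<in> K"
        moreover have "e \<in> [topspace Y]\<^bsup>2\<^esup>"
          using e Zn by (auto simp: nsets_def)
        ultimately have "e \<in> K'" by (simp add: K'_def)
        then show False using e 2(2)[of n] by blast
      qed
      then show ?thesis
        using nsets_preimage[OF _ Zn] by blast
    qed
    ultimately show ?thesis
      by (intro disjI2 exI[of _ "\<lambda>n. g ` Z n"] conjI allI)
  qed
qed

lemma OCA_all_types:
  fixes X :: "'a topology"
  assumes OCA "separable_space X" "metrizable_space X"
  shows "oca_dichotomy X"
proof -
  obtain h :: "'a \<Rightarrow> real" where h: "inj_on h (topspace X)"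
    using continuum_inj_on separable_metrizable_lepoll assms by blast
  define g where "g = inv_into (topspace X) h"
  define Y where "Y = pullback_topology (h ` topspace X) g X"
  have gh: "g (h x) = x" if "x \<in> topspace X" for x
    using h that by (simp add: g_def)
  have top: "topspace Y = h ` topspace X"
    by (auto simp: Y_def topspace_pullback_topology gh)
  have "continuous_map X Y h"
    unfolding Y_def
  proof (rule continuous_map_pullback')
    show "continuous_map X X (g \<circ> h)"
      by (rule continuous_map_eq[OF continuous_map_id]) (simp add: gh)
  qed auto
  moreover have "continuous_map Y X g"
    unfolding Y_def using continuous_map_pullback[OF continuous_map_id] by simp
  ultimately have "homeomorphic_maps Y X g h"
    by (auto simp: homeomorphic_maps_def top gh)
  then have hom: "homeomorphic_map Y X g" and space: "X homeomorphic_space Y"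
    using homeomorphic_maps_imp_map homeomorphic_maps_sym homeomorphic_space_def by metis+
  have "separable_space Y" "metrizable_space Y"
    using assms homeomorphic_separable_space[OF space] homeomorphic_metrizable_space[OF space]
    by simp_all
  then have "oca_dichotomy Y"
    using assms by (auto simp: OCA_def)
  then show ?thesis
    by (rule oca_dichotomy_homeomorphic[OF hom])
qed

lemma generic_filter_small_suborder:
  fixes P :: "'p set" and h :: "'p \<Rightarrow> real"
  assumes MA: MA_sigma_linked
    and Q: "Q \<subseteq> P" "Q \<noteq> {}" "inj_on h Q"
    and P: "partial_order_on P r" "sigma_linked P r"
    and comp: "\<And>p q. p \<in> Q \<Longrightarrow> q \<in> Q \<Longrightarrow> compatible P r p q \<Longrightarrow> compatible Q r p q"
    and card: "|\<D>| \<le>o cardSuc natLeq"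
    and dense: "\<And>D. D \<in> \<D> \<Longrightarrow> D \<subseteq> P \<and> (\<forall>p\<in>Q. \<exists>q\<in>D \<inter> Q. (q, p) \<in> r)"
  shows "\<exists>G. poset_filter P r G \<and> (\<forall>D\<in>\<D>. G \<inter> D \<noteq> {})"
proof -
  have refl: "(p, p) \<in> r" if "p \<in> P" for p
    using P(1) that by (auto simp: partial_order_on_def preorder_on_def refl_on_def)
  have trans: "(x, z) \<in> r" if "(x, y) \<in> r" "(y, z) \<in> r" for x y z
    using P(1) that by (meson partial_order_onD(2) transD)
  have anti: "x = y" if "(x, y) \<in> r" "(y, x) \<in> r" for x y
    using P(1) that by (meson partial_order_onD(3) antisymD)
  define r' where "r' = (\<lambda>(x, y). (h x, h y)) ` (r \<inter> Q \<times> Q)"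
  have r': "(h x, h y) \<in> r' \<longleftrightarrow> (x, y) \<in> r" if "x \<in> Q" "y \<in> Q" for x y
    using that Q(3) by (auto simp: r'_def inj_on_def)
  have "partial_order_on (h ` Q) r'"
    unfolding partial_order_on_def preorder_on_def
  proof (intro conjI)
    show "r' \<subseteq> h ` Q \<times> h ` Q" by (auto simp: r'_def)
    show "refl_on (h ` Q) r'" using Q(1) by (auto simp: refl_on_def r' refl)
    show "trans r'"
    proof (rule transI)
      fix x y z assume xy: "(x, y) \<in> r'" and yz: "(y, z) \<in> r'"
      obtain a b where ab: "x = h a" "y = h b" "a \<in> Q" "b \<in> Q"
        using xy by (auto simp: r'_def)
      obtain c where c: "z = h c" "c \<in> Q"
        using yz by (auto simp: r'_def)
      show "(x, z) \<in> r'"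
        using xy yz ab c trans by (auto simp: r')
    qed
    show "antisym r'"
    proof (rule antisymI)
      fix x y assume xy: "(x, y) \<in> r'" and yx: "(y, x) \<in> r'"
      obtain a b where ab: "x = h a" "y = h b" "a \<in> Q" "b \<in> Q"
        using xy by (auto simp: r'_def)
      then show "x = y" using xy yx anti by (auto simp: r')
    qed
  qed
  moreover have "sigma_linked (h ` Q) r'"
  proof -
    obtain L :: "nat \<Rightarrow> 'p set" where L: "P = (\<Union>n. L n)"
      "\<And>n p q. p \<in> L n \<Longrightarrow> q \<in> L n \<Longrightarrow> compatible P r p q"
      using P(2) by (auto simp: sigma_linked_def)
    have "compatible (h ` Q) r' (h p) (h q)" if "p \<in> L n \<inter> Q" "q \<in> L n \<inter> Q" for n p q
    proof -
      have "compatible Q r p q"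
        using that L(2) comp by blast
      then show ?thesis
        using that by (auto simp: compatible_def r')
    qed
    then show ?thesis
      unfolding sigma_linked_def using Q(1) L(1)
      by (intro exI[of _ "\<lambda>n. h ` (L n \<inter> Q)"]) blast
  qed
  ultimately have gen: "generic_filters_aleph1 (h ` Q) r'"
    using MA Q(2) by (auto simp: MA_sigma_linked_def)
  let ?\<E> = "(\<lambda>D. h ` (D \<inter> Q)) ` \<D>"
  have "|?\<E>| \<le>o cardSuc natLeq"
    using card_of_image card ordLeq_transitive by blast
  moreover have "dense_subset (h ` Q) r' E" if E: "E \<in> ?\<E>" for E
  proof -
    obtain D where D: "D \<in> \<D>" "E = h ` (D \<inter> Q)"
      using E by blast
    have "\<exists>y\<in>E. (y, h p) \<in> r'" if p: "p \<in> Q" for p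
    proof -
      obtain q where "q \<in> D \<inter> Q" "(q, p) \<in> r"
        using dense[OF D(1)] p by blast
      then show ?thesis
        using p D(2) by (auto simp: r' intro!: bexI[of _ "h q"])
    qed
    then show ?thesis
      using D(2) by (auto simp: dense_subset_def)
  qed
  ultimately obtain G' where G': "poset_filter (h ` Q) r' G'" "\<And>E. E \<in> ?\<E> \<Longrightarrow> G' \<inter> E \<noteq> {}"
    using gen unfolding generic_filters_aleph1_def by meson
  define G where "G = {p \<in> P. \<exists>q\<in>Q. h q \<in> G' \<and> (q, p) \<in> r}"
  have "poset_filter P r G"
    unfolding poset_filter_def
  proof (intro conjI ballI impI)
    show "G \<subseteq> P" by (auto simp: G_def)
    obtain x where "x \<in> G'" "x \<in> h ` Q"
      using G'(1) unfolding poset_filter_def by blast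
    then show "G \<noteq> {}"
      using refl Q(1) by (auto simp: G_def)
    show "q \<in> G" if "p \<in> G" "q \<in> P" "(p, q) \<in> r" for p q
      using that trans by (auto simp: G_def)
    show "\<exists>s\<in>G. (s, p) \<in> r \<and> (s, q) \<in> r" if pG: "p \<in> G" "q \<in> G" for p q
    proof -
      obtain p' q' where pq: "p' \<in> Q" "h p' \<in> G'" "(p', p) \<in> r" "q' \<in> Q" "h q' \<in> G'" "(q', q) \<in> r"
        using pG by (auto simp: G_def)
      then obtain x where x: "x \<in> G'" "(x, h p') \<in> r'" "(x, h q') \<in> r'"
        using G'(1) unfolding poset_filter_def by meson
      then obtain s where s: "s \<in> Q" "x = h s"
        using G'(1) unfolding poset_filter_def by blast
      have "s \<in> G" using s x Q(1) refl by (auto simp: G_def)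
      moreover have "(s, p) \<in> r" "(s, q) \<in> r"
        using s x pq r' trans by blast+
      ultimately show ?thesis by blast
    qed
  qed
  moreover have "G \<inter> D \<noteq> {}" if D: "D \<in> \<D>" for D
  proof -
    obtain q where "q \<in> D \<inter> Q" "h q \<in> G'"
      using G'(2)[of "h ` (D \<inter> Q)"] D by blast
    then show ?thesis
      using Q(1) refl by (auto simp: G_def)
  qed
  ultimately show ?thesis by blast
qed

lemma MA_sigma_linked_all_types:
  fixes P :: "'p set"
  assumes MA: MA_sigma_linked
    and P: "P \<noteq> {}" "partial_order_on P r" "sigma_linked P r"
  shows "generic_filters_aleph1 P r"
  unfolding generic_filters_aleph1_def
proof (intro allI impI, elim conjE)
  fix \<D> :: "'p set set"
  assume card: "|\<D>| \<le>o cardSuc natLeq" and dense: "\<forall>D\<in>\<D>. dense_subset P r D"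
  obtain p0 where p0: "p0 \<in> P" using P(1) by blast
  define w where "w p q = (SOME s. s \<in> P \<and> (s, p) \<in> r \<and> (s, q) \<in> r)" for p q
  define e where "e D p = (SOME q. q \<in> D \<and> (q, p) \<in> r)" for D p
  have w: "w p q \<in> P \<and> (w p q, p) \<in> r \<and> (w p q, q) \<in> r" if "compatible P r p q" for p q
    unfolding w_def by (rule someI_ex) (use that in \<open>auto simp: compatible_def\<close>)
  have e: "e D p \<in> D \<and> (e D p, p) \<in> r" if "D \<in> \<D>" "p \<in> P" for D p
    unfolding e_def by (rule someI_ex) (use that dense in \<open>unfold dense_subset_def, blast\<close>)
  define step where
    "step A = A \<union> (\<lambda>(p, q). w p q) ` (A \<times> A) \<union> (\<lambda>(D, p). e D p) ` (\<D> \<times> A)" for A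
  define R where "R = (\<Union>n. (step ^^ n) {p0})"
  define Q where "Q = R \<inter> P"
  let ?c = "|UNIV :: nat set set|"
  have inf: "infinite (UNIV :: nat set set)"
    by (simp add: Finite_Set.finite_set)
  then have inf_Field: "infinite (Field ?c)"
    unfolding Field_card_of .
  have "natLeq <o ?c"
    using card_of_Pow[of "UNIV :: nat set"] card_of_nat ordIso_ordLess_trans ordIso_symmetric
    by (metis Pow_UNIV)
  then have "cardSuc natLeq \<le>o ?c"
    using cardSuc_least natLeq_Card_order card_of_Card_order by blast
  then have D: "|\<D>| \<le>o ?c"
    using card ordLeq_transitive by blast
  have step: "|step A| \<le>o ?c" if "|A| \<le>o ?c" for A
    unfolding step_def
    by (intro card_of_Un_ordLeq_infinite_Field card_of_Times_ordLeq_infinite_Field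
        ordLeq_transitive[OF card_of_image] that D inf_Field card_of_Card_order)
  have iter: "|(step ^^ n) {p0}| \<le>o ?c" for n
  proof (induction n)
    case 0
    show ?case using card_of_singl_ordLeq[of "UNIV :: nat set set" p0] by simp
  next
    case (Suc n)
    then show ?case using step by simp
  qed
  have nat: "|UNIV :: nat set| \<le>o ?c"
    by (rule card_of_ordLeqI[of "\<lambda>n. {n}"]) auto
  have "|R| \<le>o ?c"
    unfolding R_def by (rule card_of_UNION_ordLeq_infinite[OF inf nat]) (use iter in blast)
  then have "Q \<lesssim> (UNIV :: nat set set)"
    unfolding Q_def lepoll_def by (meson Int_lower1 card_of_mono1 card_of_ordLeq ordLeq_transitive)
  then obtain h :: "'p \<Rightarrow> real" where h: "inj_on h Q"
    using continuum_inj_on by blast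
  have mono: "(step ^^ m) {p0} \<subseteq> (step ^^ n) {p0}" if "m \<le> n" for m n
    using that by (induction n rule: dec_induct) (auto simp: step_def)
  have clos_w: "w p q \<in> R" if R: "p \<in> R" "q \<in> R" for p q
  proof -
    obtain m n where "p \<in> (step ^^ m) {p0}" "q \<in> (step ^^ n) {p0}"
      using R by (auto simp: R_def)
    then have "p \<in> (step ^^ max m n) {p0}" "q \<in> (step ^^ max m n) {p0}"
      using mono[of m "max m n"] mono[of n "max m n"] by auto
    then have "w p q \<in> (step ^^ Suc (max m n)) {p0}"
      by (auto simp: step_def)
    then show ?thesis unfolding R_def by blast
  qed
  have clos_e: "e D p \<in> R" if R: "p \<in> R" and D: "D \<in> \<D>" for p D
  proof -
    obtain m where "p \<in> (step ^^ m) {p0}"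
      using R by (auto simp: R_def)
    then have "e D p \<in> (step ^^ Suc m) {p0}"
      using D by (auto simp: step_def)
    then show ?thesis unfolding R_def by blast
  qed
  show "\<exists>G. poset_filter P r G \<and> (\<forall>D\<in>\<D>. G \<inter> D \<noteq> {})"
  proof (rule generic_filter_small_suborder[OF MA _ _ h P(2,3) _ card])
    show "Q \<subseteq> P" by (simp add: Q_def)
    have "p0 \<in> (step ^^ 0) {p0}" by simp
    then show "Q \<noteq> {}" using p0 unfolding Q_def R_def by blast
    show "compatible Q r p q" if "p \<in> Q" "q \<in> Q" "compatible P r p q" for p q
      unfolding compatible_def
    proof (intro bexI conjI)
      show "(w p q, p) \<in> r" "(w p q, q) \<in> r"
        using w that(3) by simp_all
      show "w p q \<in> Q"
        using w that clos_w by (simp add: Q_def)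
    qed
    show "D \<subseteq> P \<and> (\<forall>p\<in>Q. \<exists>q\<in>D \<inter> Q. (q, p) \<in> r)" if D: "D \<in> \<D>" for D
    proof (intro conjI ballI bexI)
      show DP: "D \<subseteq> P"
        using dense D by (simp add: dense_subset_def)
      show "(e D p, p) \<in> r" if "p \<in> Q" for p
        using e D that by (simp add: Q_def)
      show "e D p \<in> D \<inter> Q" if "p \<in> Q" for p
        using e[of D p] clos_e[of p D] D that DP by (auto simp: Q_def)
    qed
  qed
qed

end

theory Submission
  imports Defs "HOL-Library.Countable_Set_Type" "HOL-Library.Sublist"
begin

text \<open>
  Only finite information about two objects is needed to see that they conflict, so OCA either covers all
  objects by countably many conflict-free pieces or yields uncountably many pairwise conflicting ones. In
  the latter case a \<open>\<sigma>\<close>-linked forcing adds one sequence \<open>c\<close> on which uncountably many of the objects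
  visibly conflict in pairs; the value of the given map at \<open>c\<close> then refutes this. In the former case each
  piece defines a candidate for the coordinate maps, and if every candidate failed, splicing countably
  many counterexamples along disjoint infinite sets would give a sequence that belongs to no piece.

  This is applied first to the automorphism \<open>\<alpha>\<close>. Along the branches of a tree-like family, the covering
  makes \<open>\<alpha>\<close> and its inverse continuous on each of countably many pieces; predicting the bits of a set by
  using the two continuous maps in turn is impossible for all sets, so \<open>\<alpha>\<close> is local, hence trivial, on many
  sets, and conflicts between local trivialisations are excluded as above. Once \<open>\<alpha>\<close> is a permutation, the
  same scheme produces the coordinate maps: up to an error \<open>\<epsilon>\<close> on many sets, then up to \<open>8\<epsilon>\<close> everywhere.
  Separability allows one to replace the spaces by countable ones.
\<close>

section \<open>The axioms in combinatorial form\<close>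

text \<open>OCA needs conflicts decided by initial segments. Agreement of two sets on the common
  part of two branches is such a condition only if that part is finite and fixed by initial segments
  of the branches; hence tree-like families rather than merely almost disjoint ones.

  A lift of a map between quotients obeys each law only beyond a threshold depending on the
  arguments. Thresholds take countably many values, so two of uncountably many objects share a
  threshold and the finite data below it; every uncountable set of conflicts is refuted in this way.

  A wrong candidate fails on an infinite set. Local solutions are therefore sought on sets that meet
  countably many prescribed infinite sets infinitely often, so that one of them captures the
  failures of all candidates.

  The constant 8 arises thus: lifts accurate to \<open>\<epsilon>\<close> agree up to
  \<open>2 * \<epsilon>\<close>, a visible conflict must exceed \<open>2 * \<epsilon>\<close>, and
  transferring it between pairs costs \<open>2 * \<epsilon>\<close> on each side. So conflicts have
  size \<open>6 * \<epsilon>\<close>; the accuracy of the local lift and the splicing add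
  \<open>\<epsilon>\<close> each.\<close>

lemma open_agree_below: "open {g :: nat \<Rightarrow> nat. \<forall>n<m. g n = f n}"
proof -
  have "{g :: nat \<Rightarrow> nat. \<forall>n<m. g n = f n} = (\<Inter>n\<in>{..<m}. (\<lambda>g. g n) -` {f n})"
    by auto
  moreover have "open ((\<lambda>g :: nat \<Rightarrow> nat. g n) -` {f n})" for n
    by (rule open_vimage) (auto simp: open_discrete intro: continuous_intros)
  ultimately show ?thesis by (simp add: open_INT)
qed

lemma metrizable_space_Baire: "metrizable_space (euclidean :: (nat \<Rightarrow> nat) topology)"
proof -
  have "(euclidean :: nat topology) = discrete_topology UNIV"
    by (simp add: topology_eq open_discrete)
  then have "metrizable_space (euclidean :: nat topology)"
    by simp
  then have "metrizable_space (product_topology (\<lambda>_ :: nat. euclidean :: nat topology) UNIV)"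
    by (simp add: metrizable_space_product_topology)
  then show ?thesis
    by (simp add: euclidean_product_topology)
qed

text \<open>The code embeds \<open>X\<close> into Baire space, and \<open>loc\<close> is openness of
  the conflict in the subspace topology. The code may also list values attached to an object, such
  as bits of its image, which makes conflicts about these values open too.\<close>

lemma OCA_coded:
  fixes e :: "'x \<Rightarrow> nat \<Rightarrow> 'c :: countable" and K :: "'x \<Rightarrow> 'x \<Rightarrow> bool"
  assumes OCA and inj: "inj_on e X"
    and sym: "\<And>u v. u \<in> X \<Longrightarrow> v \<in> X \<Longrightarrow> K u v \<Longrightarrow> K v u"
    and loc: "\<And>u v. u \<in> X \<Longrightarrow> v \<in> X \<Longrightarrow> u \<noteq> v \<Longrightarrow> K u v \<Longrightarrow>
      \<exists>m. \<forall>u'\<in>X. \<forall>v'\<in>X. (\<forall>n<m. e u' n = e u n) \<longrightarrow> (\<forall>n<m. e v' n = e v n) \<longrightarrow> u' \<noteq> v' \<and> K u' v'"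
  obtains H where "H \<subseteq> X" "uncountable H" "\<And>u v. u \<in> H \<Longrightarrow> v \<in> H \<Longrightarrow> u \<noteq> v \<Longrightarrow> K u v"
  | Y :: "nat \<Rightarrow> 'x set" where "X = (\<Union>n. Y n)"
      "\<And>n u v. u \<in> Y n \<Longrightarrow> v \<in> Y n \<Longrightarrow> u \<noteq> v \<Longrightarrow> \<not> K u v"
proof -
  define e' where "e' u = (\<lambda>n. to_nat (e u n))" for u
  have inj': "inj_on e' X"
  proof (rule inj_onI)
    fix u v assume "u \<in> X" "v \<in> X" "e' u = e' v"
    then have "e u n = e v n" for n
      unfolding e'_def by (metis from_nat_to_nat)
    then have "e u = e v" by blast
    then show "u = v" using inj \<open>u \<in> X\<close> \<open>v \<in> X\<close> by (auto simp: inj_on_def)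
  qed
  have e'_eq: "e' u n = e' v n \<longleftrightarrow> e u n = e v n" for u v n
    by (simp add: e'_def)
  define E where "E = e' ` X"
  define C where "C = {{e' u, e' v} | u v. u \<in> X \<and> v \<in> X \<and> u \<noteq> v \<and> K u v}"
  have C_iff: "{e' u, e' v} \<in> C \<longleftrightarrow> u \<noteq> v \<and> K u v" if "u \<in> X" "v \<in> X" for u v
  proof
    assume "{e' u, e' v} \<in> C"
    then obtain a b where ab: "{e' u, e' v} = {e' a, e' b}" "a \<in> X" "b \<in> X" "a \<noteq> b" "K a b"
      unfolding C_def by auto
    then have "u = a \<and> v = b \<or> u = b \<and> v = a"
      using that inj' by (auto simp: doubleton_eq_iff inj_on_eq_iff)
    then show "u \<noteq> v \<and> K u v" using ab sym by auto
  qed (use that in \<open>auto simp: C_def\<close>)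
  let ?T = "top_of_set E"
  have col: "open_colouring ?T C"
    unfolding open_colouring_def
  proof
    show "C \<subseteq> [topspace ?T]\<^bsup>2\<^esup>"
      using inj' by (auto simp: C_def E_def nsets_def inj_on_eq_iff)
    show "openin (prod_topology ?T ?T) {(x, y). {x, y} \<in> C}"
      unfolding openin_prod_topology_alt
    proof (intro allI impI)
      fix x y assume "(x, y) \<in> {(x, y). {x, y} \<in> C}"
      then have xy: "{x, y} \<in> C" by simp
      then have "x \<in> E" "y \<in> E" by (auto simp: C_def E_def doubleton_eq_iff)
      then obtain u v where uv: "u \<in> X" "v \<in> X" "x = e' u" "y = e' v"
        by (auto simp: E_def)
      then have "u \<noteq> v" "K u v" using C_iff xy by blast+
      then obtain m where m: "\<And>u' v'. u' \<in> X \<Longrightarrow> v' \<in> X \<Longrightarrow> \<forall>n<m. e u' n = e u n \<Longrightarrow>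
          \<forall>n<m. e v' n = e v n \<Longrightarrow> u' \<noteq> v' \<and> K u' v'"
        using loc[OF uv(1,2) \<open>u \<noteq> v\<close> \<open>K u v\<close>] by blast
      let ?U = "\<lambda>f. E \<inter> {g. \<forall>n<m. g n = f n}"
      have "openin ?T (?U f)" for f
        by (simp add: openin_open_Int open_agree_below)
      moreover have "x \<in> ?U x" "y \<in> ?U y" using \<open>x \<in> E\<close> \<open>y \<in> E\<close> by auto
      moreover have "?U x \<times> ?U y \<subseteq> {(x, y). {x, y} \<in> C}"
        unfolding E_def using m by (auto simp: uv e'_eq C_iff)
      ultimately show "\<exists>U V. openin ?T U \<and> openin ?T V \<and> x \<in> U \<and> y \<in> V \<and>
          U \<times> V \<subseteq> {(x, y). {x, y} \<in> C}" by blast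
    qed
  qed
  have "second_countable (euclidean :: (nat \<Rightarrow> nat) topology)"
  proof -
    obtain B :: "(nat \<Rightarrow> nat) set set" where "countable B" "topological_basis B"
      using ex_countable_basis by blast
    then show ?thesis
      unfolding second_countable_def
      using topological_basis_open[of B] topological_basisE[of B]
      by (intro exI[of _ B] conjI) (simp_all, metis)
  qed
  then have "separable_space ?T"
    by (intro second_countable_imp_separable_space second_countable_subtopology)
  moreover have "metrizable_space ?T"
    by (intro metrizable_space_subtopology metrizable_space_Baire)
  ultimately have "oca_dichotomy ?T"
    by (intro OCA_all_types[OF \<open>OCA\<close>])
  then have "(\<exists>H. H \<subseteq> topspace ?T \<and> uncountable H \<and> [H]\<^bsup>2\<^esup> \<subseteq> C) \<or>
      (\<exists>Z :: nat \<Rightarrow> (nat \<Rightarrow> nat) set. (\<Union>n. Z n) = topspace ?T \<and> (\<forall>n. [Z n]\<^bsup>2\<^esup> \<inter> C = {}))"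
    using col unfolding oca_dichotomy_def by blast
  then consider H where "H \<subseteq> E" "uncountable H" "[H]\<^bsup>2\<^esup> \<subseteq> C"
    | Z where "(\<Union>n :: nat. Z n) = E" "\<And>n. [Z n]\<^bsup>2\<^esup> \<inter> C = {}"
    unfolding topspace_euclidean_subtopology by metis
  then show thesis
  proof cases
    case 1
    define H' where "H' = X \<inter> e' -` H"
    have img: "e' ` H' = H" using 1(1) by (auto simp: H'_def E_def)
    show ?thesis
    proof (rule that(1))
      show "H' \<subseteq> X" by (auto simp: H'_def)
      show "uncountable H'" using 1(2) img by auto
      fix u v assume uv: "u \<in> H'" "v \<in> H'" "u \<noteq> v"
      then have "{e' u, e' v} \<in> [H]\<^bsup>2\<^esup>"
        using inj' by (auto simp: H'_def nsets_def inj_on_eq_iff)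
      then have "{e' u, e' v} \<in> C" using 1(3) by blast
      then show "K u v" using C_iff[of u v] uv by (simp add: H'_def)
    qed
  next
    case 2
    define Y where "Y n = X \<inter> e' -` Z n" for n
    show ?thesis
    proof (rule that(2))
      have "e' u \<in> (\<Union>n. Z n)" if "u \<in> X" for u
        unfolding 2(1) using that by (simp add: E_def)
      then show "X = (\<Union>n. Y n)" by (auto simp: Y_def)
      fix n u v assume uv: "u \<in> Y n" "v \<in> Y n" "u \<noteq> v"
      then have "{e' u, e' v} \<in> [Z n]\<^bsup>2\<^esup>"
        using inj' by (auto simp: Y_def nsets_def inj_on_eq_iff)
      then have "{e' u, e' v} \<notin> C" using 2(2)[of n] by blast
      then show "\<not> K u v" using C_iff[of u v] uv by (simp add: Y_def)
    qed
  qed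
qed

text \<open>MA meets at most aleph-one dense sets, one for each object to be captured, so
  uncountable sets are cut down to this size.\<close>

lemma uncountable_subset_aleph1:
  assumes "uncountable H"
  obtains H0 where "H0 \<subseteq> H" "uncountable H0" "|H0| \<le>o cardSuc natLeq"
proof -
  have "\<not> |H| \<le>o natLeq"
    using assms by (simp add: countable_card_le_natLeq)
  then have "natLeq <o |H|"
    using not_ordLeq_iff_ordLess[OF natLeq_Well_order card_of_Well_order, of H] by blast
  then have "cardSuc natLeq \<le>o |H|"
    by (rule cardSuc_least[OF natLeq_Card_order card_of_Card_order])
  then obtain H0 where H0: "H0 \<subseteq> H" "cardSuc natLeq =o |H0|"
    using internalize_card_of_ordLeq2[of "Field (cardSuc natLeq)" H]
      card_of_Field_ordIso[OF cardSuc_Card_order[OF natLeq_Card_order]]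
      ordIso_ordLeq_trans ordIso_symmetric ordIso_transitive
    by (smt (verit, del_insts))
  then have "natLeq <o |H0|"
    using cardSuc_greater[OF natLeq_Card_order] ordLess_ordIso_trans by blast
  then have "\<not> |H0| \<le>o natLeq"
    using not_ordLeq_ordLess by blast
  then have "uncountable H0"
    by (simp add: countable_card_le_natLeq)
  then show thesis
    using that H0 ordIso_imp_ordLeq[OF ordIso_symmetric] by blast
qed

lemma uncountable_UN_nat:
  assumes "uncountable H" "H \<subseteq> (\<Union>i :: nat. A i)"
  obtains i where "uncountable (H \<inter> A i)"
proof -
  have "H = (\<Union>i. H \<inter> A i)" using assms(2) by blast
  then have "\<exists>i. uncountable (H \<inter> A i)"
    using assms(1) by (metis countable_UN uncountable_def countableI_type)
  then show thesis using that by blast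
qed

text \<open>Typically applied to a threshold together with the finite data below it.\<close>

lemma uncountable_pigeonhole:
  fixes F :: "'x \<Rightarrow> 'c :: countable"
  assumes "uncountable H"
  obtains x y where "x \<in> H" "y \<in> H" "x \<noteq> y" "F x = F y"
proof -
  have "\<not> inj_on F H"
    using assms by (metis countableI_type countable_image_inj_on)
  then show thesis using that by (auto simp: inj_on_def)
qed

lemma uncountable_Cantor_space: "uncountable (UNIV :: (nat \<Rightarrow> bool) set)"
proof
  assume "countable (UNIV :: (nat \<Rightarrow> bool) set)"
  then obtain f :: "nat \<Rightarrow> nat \<Rightarrow> bool" where "range f = UNIV"
    using uncountable_def[of "UNIV :: (nat \<Rightarrow> bool) set"] by blast
  then obtain n where "f n = (\<lambda>i. \<not> f i i)"
    by (metis UNIV_I imageE)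
  then show False by metis
qed

lemma prefix_nth: "prefix xs ys \<Longrightarrow> n < length xs \<Longrightarrow> xs ! n = ys ! n"
  by (auto simp: prefix_def nth_append)

text \<open>
  The partial order consists of finite lists of conditions, so that a generic filter yields countably many
  sequences whose promises together exhaust the given uncountable set.
\<close>

lemma MA_generic_sequence:
  fixes wit :: "'h \<Rightarrow> 'h \<Rightarrow> 'v :: countable list \<Rightarrow> bool"
    and code :: "'v list \<Rightarrow> 'h list \<Rightarrow> 'c :: countable"
  assumes MA: MA_sigma_linked and H: "uncountable H"
  defines "cond \<equiv> \<lambda>s F. finite F \<and> F \<subseteq> H \<and> (\<forall>h\<in>F. \<forall>h'\<in>F. h \<noteq> h' \<longrightarrow> wit h h' s)"
  assumes amalg: "\<And>s xs ys. cond s (set xs) \<Longrightarrow> cond s (set ys) \<Longrightarrow> distinct xs \<Longrightarrow> distinct ys \<Longrightarrow>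
      code s xs = code s ys \<Longrightarrow> \<exists>t. cond (s @ t) (set xs \<union> set ys)"
  obtains c H' where "H' \<subseteq> H" "uncountable H'"
    "\<And>h h'. h \<in> H' \<Longrightarrow> h' \<in> H' \<Longrightarrow> h \<noteq> h' \<Longrightarrow> \<exists>m. wit h h' (map c [0..<m])"
proof -
  obtain H0 where H0: "H0 \<subseteq> H" "uncountable H0" "|H0| \<le>o cardSuc natLeq"
    using uncountable_subset_aleph1[OF H] .
  \<comment> \<open>Entry \<open>i\<close> of a condition approximates the \<open>i\<close>-th
    generic sequence by its stem \<open>s\<close>, on which the members of \<open>F\<close> already
    conflict pairwise.\<close>
  define P where "P = {p. \<forall>(s, F)\<in>set p. cond s F}"
  define le where "le p q \<longleftrightarrow> length q \<le> length p \<and>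
    (\<forall>i<length q. prefix (fst (q ! i)) (fst (p ! i)) \<and> snd (q ! i) \<subseteq> snd (p ! i))"
    for p q :: "('v list \<times> 'h set) list"
  define r where "r = {(p, q). p \<in> P \<and> q \<in> P \<and> le p q}"
  have P_nth: "cond (fst (p ! i)) (snd (p ! i))" if "p \<in> P" "i < length p" for p i
    using that nth_mem[OF that(2)] by (auto simp: P_def)
  have P_I: "p \<in> P" if "\<And>i. i < length p \<Longrightarrow> cond (fst (p ! i)) (snd (p ! i))" for p
    using that by (auto simp: P_def in_set_conv_nth) (metis fst_conv snd_conv)
  have le_refl: "le p p" for p by (simp add: le_def)
  have le_trans: "le p q \<Longrightarrow> le q u \<Longrightarrow> le p u" for p q u
    unfolding le_def by (meson order.trans order.strict_trans2 prefix_order.trans)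
  have le_antisym: "p = q" if "le p q" "le q p" for p q
  proof (rule nth_equalityI)
    show "length p = length q" using that by (auto simp: le_def)
    then show "p ! i = q ! i" if "i < length p" for i
      using \<open>le p q\<close> \<open>le q p\<close> that unfolding le_def
      by (metis prefix_order.antisym prod_eqI subset_antisym)
  qed
  have "partial_order_on P r"
    unfolding partial_order_on_def preorder_on_def
  proof (intro conjI)
    show "r \<subseteq> P \<times> P" by (auto simp: r_def)
    show "refl_on P r" by (auto simp: refl_on_def r_def le_refl)
    show "trans r" by (rule transI) (auto simp: r_def intro: le_trans)
    show "antisym r" by (rule antisymI) (auto simp: r_def intro: le_antisym)
  qed
  moreover have "sigma_linked P r"
  proof -
    \<comment> \<open>Promises are sets while \<open>code\<close> reads lists; a fixed enumeration
      lets members be matched by position.\<close>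
    define en where "en F = (SOME xs. set xs = F \<and> distinct xs)" for F :: "'h set"
    have en: "set (en F) = F \<and> distinct (en F)" if "finite F" for F
      unfolding en_def by (rule someI_ex) (use finite_distinct_list[OF that] in blast)
    define cd where "cd p = map (\<lambda>(s, F). (s, code s (en F))) p" for p
    define L where "L n = {p \<in> P. to_nat (cd p) = n}" for n
    have "compatible P r p q" if p: "p \<in> L n" and q: "q \<in> L n" for n p q
    proof -
      have cd: "cd p = cd q" and PQ: "p \<in> P" "q \<in> P"
        using p q by (auto simp: L_def)
      have len: "length p = length q"
        using arg_cong[OF cd, of length] by (simp add: cd_def)
      have eq: "fst (p ! i) = fst (q ! i) \<and>
          code (fst (p ! i)) (en (snd (p ! i))) = code (fst (q ! i)) (en (snd (q ! i)))"
        if "i < length p" for i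
      proof -
        have "cd p ! i = cd q ! i" using cd by simp
        then show ?thesis using that len by (auto simp: cd_def case_prod_unfold)
      qed
      have "\<exists>t. cond (fst (p ! i) @ t) (snd (p ! i) \<union> snd (q ! i))" if i: "i < length p" for i
      proof -
        have c: "cond (fst (p ! i)) (snd (p ! i))" "cond (fst (q ! i)) (snd (q ! i))"
          using P_nth[OF PQ(1) i] P_nth[OF PQ(2), of i] i len by simp_all
        then have "finite (snd (p ! i))" "finite (snd (q ! i))"
          by (simp_all add: cond_def)
        note en[OF this(1)] en[OF this(2)]
        then show ?thesis
          using amalg[of "fst (p ! i)" "en (snd (p ! i))" "en (snd (q ! i))"] c
            eq[OF i, THEN conjunct1] eq[OF i, THEN conjunct2] by simp
      qed
      then have "\<forall>i. \<exists>t. i < length p \<longrightarrow> cond (fst (p ! i) @ t) (snd (p ! i) \<union> snd (q ! i))"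
        by blast
      then obtain t where t: "\<forall>i. i < length p \<longrightarrow> cond (fst (p ! i) @ t i) (snd (p ! i) \<union> snd (q ! i))"
        by (rule choice[THEN exE])
      define u where "u = map (\<lambda>i. (fst (p ! i) @ t i, snd (p ! i) \<union> snd (q ! i))) [0..<length p]"
      have "u \<in> P" by (rule P_I) (simp add: u_def t)
      moreover have "le u p" by (simp add: le_def u_def)
      moreover have "le u q" using eq len by (simp add: le_def u_def)
      ultimately show ?thesis using PQ by (auto simp: compatible_def r_def)
    qed
    moreover have "P = (\<Union>n. L n)" by (auto simp: L_def)
    ultimately show ?thesis
      unfolding sigma_linked_def by (intro exI[of _ L]) simp
  qed
  moreover have "[] \<in> P" by (simp add: P_def)
  then have "P \<noteq> {}" by blast
  ultimately have gen: "generic_filters_aleph1 P r"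
    by (intro MA_sigma_linked_all_types[OF MA])
  define D where "D h = {p \<in> P. \<exists>i<length p. h \<in> snd (p ! i)}" for h
  have "|D ` H0| \<le>o cardSuc natLeq"
    by (rule ordLeq_transitive[OF card_of_image H0(3)])
  moreover have "dense_subset P r (D h)" if h: "h \<in> H0" for h
    unfolding dense_subset_def
  proof (intro conjI ballI)
    show "D h \<subseteq> P" by (auto simp: D_def)
    fix p assume p: "p \<in> P"
    \<comment> \<open>A new object opens a new entry, where there is no pair to witness; joining an
      old entry might demand conflicts that cannot be arranged. This is why conditions are
      lists.\<close>
    have "cond [] {h}" using h H0(1) by (auto simp: cond_def)
    then have "p @ [([], {h})] \<in> P" using p by (simp add: P_def)
    moreover have "le (p @ [([], {h})]) p" by (simp add: le_def nth_append)
    moreover have "\<exists>i<length (p @ [([], {h})]). h \<in> snd ((p @ [([], {h})]) ! i)"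
      by (rule exI[of _ "length p"]) simp
    ultimately show "\<exists>q\<in>D h. (q, p) \<in> r"
      using p by (intro bexI[of _ "p @ [([], {h})]"]) (auto simp: r_def D_def)
  qed
  ultimately obtain G where G: "poset_filter P r G" "\<And>h. h \<in> H0 \<Longrightarrow> G \<inter> D h \<noteq> {}"
    using gen[unfolded generic_filters_aleph1_def, rule_format, of "D ` H0"] by auto
  have GP: "G \<subseteq> P" using G(1) by (simp add: poset_filter_def)
  have dir: "\<exists>u\<in>G. le u p \<and> le u q" if "p \<in> G" "q \<in> G" for p q
  proof -
    have "\<exists>s\<in>G. (s, p) \<in> r \<and> (s, q) \<in> r"
      using G(1) that unfolding poset_filter_def by blast
    then show ?thesis by (auto simp: r_def)
  qed
  \<comment> \<open>The union of the stems at entry \<open>i\<close>. Positions beyond all stems get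
    arbitrary values, which is harmless because every witness lies inside a stem.\<close>
  define c where "c i n = (SOME v. \<exists>p\<in>G. i < length p \<and> n < length (fst (p ! i)) \<and> v = fst (p ! i) ! n)"
    for i n
  have c: "c i n = fst (p ! i) ! n" if p: "p \<in> G" "i < length p" "n < length (fst (p ! i))" for p i n
  proof -
    have "\<exists>q\<in>G. i < length q \<and> n < length (fst (q ! i)) \<and> c i n = fst (q ! i) ! n"
      unfolding c_def by (rule someI_ex) (use p in blast)
    then obtain q where q: "q \<in> G" "i < length q" "n < length (fst (q ! i))" "c i n = fst (q ! i) ! n"
      by blast
    obtain u where "le u p" "le u q" using dir[OF p(1) q(1)] by blast
    then have "prefix (fst (p ! i)) (fst (u ! i))" "prefix (fst (q ! i)) (fst (u ! i))"
      using p q by (auto simp: le_def)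
    then have "fst (p ! i) ! n = fst (u ! i) ! n" "fst (q ! i) ! n = fst (u ! i) ! n"
      using p(3) q(3) prefix_nth by blast+
    then show ?thesis using q(4) by simp
  qed
  have seq: "fst (p ! i) = map (c i) [0..<length (fst (p ! i))]" if "p \<in> G" "i < length p" for p i
    by (rule nth_equalityI) (simp_all add: c[OF that])
  define K where "K i = {h. \<exists>p\<in>G. i < length p \<and> h \<in> snd (p ! i)}" for i
  have "H0 \<subseteq> (\<Union>i. K i)"
  proof
    fix h assume "h \<in> H0"
    then obtain p where "p \<in> G" "p \<in> D h" using G(2) by blast
    then show "h \<in> (\<Union>i. K i)" by (auto simp: D_def K_def)
  qed
  then obtain i where i: "uncountable (H0 \<inter> K i)"
    by (rule uncountable_UN_nat[OF H0(2)])
  show thesis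
  proof (rule that[of "H0 \<inter> K i" "c i"])
    show "H0 \<inter> K i \<subseteq> H" using H0(1) by blast
    show "uncountable (H0 \<inter> K i)" by (rule i)
    fix h h' assume hh: "h \<in> H0 \<inter> K i" "h' \<in> H0 \<inter> K i" "h \<noteq> h'"
    then obtain p q where pq: "p \<in> G" "i < length p" "h \<in> snd (p ! i)"
      "q \<in> G" "i < length q" "h' \<in> snd (q ! i)"
      by (auto simp: K_def)
    then obtain u where u: "u \<in> G" "le u p" "le u q" using dir[of p q] by blast
    then have "i < length u" "h \<in> snd (u ! i)" "h' \<in> snd (u ! i)"
      using pq by (auto simp: le_def)
    then have "wit h h' (fst (u ! i))"
      using P_nth[of u i] u(1) GP hh(3) by (auto simp: cond_def)
    then show "\<exists>m. wit h h' (map (c i) [0..<m])"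
      using seq[OF u(1) \<open>i < length u\<close>] by (intro exI[of _ "length (fst (u ! i))"]) argo
  qed
qed

section \<open>Tree-like families\<close>

text \<open>The next value is taken beyond the \<open>R\<close>-successors of all numbers up to the
  previous value, so that one bound excludes a relation to any earlier value.\<close>

lemma sparse_choice:
  fixes D :: "nat \<Rightarrow> nat set"
  assumes inf: "\<And>n. infinite (D n)" and fin: "\<And>x. finite {y. R x y}"
  obtains g :: "nat \<Rightarrow> nat" where "strict_mono g" "\<And>n. g n \<in> D n" "\<And>i j. i < j \<Longrightarrow> \<not> R (g i) (g j)"
proof -
  have "\<exists>b. \<forall>x\<le>m. \<forall>y. R x y \<longrightarrow> y < b" for m
  proof -
    have "finite (\<Union>x\<le>m. {y. R x y})" using fin by blast
    then obtain b where "(\<Union>x\<le>m. {y. R x y}) \<subseteq> {..<b}"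
      using finite_nat_iff_bounded by blast
    then show ?thesis by (intro exI[of _ b]) blast
  qed
  then obtain B where B: "\<And>m x y. x \<le> m \<Longrightarrow> R x y \<Longrightarrow> y < B m" by metis
  have above: "\<exists>y\<in>D n. b \<le> y" for n b
    using inf[of n] by (meson infinite_nat_iff_unbounded_le)
  have "\<exists>g. \<forall>n. g n \<in> D n \<and> g n < g (Suc n) \<and> B (g n) \<le> g (Suc n)"
  proof (rule dependent_nat_choice)
    show "\<exists>x. x \<in> D 0" using above by blast
    show "\<exists>y. y \<in> D (Suc n) \<and> x < y \<and> B x \<le> y" for x n
      using above[of "Suc n" "max (Suc x) (B x)"] by auto
  qed
  then obtain g where g: "\<And>n. g n \<in> D n" "\<And>n. g n < g (Suc n)" "\<And>n. B (g n) \<le> g (Suc n)"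
    by blast
  have mono: "strict_mono g" using g(2) by (simp add: strict_mono_Suc_iff)
  show thesis
  proof (rule that[OF mono g(1)])
    fix i j :: nat assume "i < j"
    then obtain l where l: "j = Suc l" "i \<le> l" by (cases j) auto
    then have "g i \<le> g l" using mono by (simp add: strict_mono_less_eq)
    then show "\<not> R (g i) (g j)"
      using B[of "g i" "g l" "g j"] g(3)[of l] l(1) by auto
  qed
qed

lemma injective_choice:
  fixes D :: "'j :: countable \<Rightarrow> nat set"
  assumes "\<And>j. infinite (D j)"
  obtains g where "inj g" "\<And>j. g j \<in> D j"
proof -
  have "infinite (if n \<in> range (to_nat :: 'j \<Rightarrow> nat) then D (from_nat n) else UNIV)" for n
    using assms by simp
  then obtain f :: "nat \<Rightarrow> nat" where f: "strict_mono f"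
    "\<And>n. f n \<in> (if n \<in> range (to_nat :: 'j \<Rightarrow> nat) then D (from_nat n) else UNIV)"
    using sparse_choice[of "\<lambda>n. if n \<in> range (to_nat :: 'j \<Rightarrow> nat) then D (from_nat n) else UNIV"
        "\<lambda>_ _. False"] by auto
  show thesis
  proof (rule that[of "f \<circ> to_nat"])
    show "inj (f \<circ> (to_nat :: 'j \<Rightarrow> nat))"
      using f(1) by (intro inj_compose) (auto simp: strict_mono_imp_inj_on)
    show "(f \<circ> to_nat) j \<in> D j" for j
      using f(2)[of "to_nat j"] by simp
  qed
qed

text \<open>Stronger than almost disjointness: the intersection of two branches must not change when
  the branches are altered far out. This turns agreement on the common part into a condition on
  initial segments.\<close>

definition tree_like :: "((nat \<Rightarrow> bool) \<Rightarrow> nat set) \<Rightarrow> bool" where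
  "tree_like S \<longleftrightarrow> (\<forall>x y. x \<noteq> y \<longrightarrow> (\<exists>m. S x \<inter> S y \<subseteq> {..<m} \<and>
     (\<forall>x' y'. (\<forall>i<m. x' i = x i) \<longrightarrow> (\<forall>i<m. y' i = y i) \<longrightarrow> S x' \<inter> S y' = S x \<inter> S y)))"

text \<open>Nodes of the binary tree, with labels, become numbers: \<open>pt (s, k)\<close> is
  placed in \<open>D k\<close>, and a branch collects the points over its restrictions. The
  condition \<open>k < l\<close> leaves finitely many points on each level, so branches that split
  share finitely many, while each label occurs on all later levels.\<close>

lemma tree_like_family:
  fixes D :: "nat \<Rightarrow> nat set"
  assumes "\<And>k. infinite (D k)"
  obtains S where "tree_like S" "\<And>x k. infinite (S x \<inter> D k)"
proof -
  obtain pt :: "bool list \<times> nat \<Rightarrow> nat" where inj: "inj pt" and pt: "\<And>s. pt s \<in> D (snd s)"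
    by (rule injective_choice[of "\<lambda>s :: bool list \<times> nat. D (snd s)"]) (use assms in auto)
  define res where "res x l = map x [0..<l]" for x :: "nat \<Rightarrow> bool" and l
  have len: "length (res x l) = l" for x l by (simp add: res_def)
  have res_eq: "res x l = res y l \<longleftrightarrow> (\<forall>i<l. x i = y i)" for x y l
    by (auto simp: res_def)
  define S where "S x = {pt (res x l, k) | l k. k < l}" for x
  have S_Int: "n \<in> S x \<inter> S y \<longleftrightarrow> (\<exists>l k. k < l \<and> n = pt (res x l, k) \<and> res x l = res y l)" for n x y
    unfolding S_def using inj len by (auto simp: inj_eq) (metis len)
  have "infinite (S x \<inter> D k)" for x k
  proof -
    have "inj_on (\<lambda>l. pt (res x l, k)) {k<..}"
      using inj by (intro inj_onI) (metis injD len prod.inject)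
    then have "infinite ((\<lambda>l. pt (res x l, k)) ` {k<..})"
      by (simp add: finite_image_iff infinite_Ioi)
    moreover have "(\<lambda>l. pt (res x l, k)) ` {k<..} \<subseteq> S x \<inter> D k"
      using pt[of "(res x l, k)" for l] by (auto simp: S_def)
    ultimately show ?thesis using finite_subset by blast
  qed
  moreover have "tree_like S"
    unfolding tree_like_def
  proof (intro allI impI)
    fix x y :: "nat \<Rightarrow> bool" assume "x \<noteq> y"
    then obtain d where d: "x d \<noteq> y d" by auto
    have le: "l \<le> d" if "res x' l = res y' l" "\<forall>i\<le>d. x' i = x i" "\<forall>i\<le>d. y' i = y i" for x' y' l
      using that d unfolding res_eq by (metis le_refl not_le_imp_less)
    have eq: "S x' \<inter> S y' = S x \<inter> S y" if ag: "\<forall>i\<le>d. x' i = x i" "\<forall>i\<le>d. y' i = y i" for x' y'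
    proof -
      have "res x' l = res y' l \<longleftrightarrow> res x l = res y l" for l
      proof (cases "l \<le> d")
        case True
        then show ?thesis using ag by (simp add: res_eq)
      next
        case False
        then show ?thesis using le[of x' l y'] le[of x l y] ag by auto
      qed
      moreover have "res x' l = res x l" if "res x l = res y l" for l
        using le[OF that] ag by (simp add: res_eq)
      ultimately show ?thesis
        by (intro set_eqI) (simp only: S_Int, metis)
    qed
    have "S x \<inter> S y \<subseteq> (\<lambda>(l, k). pt (res x l, k)) ` ({..d} \<times> {..d})"
    proof
      fix n assume "n \<in> S x \<inter> S y"
      then obtain l k where "k < l" "n = pt (res x l, k)" "res x l = res y l"
        unfolding S_Int by blast
      then show "n \<in> (\<lambda>(l, k). pt (res x l, k)) ` ({..d} \<times> {..d})"
        using le[of x l y] by (intro image_eqI[of _ _ "(l, k)"]) auto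
    qed
    then have "finite (S x \<inter> S y)"
      by (rule finite_subset) simp
    then obtain m where "S x \<inter> S y \<subseteq> {..<m}"
      using finite_nat_iff_bounded by blast
    then show "\<exists>m. S x \<inter> S y \<subseteq> {..<m} \<and>
        (\<forall>x' y'. (\<forall>i<m. x' i = x i) \<longrightarrow> (\<forall>i<m. y' i = y i) \<longrightarrow> S x' \<inter> S y' = S x \<inter> S y)"
      by (intro exI[of _ "max m (Suc d)"] conjI allI impI eq) auto
  qed
  ultimately show thesis using that by blast
qed

text \<open>An endomorphism of the sets modulo finite, seen through an arbitrary choice of
  representatives. The exceptional finite sets depend on the arguments, and no continuity is
  assumed.\<close>

locale almost_hom =
  fixes A :: "nat set \<Rightarrow> nat set"
  assumes cong: "(\<forall>\<^sub>\<infinity>n. n \<in> X \<longleftrightarrow> n \<in> Y) \<Longrightarrow> \<forall>\<^sub>\<infinity>n. n \<in> A X \<longleftrightarrow> n \<in> A Y"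
    and Int: "\<forall>\<^sub>\<infinity>n. n \<in> A (X \<inter> Y) \<longleftrightarrow> n \<in> A X \<and> n \<in> A Y"
    and Compl: "\<forall>\<^sub>\<infinity>n. n \<in> A (- X) \<longleftrightarrow> n \<notin> A X"
begin

lemma image_empty: "\<forall>\<^sub>\<infinity>n. n \<notin> A {}"
  using Int[of "{}" "- {}"] Compl[of "{}"] by eventually_elim auto

lemma image_finite: "finite X \<Longrightarrow> \<forall>\<^sub>\<infinity>n. n \<notin> A X"
proof -
  assume "finite X"
  then have "\<forall>\<^sub>\<infinity>n. n \<in> X \<longleftrightarrow> n \<in> {}"
    by (simp add: eventually_cofinite)
  from cong[OF this] image_empty show ?thesis by eventually_elim auto
qed

lemma mono: "X \<subseteq> Y \<Longrightarrow> \<forall>\<^sub>\<infinity>n. n \<in> A X \<longrightarrow> n \<in> A Y"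
  using Int[of X Y] by (auto simp: Int_absorb2 elim: MOST_mono)

lemma Diff: "\<forall>\<^sub>\<infinity>n. n \<in> A (X - Y) \<longleftrightarrow> n \<in> A X \<and> n \<notin> A Y"
  unfolding Diff_eq using Int[of X "- Y"] Compl[of Y] by eventually_elim auto

end

section \<open>Locality of lifts of automorphisms\<close>

context almost_hom
begin

text \<open>Pairwise conflicting pairs \<open>(x, a)\<close> amalgamate outright: the sets agree on
  common parts, so their union \<open>c\<close> meets each branch \<open>S x\<close> in
  \<open>a\<close>. Hence \<open>A a\<close> is \<open>A c \<inter> A (S x)\<close> beyond a
  threshold, and two pairs with the same threshold and the same image below it cannot
  conflict.\<close>

lemma tree_cover:
  fixes S :: "(nat \<Rightarrow> bool) \<Rightarrow> nat set"
  assumes OCA and tree: "tree_like S"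
  obtains X :: "nat \<Rightarrow> ((nat \<Rightarrow> bool) \<times> nat set) set"
  where "(\<Union>k. X k) = {(x, a). a \<subseteq> S x}"
    "\<And>k x a y b n. (x, a) \<in> X k \<Longrightarrow> (y, b) \<in> X k \<Longrightarrow> x \<noteq> y \<Longrightarrow> a \<inter> S y = b \<inter> S x \<Longrightarrow>
        n \<in> A (S x) \<Longrightarrow> n \<in> A (S y) \<Longrightarrow> n \<in> A a \<longleftrightarrow> n \<in> A b"
proof -
  define V where "V = {(x, a). a \<subseteq> S x}"
  \<comment> \<open>The bits of \<open>A (S x)\<close> and \<open>A a\<close> are recorded because
    the conflict point is defined through them.\<close>
  define e where "e = (\<lambda>(x, a) n. (x n, n \<in> a, n \<in> A (S x), n \<in> A a))"
  define K where "K = (\<lambda>(x, a) (y, b). x \<noteq> y \<and> a \<inter> S y = b \<inter> S x \<and>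
      (\<exists>n \<in> A (S x) \<inter> A (S y). (n \<in> A a) \<noteq> (n \<in> A b)))"
  have inj: "inj_on e V"
  proof (rule inj_onI, clarify)
    fix x a y b assume "e (x, a) = e (y, b)"
    then have "e (x, a) n = e (y, b) n" for n by simp
    then have "x n = y n \<and> (n \<in> a \<longleftrightarrow> n \<in> b)" for n by (simp add: e_def)
    then show "x = y \<and> a = b" by auto
  qed
  have sym: "K v u" if "K u v" for u v
    using that by (auto simp: K_def split: prod.splits)
  have loc: "\<exists>m. \<forall>u'\<in>V. \<forall>v'\<in>V. (\<forall>n<m. e u' n = e u n) \<longrightarrow> (\<forall>n<m. e v' n = e v n) \<longrightarrow>
      u' \<noteq> v' \<and> K u' v'" if uv: "u \<in> V" "v \<in> V" "K u v" for u v
  proof -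
    obtain x a y b where eq: "u = (x, a)" "v = (y, b)" by fastforce
    then obtain n where n: "x \<noteq> y" "a \<inter> S y = b \<inter> S x" "n \<in> A (S x)" "n \<in> A (S y)"
      "(n \<in> A a) \<noteq> (n \<in> A b)" and ab: "a \<subseteq> S x" "b \<subseteq> S y"
      using uv by (auto simp: K_def V_def)
    obtain m where m: "S x \<inter> S y \<subseteq> {..<m}"
      "\<And>x' y'. \<forall>i<m. x' i = x i \<Longrightarrow> \<forall>i<m. y' i = y i \<Longrightarrow> S x' \<inter> S y' = S x \<inter> S y"
      using tree[unfolded tree_like_def, rule_format, OF n(1)] by blast
    obtain d where d: "x d \<noteq> y d" using n(1) by auto
    \<comment> \<open>Three things must be fixed: the common part of the branches, the conflict
      point, and a place where the branches differ.\<close>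
    define l where "l = max (max m (Suc n)) (Suc d)"
    have l: "m \<le> l" "n < l" "d < l" by (auto simp: l_def)
    have "u' \<noteq> v' \<and> K u' v'" if V: "u' \<in> V" "v' \<in> V"
      and ag: "\<forall>n<l. e u' n = e u n" "\<forall>n<l. e v' n = e v n" for u' v'
    proof -
      obtain x' a' y' b' where eq': "u' = (x', a')" "v' = (y', b')" by fastforce
      have ax: "x' i = x i" "i \<in> a' \<longleftrightarrow> i \<in> a" "i \<in> A (S x') \<longleftrightarrow> i \<in> A (S x)"
        "i \<in> A a' \<longleftrightarrow> i \<in> A a" if "i < l" for i
        using ag(1)[rule_format, OF that] by (simp_all add: e_def eq eq')
      have ay: "y' i = y i" "i \<in> b' \<longleftrightarrow> i \<in> b" "i \<in> A (S y') \<longleftrightarrow> i \<in> A (S y)"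
        "i \<in> A b' \<longleftrightarrow> i \<in> A b" if "i < l" for i
        using ag(2)[rule_format, OF that] by (simp_all add: e_def eq eq')
      have ne: "x' \<noteq> y'" using d ax(1)[OF l(3)] ay(1)[OF l(3)] by auto
      have I: "S x' \<inter> S y' = S x \<inter> S y"
        by (rule m(2)) (use ax(1) ay(1) l(1) in auto)
      have "a' \<inter> S y' = b' \<inter> S x'"
      proof (rule set_eqI)
        fix i
        have "i \<in> a' \<inter> S y' \<longleftrightarrow> i \<in> a' \<and> i \<in> S x \<inter> S y"
          using V I by (auto simp: V_def eq')
        also have "\<dots> \<longleftrightarrow> i \<in> a \<and> i \<in> S x \<inter> S y"
          using ax(2)[of i] m(1) l(1) by auto
        also have "\<dots> \<longleftrightarrow> i \<in> b \<and> i \<in> S x \<inter> S y"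
          using n(2) by blast
        also have "\<dots> \<longleftrightarrow> i \<in> b' \<and> i \<in> S x \<inter> S y"
          using ay(2)[of i] m(1) l(1) by auto
        also have "\<dots> \<longleftrightarrow> i \<in> b' \<inter> S x'"
          using V I by (auto simp: V_def eq')
        finally show "i \<in> a' \<inter> S y' \<longleftrightarrow> i \<in> b' \<inter> S x'" .
      qed
      then show ?thesis
        using ne n(3,4,5) ax(3,4)[OF l(2)] ay(3,4)[OF l(2)] unfolding eq' K_def by auto
    qed
    then show ?thesis by (intro exI[of _ l]) blast
  qed
  have hom: False if H: "H \<subseteq> V" "uncountable H" "\<And>u v. u \<in> H \<Longrightarrow> v \<in> H \<Longrightarrow> u \<noteq> v \<Longrightarrow> K u v" for H
  proof -
    define c where "c = (\<Union>(x, a)\<in>H. a)"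
    have c: "c \<inter> S x = a" if xa: "(x, a) \<in> H" for x a
    proof
      show "c \<inter> S x \<subseteq> a"
      proof
        fix i assume "i \<in> c \<inter> S x"
        then obtain y b where yb: "(y, b) \<in> H" "i \<in> b" "i \<in> S x" by (auto simp: c_def)
        show "i \<in> a"
        proof (cases "(x, a) = (y, b)")
          case False
          then have "K (x, a) (y, b)" using H(3) xa yb(1) by blast
          then have "a \<inter> S y = b \<inter> S x" by (simp add: K_def)
          then show ?thesis using yb by blast
        qed (use yb in simp)
      qed
      show "a \<subseteq> c \<inter> S x" using xa H(1) by (auto simp: c_def V_def)
    qed
    have "\<exists>m. \<forall>n\<ge>m. n \<in> A a \<longleftrightarrow> n \<in> A c \<and> n \<in> A (S x)" if "(x, a) \<in> H" for x a
      using Int[of c "S x"] unfolding c[OF that] MOST_nat_le .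
    then have "\<forall>p. \<exists>m. p \<in> H \<longrightarrow> (\<forall>n\<ge>m. n \<in> A (snd p) \<longleftrightarrow> n \<in> A c \<and> n \<in> A (S (fst p)))"
      by auto
    then obtain m where m: "\<forall>p. p \<in> H \<longrightarrow> (\<forall>n\<ge>m p. n \<in> A (snd p) \<longleftrightarrow> n \<in> A c \<and> n \<in> A (S (fst p)))"
      by (rule choice[THEN exE])
    obtain p q where pq: "p \<in> H" "q \<in> H" "p \<noteq> q"
      "(m p, map (\<lambda>n. n \<in> A (snd p)) [0..<m p]) = (m q, map (\<lambda>n. n \<in> A (snd q)) [0..<m q])"
      by (rule uncountable_pigeonhole[OF H(2)])
    then have mm: "m p = m q" by simp
    have low: "n \<in> A (snd p) \<longleftrightarrow> n \<in> A (snd q)" if "n < m q" for n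
      using pq(4) that by auto
    have "K p q" using H(3) pq by blast
    then obtain n where n: "n \<in> A (S (fst p))" "n \<in> A (S (fst q))" "(n \<in> A (snd p)) \<noteq> (n \<in> A (snd q))"
      by (auto simp: K_def split: prod.splits)
    show False
    proof (cases "n < m q")
      case True
      then show ?thesis using low n(3) by blast
    next
      case False
      then show ?thesis
        using m[rule_format, OF pq(1), of n] m[rule_format, OF pq(2), of n] mm n by simp
    qed
  qed
  show thesis
  proof (rule OCA_coded[OF \<open>OCA\<close> inj sym loc])
    fix H assume "H \<subseteq> V" "uncountable H" "\<And>u v. u \<in> H \<Longrightarrow> v \<in> H \<Longrightarrow> u \<noteq> v \<Longrightarrow> K u v"
    then show thesis using hom[of H] by blast
  next
    fix Y :: "nat \<Rightarrow> ((nat \<Rightarrow> bool) \<times> nat set) set"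
    assume Y: "V = (\<Union>n. Y n)" "\<And>n u v. u \<in> Y n \<Longrightarrow> v \<in> Y n \<Longrightarrow> u \<noteq> v \<Longrightarrow> \<not> K u v"
    show thesis
    proof (rule that[of Y])
      show "(\<Union>k. Y k) = {(x, a). a \<subseteq> S x}" using Y(1) V_def by blast
      fix k x a y b n
      assume *: "(x, a) \<in> Y k" "(y, b) \<in> Y k" "x \<noteq> y" "a \<inter> S y = b \<inter> S x" "n \<in> A (S x)" "n \<in> A (S y)"
      then have "\<not> K (x, a) (y, b)" using Y(2) by blast
      then show "n \<in> A a \<longleftrightarrow> n \<in> A b" using * by (auto simp: K_def)
    qed
  qed
qed

text \<open>
  Two distinct bad branches with the same parameters would refute each other: a set witnessing that the
  second one is bad can be copied into the first one along the common part of the branches.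
\<close>

lemma good_branch:
  fixes S :: "(nat \<Rightarrow> bool) \<Rightarrow> nat set" and X :: "nat \<Rightarrow> ((nat \<Rightarrow> bool) \<times> nat set) set"
  assumes tree: "tree_like S"
    and X: "\<And>k x a. (x, a) \<in> X k \<Longrightarrow> a \<subseteq> S x"
    and free: "\<And>k x a y b n. (x, a) \<in> X k \<Longrightarrow> (y, b) \<in> X k \<Longrightarrow> x \<noteq> y \<Longrightarrow> a \<inter> S y = b \<inter> S x \<Longrightarrow>
        n \<in> A (S x) \<Longrightarrow> n \<in> A (S y) \<Longrightarrow> n \<in> A a \<longleftrightarrow> n \<in> A b"
  obtains x where "\<forall>k m p t. t \<subseteq> S x \<inter> {..<p} \<longrightarrow> (\<exists>p'\<ge>p. \<exists>t'\<subseteq>S x \<inter> {..<p'}. t' \<inter> {..<p} = t \<and>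
      (\<forall>a b. (x, a) \<in> X k \<longrightarrow> (x, b) \<in> X k \<longrightarrow> a \<inter> {..<p'} = t' \<longrightarrow> b \<inter> {..<p'} = t' \<longrightarrow>
        (\<forall>n<m. n \<in> A (S x) \<longrightarrow> (n \<in> A a \<longleftrightarrow> n \<in> A b))))"
proof -
  define good where "good x k m p t \<longleftrightarrow> (t \<subseteq> S x \<inter> {..<p} \<longrightarrow>
    (\<exists>p'\<ge>p. \<exists>t'\<subseteq>S x \<inter> {..<p'}. t' \<inter> {..<p} = t \<and>
      (\<forall>a b. (x, a) \<in> X k \<longrightarrow> (x, b) \<in> X k \<longrightarrow> a \<inter> {..<p'} = t' \<longrightarrow> b \<inter> {..<p'} = t' \<longrightarrow>
        (\<forall>n<m. n \<in> A (S x) \<longrightarrow> (n \<in> A a \<longleftrightarrow> n \<in> A b)))))" for x k m p t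
  have "\<exists>x. \<forall>k m p t. good x k m p t"
  proof (rule ccontr)
    assume "\<not> ?thesis"
    then have "\<forall>x. \<exists>k m p t. \<not> good x k m p t" by simp
    then obtain k m p t where bad: "\<And>x. \<not> good x (k x) (m x) (p x) (t x)" by metis
    define F where "F x = (k x, m x, p x, map (\<lambda>i. i \<in> t x) [0..<p x], map (\<lambda>n. n \<in> A (S x)) [0..<m x])"
      for x
    obtain x y where xy: "x \<noteq> y" "F x = F y"
      by (rule uncountable_pigeonhole[OF uncountable_Cantor_space, of F])
    have tb: "t z \<subseteq> S z \<inter> {..<p z}" for z
      using bad[of z] by (auto simp: good_def)
    have par: "k x = k y" "m x = m y" "p x = p y" using xy(2) by (auto simp: F_def)
    have A_eq: "n \<in> A (S x) \<longleftrightarrow> n \<in> A (S y)" if "n < m x" for n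
      using xy(2) that by (auto simp: F_def)
    have "i \<in> t x \<longleftrightarrow> i \<in> t y" if "i < p x" for i
      using xy(2) that by (auto simp: F_def)
    then have t_eq: "t x = t y" using tb[of x] tb[of y] par(3) by auto
    \<comment> \<open>If no set of the piece extended \<open>t y\<close>, then \<open>y\<close>
      would be good vacuously; so the bad branch \<open>y\<close> supplies a set \<open>b\<close> to
      copy.\<close>
    have "\<exists>a. (y, a) \<in> X (k y) \<and> a \<inter> {..<p y} = t y"
    proof (rule ccontr)
      assume "\<nexists>a. (y, a) \<in> X (k y) \<and> a \<inter> {..<p y} = t y"
      then have "good y (k y) (m y) (p y) (t y)"
        unfolding good_def by (intro impI exI[of _ "p y"] exI[of _ "t y"] conjI) auto
      then show False using bad by blast
    qed
    then obtain b where b: "(y, b) \<in> X (k x)" "b \<inter> {..<p x} = t x"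
      using par t_eq by auto
    obtain l where l: "S x \<inter> S y \<subseteq> {..<l}" using tree[unfolded tree_like_def, rule_format, OF xy(1)] by blast
    define p' where "p' = max (p x) l"
    \<comment> \<open>Since \<open>p'\<close> lies past the common part of the branches, every set
      of the piece extending \<open>t'\<close> agrees with \<open>b\<close> there. By
      \<open>free\<close> the images of all these sets are then compared with the one set
      \<open>A b\<close>.\<close>
    define t' where "t' = t x \<union> (b \<inter> S x \<inter> {p x..<p'})"
    have "good x (k x) (m x) (p x) (t x)"
      unfolding good_def
    proof (intro impI exI[of _ p'] exI[of _ t'] conjI allI)
      show "p x \<le> p'" by (simp add: p'_def)
      then show "t' \<subseteq> S x \<inter> {..<p'}" "t' \<inter> {..<p x} = t x"
        using tb[of x] by (auto simp: t'_def)
      have "a \<inter> S y = b \<inter> S x" if a: "(x, a) \<in> X (k x)" "a \<inter> {..<p'} = t'" for a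
      proof (rule set_eqI)
        fix i
        have aS: "a \<subseteq> S x" and bS: "b \<subseteq> S y" using X[OF a(1)] X[OF b(1)] .
        have "i < p'" if "i \<in> S x" "i \<in> S y" using l that by (auto simp: p'_def)
        moreover have "i \<in> a \<longleftrightarrow> i \<in> t'" if "i < p'" using a(2) that by auto
        moreover have "i \<in> t' \<longleftrightarrow> i \<in> b" if "i < p'" "i \<in> S x"
          using b(2) that tb[of x] by (cases "i < p x") (auto simp: t'_def)
        ultimately show "i \<in> a \<inter> S y \<longleftrightarrow> i \<in> b \<inter> S x" using aS bS by blast
      qed
      then have "n \<in> A a \<longleftrightarrow> n \<in> A b"
        if "(x, a) \<in> X (k x)" "a \<inter> {..<p'} = t'" "n < m x" "n \<in> A (S x)" for a n
        using free[OF that(1) b(1) xy(1) _ that(4)] A_eq[OF that(3)] that by simp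
      note agree = this
      show "n \<in> A a \<longleftrightarrow> n \<in> A a'"
        if "(x, a) \<in> X (k x)" "(x, a') \<in> X (k x)" "a \<inter> {..<p'} = t'" "a' \<inter> {..<p'} = t'"
          "n < m x" "n \<in> A (S x)" for a a' n
        using agree[OF that(1,3,5,6)] agree[OF that(2,4,5,6)] by simp
    qed
    then show False using bad by blast
  qed
  then obtain x where "\<forall>k m p t. good x k m p t" ..
  then show thesis by (intro that[of x]) (simp only: good_def)
qed

end

lemma infinite_Collect_MOST:
  fixes S :: "nat set"
  assumes "infinite S" "\<forall>\<^sub>\<infinity>n. n \<in> S \<longrightarrow> P n"
  shows "infinite {n \<in> S. P n}"
proof
  assume "finite {n \<in> S. P n}"
  moreover have "finite {n. \<not> (n \<in> S \<longrightarrow> P n)}"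
    using assms(2) by (simp add: eventually_cofinite)
  moreover have "S \<subseteq> {n \<in> S. P n} \<union> {n. \<not> (n \<in> S \<longrightarrow> P n)}" by blast
  ultimately show False using assms(1) by (meson finite_UnI finite_subset)
qed

text \<open>Continuity of \<open>A\<close> on each of countably many pieces, with one modulus
  \<open>w\<close> for all pieces; only outputs inside \<open>A E\<close> are controlled.\<close>

definition locally_determined ::
  "(nat set \<Rightarrow> nat set) \<Rightarrow> nat set \<Rightarrow> (nat \<Rightarrow> nat) \<Rightarrow> (nat \<Rightarrow> nat set set) \<Rightarrow> bool" where
  "locally_determined A E w Y \<longleftrightarrow> Pow E \<subseteq> (\<Union>k. Y k) \<and>
     (\<forall>k. \<forall>a\<in>Y k. \<forall>b\<in>Y k. \<forall>n\<in>A E. a \<subseteq> E \<longrightarrow> b \<subseteq> E \<longrightarrow>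
        a \<inter> {..<w n} = b \<inter> {..<w n} \<longrightarrow> (n \<in> A a \<longleftrightarrow> n \<in> A b))"

context almost_hom
begin

text \<open>
  Blocks of the branch are alternately left free (these form \<open>E\<close>) and frozen. The frozen part is chosen so
  that, on each piece of the covering, the first \<open>j\<close> outputs depend only on the input below the \<open>j\<close>th frozen
  block.
\<close>

lemma one_sided_locality:
  fixes D :: "nat \<Rightarrow> nat set"
  assumes OCA and D: "\<And>k. infinite (D k)"
  obtains E w Y where "\<forall>k. infinite (E \<inter> D k)" "locally_determined A E w Y"
proof -
  obtain T where T: "tree_like T" and T_inf: "\<And>x k. infinite (T x \<inter> D k)"
    using tree_like_family[of D, OF D] by blast
  obtain X :: "nat \<Rightarrow> ((nat \<Rightarrow> bool) \<times> nat set) set"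
    where X: "(\<Union>k. X k) = {(x, a). a \<subseteq> T x}"
    and free: "\<And>k x a y b n. (x, a) \<in> X k \<Longrightarrow> (y, b) \<in> X k \<Longrightarrow> x \<noteq> y \<Longrightarrow> a \<inter> T y = b \<inter> T x \<Longrightarrow>
        n \<in> A (T x) \<Longrightarrow> n \<in> A (T y) \<Longrightarrow> n \<in> A a \<longleftrightarrow> n \<in> A b"
    by (rule tree_cover[OF \<open>OCA\<close> T]) blast
  have XT: "a \<subseteq> T x" if "(x, a) \<in> X k" for k x a using X that by blast
  obtain x where x: "\<forall>k m p t. t \<subseteq> T x \<inter> {..<p} \<longrightarrow> (\<exists>p'\<ge>p. \<exists>t'\<subseteq>T x \<inter> {..<p'}. t' \<inter> {..<p} = t \<and>
      (\<forall>a b. (x, a) \<in> X k \<longrightarrow> (x, b) \<in> X k \<longrightarrow> a \<inter> {..<p'} = t' \<longrightarrow> b \<inter> {..<p'} = t' \<longrightarrow>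
        (\<forall>n<m. n \<in> A (T x) \<longrightarrow> (n \<in> A a \<longleftrightarrow> n \<in> A b))))"
    by (rule good_branch[where X = X, OF T XT free])
  define S where "S = T x"
  define Z where "Z k = {a. (x, a) \<in> X k}" for k
  have Z_cover: "\<exists>k. a \<in> Z k" if "a \<subseteq> S" for a
  proof -
    have "(x, a) \<in> (\<Union>k. X k)" unfolding X using that by (simp add: S_def)
    then show ?thesis by (auto simp: Z_def)
  qed
  \<comment> \<open>On the cylinder \<open>c\<close>, given by a length and an initial segment,
    piece \<open>k\<close> leaves the outputs below \<open>m\<close> no freedom. This passes to
    longer segments.\<close>
  define agree where "agree m c k \<longleftrightarrow> (\<forall>a b. a \<in> Z k \<longrightarrow> b \<in> Z k \<longrightarrow> a \<inter> {..<fst c} = snd c \<longrightarrow> b \<inter> {..<fst c} = snd c \<longrightarrow>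
      (\<forall>n<m. n \<in> A S \<longrightarrow> (n \<in> A a \<longleftrightarrow> n \<in> A b)))" for m k and c :: "nat \<times> nat set"
  have extend: "\<exists>p'\<ge>p. \<exists>t'\<subseteq>S \<inter> {..<p'}. t' \<inter> {..<p} = t \<and> agree m (p', t') k"
    if "t \<subseteq> S \<inter> {..<p}" for p t m k
    using x[rule_format, OF that[unfolded S_def], of k m] unfolding agree_def Z_def S_def by simp
  have freeze: "\<exists>r u. q \<le> r \<and> u \<subseteq> S \<inter> {q..<r} \<and> (\<forall>t k. t \<subseteq> S \<inter> {..<q} \<longrightarrow> k < m \<longrightarrow> agree m (r, t \<union> u) k)"
    for q m
  proof -
    \<comment> \<open>The finitely many pairs of a segment and a piece are served in turn by
      lengthening one common tail, which preserves what was achieved for earlier pairs.\<close>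
    have "finite P \<Longrightarrow> P \<subseteq> Pow (S \<inter> {..<q}) \<times> {..<m} \<Longrightarrow>
      \<exists>r u. q \<le> r \<and> u \<subseteq> S \<inter> {q..<r} \<and> (\<forall>(t, k)\<in>P. agree m (r, t \<union> u) k)" for P
    proof (induction P rule: finite_induct)
      case empty
      show ?case by (intro exI[of _ q] exI[of _ "{}"]) auto
    next
      case (insert tk P)
      obtain t k where tk: "tk = (t, k)" "t \<subseteq> S \<inter> {..<q}" using insert.prems by auto
      have "P \<subseteq> Pow (S \<inter> {..<q}) \<times> {..<m}" using insert.prems by simp
      from insert.IH[OF this] obtain r u where ru: "q \<le> r" "u \<subseteq> S \<inter> {q..<r}"
        and P: "\<forall>(t, k)\<in>P. agree m (r, t \<union> u) k"
        by (elim exE conjE)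
      have "t \<union> u \<subseteq> S \<inter> {..<r}" using tk(2) ru(1,2) by auto
      from extend[OF this, of m k] obtain p' t' where p': "r \<le> p'" "t' \<subseteq> S \<inter> {..<p'}"
        "t' \<inter> {..<r} = t \<union> u" "agree m (p', t') k"
        by (elim exE conjE)
      define u' where "u' = t' - {..<q}"
      have u'_r: "u' \<inter> {..<r} = u"
        using p'(3) tk(2) ru(2) unfolding u'_def by auto
      have "t' \<inter> {..<q} = (t' \<inter> {..<r}) \<inter> {..<q}" using ru(1) by auto
      also have "\<dots> = t" unfolding p'(3) using tk(2) ru(2) by auto
      finally have t': "t' = t \<union> u'" unfolding u'_def by auto
      have "agree m (p', t0 \<union> u') k0" if "(t0, k0) \<in> P" for t0 k0
      proof -
        have "t0 \<subseteq> S \<inter> {..<q}" using insert.prems that by auto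
        have low: "a \<inter> {..<r} = t0 \<union> u" if a: "a \<inter> {..<p'} = t0 \<union> u'" for a
        proof -
          have "a \<inter> {..<r} = (a \<inter> {..<p'}) \<inter> {..<r}" using p'(1) by auto
          also have "\<dots> = (t0 \<inter> {..<r}) \<union> (u' \<inter> {..<r})" unfolding a by blast
          also have "t0 \<inter> {..<r} = t0" using \<open>t0 \<subseteq> S \<inter> {..<q}\<close> ru(1) by auto
          finally show ?thesis unfolding u'_r .
        qed
        have ag: "agree m (r, t0 \<union> u) k0" using bspec[OF P that] by (simp only: prod.case)
        show ?thesis
          unfolding agree_def fst_conv snd_conv
        proof (intro allI impI)
          fix a b n
          assume *: "a \<in> Z k0" "b \<in> Z k0" "a \<inter> {..<p'} = t0 \<union> u'" "b \<inter> {..<p'} = t0 \<union> u'"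
            "n < m" "n \<in> A S"
          show "(n \<in> A a) = (n \<in> A b)"
            by (rule ag[unfolded agree_def fst_conv snd_conv, rule_format, OF *(1,2) low[OF *(3)] low[OF *(4)] *(5,6)])
        qed
      qed
      then have "\<forall>(t, k)\<in>insert tk P. agree m (p', t \<union> u') k"
        using p'(4) unfolding t'[symmetric] tk(1) by (simp add: t'[symmetric] split_beta)
      moreover have "u' \<subseteq> S \<inter> {q..<p'}" using p'(2) by (auto simp: u'_def)
      moreover have "q \<le> p'" using ru(1) p'(1) by simp
      ultimately show ?case by blast
    qed
    from this[of "Pow (S \<inter> {..<q}) \<times> {..<m}"] obtain r u where ru: "q \<le> r" "u \<subseteq> S \<inter> {q..<r}"
      and ag: "\<forall>(t, k)\<in>Pow (S \<inter> {..<q}) \<times> {..<m}. agree m (r, t \<union> u) k"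
      by auto
    then show ?thesis by (intro exI[of _ r] exI[of _ u] conjI) (use ag in simp_all)
  qed
  \<comment> \<open>A free block long enough to meet \<open>D 0\<close> up to \<open>D j\<close>;
    over all \<open>j\<close> this lets \<open>E\<close> meet every \<open>D k\<close> infinitely
    often.\<close>
  have meet: "\<exists>q>r. \<forall>k\<le>j. S \<inter> D k \<inter> {r..<q} \<noteq> {}" for r j
  proof -
    have "\<exists>i\<ge>r. i \<in> S \<inter> D k" for k
      using T_inf[of x k] unfolding S_def by (meson infinite_nat_iff_unbounded_le)
    then obtain i where i: "\<And>k. i k \<ge> r" "\<And>k. i k \<in> S \<inter> D k" by metis
    define q where "q = Suc (r + (\<Sum>k\<le>j. i k))"
    have "i k < q" if "k \<le> j" for k
      using member_le_sum[of k "{..j}" i] that by (simp add: q_def)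
    moreover have "r < q" by (simp add: q_def)
    ultimately have "r < q \<and> (\<forall>k\<le>j. i k \<in> S \<inter> D k \<inter> {r..<q})" using i by simp
    then show ?thesis by blast
  qed
  define ok where "ok m s \<longleftrightarrow> (case s of (q, r, u) \<Rightarrow> q \<le> r \<and> u \<subseteq> S \<inter> {q..<r} \<and>
      (\<forall>t k. t \<subseteq> S \<inter> {..<q} \<longrightarrow> k < m \<longrightarrow> agree m (r, t \<union> u) k))" for m s
  have "\<exists>f. \<forall>j. ok j (f j) \<and> fst (snd (f j)) < fst (f (Suc j)) \<and>
      (\<forall>k\<le>j. S \<inter> D k \<inter> {fst (snd (f j))..<fst (f (Suc j))} \<noteq> {})"
  proof (rule dependent_nat_choice)
    show "\<exists>s. ok 0 s" using freeze[of 0 0] by (auto simp: ok_def)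
    show "\<exists>s'. ok (Suc j) s' \<and> fst (snd s) < fst s' \<and>
        (\<forall>k\<le>j. S \<inter> D k \<inter> {fst (snd s)..<fst s'} \<noteq> {})" for s j
    proof -
      obtain q where q: "fst (snd s) < q" "\<forall>k\<le>j. S \<inter> D k \<inter> {fst (snd s)..<q} \<noteq> {}"
        using meet by blast
      obtain r u where "ok (Suc j) (q, r, u)" using freeze[of q "Suc j"] by (auto simp: ok_def)
      then show ?thesis using q by (intro exI[of _ "(q, r, u)"]) simp
    qed
  qed
  then obtain f where f: "\<And>j. ok j (f j)" "\<And>j. fst (snd (f j)) < fst (f (Suc j))"
    "\<And>j k. k \<le> j \<Longrightarrow> S \<inter> D k \<inter> {fst (snd (f j))..<fst (f (Suc j))} \<noteq> {}"
    by blast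
  define q where "q j = fst (f j)" for j
  define r where "r j = fst (snd (f j))" for j
  define u where "u j = snd (snd (f j))" for j
  have qr: "q j \<le> r j" and u: "u j \<subseteq> S \<inter> {q j..<r j}"
    and ag: "\<And>t k. t \<subseteq> S \<inter> {..<q j} \<Longrightarrow> k < j \<Longrightarrow> agree j (r j, t \<union> u j) k" for j
    using f(1)[of j] by (auto simp: ok_def q_def r_def u_def split: prod.splits)
  have rq: "r j < q (Suc j)" for j using f(2) by (simp add: q_def r_def)
  have q_mono: "q i \<le> q j" if "i \<le> j" for i j
    by (rule lift_Suc_mono_le[of q, OF _ that]) (use qr rq in \<open>meson le_less_trans less_imp_le\<close>)
  have r_q: "r i \<le> q j" if "i < j" for i j
    using rq[of i] q_mono[of "Suc i" j] that by simp
  have r_ge: "j \<le> r j" for j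
  proof (induction j)
    case (Suc j)
    then show ?case using rq[of j] qr[of "Suc j"] by simp
  qed simp
  define E where "E = S \<inter> (\<Union>j. {r j..<q (Suc j)})"
  define U where "U = (\<Union>j. u j)"
  have not_frozen: "i \<notin> E" if i: "q j \<le> i" "i < r j" for i j
  proof
    assume "i \<in> E"
    then obtain j' where "r j' \<le> i" "i < q (Suc j')" by (auto simp: E_def)
    then show False
      using i q_mono[of "Suc j'" j] r_q[of j j'] q_mono[of j j'] qr[of j']
      by (cases j j' rule: linorder_cases) auto
  qed
  have U_block: "U \<inter> {q j..<r j} = u j" for j
  proof
    show "u j \<subseteq> U \<inter> {q j..<r j}" using u[of j] by (auto simp: U_def)
    show "U \<inter> {q j..<r j} \<subseteq> u j"
    proof
      fix i assume "i \<in> U \<inter> {q j..<r j}"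
      then obtain j' where j': "i \<in> u j'" "q j \<le> i" "i < r j" by (auto simp: U_def)
      then have "q j' \<le> i" "i < r j'" using u[of j'] by auto
      then have "j' = j"
        using j'(2,3) r_q[of j j'] r_q[of j' j] by (cases j j' rule: linorder_cases) auto
      then show "i \<in> u j" using j'(1) by simp
    qed
  qed
  have UE: "U \<inter> E = {}"
    using u not_frozen by (fastforce simp: U_def)
  have US: "U \<subseteq> S" using u by (auto simp: U_def)
  have ES: "E \<subseteq> S" by (auto simp: E_def)
  \<comment> \<open>Block \<open>Suc n\<close> settles outputs below \<open>Suc n\<close> on pieces
    with index below \<open>Suc n\<close>, whence \<open>k \<le> n\<close>. It contains no point of
    \<open>E\<close>, so the input below its start determines the whole segment up to its
    end.\<close>
  have local: "n \<in> A (a \<union> U) \<longleftrightarrow> n \<in> A (b \<union> U)"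
    if a: "a \<subseteq> E" "b \<subseteq> E" "a \<union> U \<in> Z k" "b \<union> U \<in> Z k" and n: "n \<in> A S" "k \<le> n"
      and eq: "a \<inter> {..<q (Suc n)} = b \<inter> {..<q (Suc n)}" for a b k n
  proof -
    let ?j = "Suc n"
    let ?t = "(a \<union> U) \<inter> {..<q ?j}"
    have split: "(c \<union> U) \<inter> {..<r ?j} = (c \<union> U) \<inter> {..<q ?j} \<union> u ?j" if "c \<subseteq> E" for c
    proof -
      have "c \<inter> {q ?j..<r ?j} = {}" using that not_frozen[of ?j] by auto
      moreover have "{..<r ?j} = {..<q ?j} \<union> {q ?j..<r ?j}" using qr[of ?j] by auto
      ultimately show ?thesis using U_block[of ?j] by (simp add: Int_Un_distrib Int_Un_distrib2)
    qed
    have agr: "agree ?j (r ?j, ?t \<union> u ?j) k"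
      by (rule ag) (use a(1) ES US n(2) in auto)
    have sa: "(a \<union> U) \<inter> {..<r ?j} = ?t \<union> u ?j" by (rule split[OF a(1)])
    have "(b \<union> U) \<inter> {..<q ?j} = ?t" using eq by (simp add: Int_Un_distrib2)
    with split[OF a(2)] have sb: "(b \<union> U) \<inter> {..<r ?j} = ?t \<union> u ?j" by simp
    show ?thesis
      by (rule agr[unfolded agree_def fst_conv snd_conv, rule_format, OF a(3,4) sa sb lessI n(1)])
  qed
  \<comment> \<open>The index adds to the piece of \<open>a \<union> U\<close> a threshold
    \<open>p\<close>, past which \<open>A a\<close> can be read off \<open>A (a \<union> U)\<close>
    inside \<open>A E\<close>, and the bits of \<open>A a\<close> below \<open>p\<close>. The
    condition \<open>k \<le> p\<close> brings all outputs from \<open>p\<close> on within the scope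
    of \<open>local\<close>.\<close>
  define Y where "Y c = (case c of (k, p, l) \<Rightarrow> {a. a \<subseteq> E \<and> a \<union> U \<in> Z k \<and> k \<le> p \<and>
      (\<forall>n\<ge>p. n \<in> A E \<longrightarrow> n \<in> A S \<and> (n \<in> A a \<longleftrightarrow> n \<in> A (a \<union> U))) \<and> map (\<lambda>n. n \<in> A a) [0..<p] = l})"
    for c :: "nat \<times> nat \<times> bool list"
  show thesis
  proof (rule that[of E "\<lambda>n. q (Suc n)" "\<lambda>i. Y (from_nat i)"])
    show "\<forall>k. infinite (E \<inter> D k)"
    proof
      fix k
      have "\<exists>i\<ge>m. i \<in> E \<inter> D k" for m
      proof -
        obtain i where "i \<in> S \<inter> D k \<inter> {r (max k m)..<q (Suc (max k m))}"
          using f(3)[of k "max k m"] unfolding q_def r_def by fastforce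
        then show ?thesis
          using r_ge[of "max k m"] by (intro exI[of _ i]) (auto simp: E_def)
      qed
      then show "infinite (E \<inter> D k)" unfolding infinite_nat_iff_unbounded_le by blast
    qed
    have cover: "Pow E \<subseteq> (\<Union>i. Y (from_nat i))"
    proof
      fix a assume a: "a \<in> Pow E"
      then obtain k where k: "a \<union> U \<in> Z k"
        using Z_cover[of "a \<union> U"] ES US by auto
      have "a = (a \<union> U) \<inter> E" using a UE by auto
      then have "\<forall>\<^sub>\<infinity>n. n \<in> A a \<longleftrightarrow> n \<in> A (a \<union> U) \<and> n \<in> A E"
        using Int[of "a \<union> U" E] by simp
      then have "\<forall>\<^sub>\<infinity>n. n \<in> A E \<longrightarrow> n \<in> A S \<and> (n \<in> A a \<longleftrightarrow> n \<in> A (a \<union> U))"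
        using mono[OF ES] by eventually_elim blast
      then obtain p where p: "\<forall>n\<ge>p. n \<in> A E \<longrightarrow> n \<in> A S \<and> (n \<in> A a \<longleftrightarrow> n \<in> A (a \<union> U))"
        unfolding MOST_nat_le by blast
      have "a \<in> Y (k, max k p, map (\<lambda>n. n \<in> A a) [0..<max k p])"
        using a k p by (simp add: Y_def)
      then have "a \<in> Y (from_nat (to_nat (k, max k p, map (\<lambda>n. n \<in> A a) [0..<max k p])))"
        by simp
      then show "a \<in> (\<Union>i. Y (from_nat i))" by blast
    qed
    have determined: "n \<in> A a \<longleftrightarrow> n \<in> A b"
      if ab: "a \<in> Y (from_nat i)" "b \<in> Y (from_nat i)" "n \<in> A E"
      "a \<inter> {..<q (Suc n)} = b \<inter> {..<q (Suc n)}" for i a b n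
    proof -
      obtain k p l where i: "from_nat i = (k :: nat, p :: nat, l :: bool list)"
        by (metis prod_cases3)
      have a: "a \<subseteq> E" "a \<union> U \<in> Z k" "k \<le> p" "p \<le> n \<Longrightarrow> n \<in> A S \<and> (n \<in> A a \<longleftrightarrow> n \<in> A (a \<union> U))"
        "map (\<lambda>n. n \<in> A a) [0..<p] = l" using ab(1,3) by (auto simp: i Y_def)
      have b: "b \<subseteq> E" "b \<union> U \<in> Z k" "p \<le> n \<Longrightarrow> n \<in> A b \<longleftrightarrow> n \<in> A (b \<union> U)"
        "map (\<lambda>n. n \<in> A b) [0..<p] = l" using ab(2,3) by (auto simp: i Y_def)
      show ?thesis
      proof (cases "n < p")
        case True
        have "map (\<lambda>n. n \<in> A a) [0..<p] ! n = map (\<lambda>n. n \<in> A b) [0..<p] ! n" using a(5) b(4) by simp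
        then show ?thesis using True by simp
      next
        case False
        then show ?thesis using local[OF a(1) b(1) a(2) b(2), of n] a(3,4) b(3) ab(4) by simp
      qed
    qed
    show "locally_determined A E (\<lambda>n. q (Suc n)) (\<lambda>i. Y (from_nat i))"
      unfolding locally_determined_def
    proof (intro conjI cover allI ballI impI)
      fix i a b n
      assume "a \<in> Y (from_nat i)" "b \<in> Y (from_nat i)" "n \<in> A E"
        "a \<inter> {..<q (Suc n)} = b \<inter> {..<q (Suc n)}"
      then show "(n \<in> A a) = (n \<in> A b)" by (rule determined)
    qed
  qed
qed

end

section \<open>From two-sided locality to partial injections\<close>

lemma uncountable_Pow_infinite:
  fixes e :: "nat set"
  assumes "infinite e"
  shows "uncountable (Pow e)"
proof
  assume "countable (Pow e)"
  let ?h = "\<lambda>x :: nat \<Rightarrow> bool. enumerate e ` {n. x n}"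
  have "inj ?h"
  proof (rule injI)
    fix x y assume "?h x = ?h y"
    then have "{n. x n} = {n. y n}"
      by (simp add: inj_image_eq_iff[OF inj_enumerate[OF assms]])
    then show "x = y" by (simp add: Collect_inj)
  qed
  moreover have "range ?h \<subseteq> Pow e" using enumerate_in_set[OF assms] by auto
  then have "countable (range ?h)" using \<open>countable (Pow e)\<close> by (rule countable_subset)
  ultimately show False
    using uncountable_Cantor_space countable_image_inj_on[of ?h UNIV] by simp
qed

text \<open>The map \<open>g\<close> runs from outputs to inputs, as \<open>f\<close> does in a
  trivial map. Testing subsets of \<open>ran g\<close> controls every \<open>a\<close> on
  \<open>dom g\<close>, by intersecting with \<open>ran g\<close>; see
  \<open>trivialises_on_dom\<close>.\<close>

definition trivialises :: "(nat set \<Rightarrow> nat set) \<Rightarrow> (nat \<rightharpoonup> nat) \<Rightarrow> bool" where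
  "trivialises A g \<longleftrightarrow> inj_on g (dom g) \<and>
     (\<forall>a\<subseteq>ran g. \<forall>\<^sub>\<infinity>n. n \<in> A a \<longleftrightarrow> (\<exists>i\<in>a. g n = Some i))"

locale almost_iso = A: almost_hom A + A': almost_hom A' for A A' +
  assumes left: "\<forall>\<^sub>\<infinity>n. n \<in> A' (A X) \<longleftrightarrow> n \<in> X"
    and right: "\<forall>\<^sub>\<infinity>n. n \<in> A (A' X) \<longleftrightarrow> n \<in> X"

sublocale almost_iso \<subseteq> inverse: almost_iso A' A
  by standard (rule right left)+

context almost_iso
begin

lemma infinite_image:
  assumes "infinite X"
  shows "infinite (A X)"
proof
  assume "finite (A X)"
  from A'.image_finite[OF this] left[of X] have "\<forall>\<^sub>\<infinity>n. n \<notin> X" by eventually_elim auto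
  then show False using assms by (simp add: eventually_cofinite)
qed

end

context almost_iso
begin

text \<open>Almost every input has an output because \<open>A\<close> keeps infinite sets infinite.
  Almost every input has only one because \<open>A\<close> is onto modulo finite: a set with just
  one of two outputs of each multiple input would be almost some \<open>A a\<close>, but
  \<open>A a\<close> contains almost all outputs of the inputs in \<open>a\<close>.\<close>

lemma trivialiser_of_relation:
  assumes range: "\<And>n i. \<rho> n i \<Longrightarrow> i \<in> S" and func: "\<And>n i j. \<rho> n i \<Longrightarrow> \<rho> n j \<Longrightarrow> i = j"
    and fin: "\<And>i. finite {n. \<rho> n i}"
    and triv: "\<And>a. a \<subseteq> S \<Longrightarrow> \<forall>\<^sub>\<infinity>n. n \<in> A a \<longleftrightarrow> (\<exists>i\<in>a. \<rho> n i)"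
  obtains g where "trivialises A g" "ran g \<subseteq> S" "finite (S - ran g)"
proof -
  define Q where "Q = {i \<in> S. \<forall>n. \<not> \<rho> n i}"
  define P where "P = {i. \<exists>n n'. n \<noteq> n' \<and> \<rho> n i \<and> \<rho> n' i}"
  have "finite Q"
  proof (rule ccontr)
    assume "infinite Q"
    then have "infinite (A Q)" by (rule infinite_image)
    moreover have "\<forall>\<^sub>\<infinity>n. n \<in> A Q \<longleftrightarrow> (\<exists>i\<in>Q. \<rho> n i)" by (rule triv) (auto simp: Q_def)
    then have "\<forall>\<^sub>\<infinity>n. n \<notin> A Q" by eventually_elim (auto simp: Q_def)
    ultimately show False by (simp add: eventually_cofinite)
  qed
  have "finite P"
  proof (rule ccontr)
    assume P: "infinite P"
    have "\<forall>i\<in>P. \<exists>p. fst p \<noteq> snd p \<and> \<rho> (fst p) i \<and> \<rho> (snd p) i" by (auto simp: P_def)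
    then obtain p where p: "\<And>i. i \<in> P \<Longrightarrow> fst (p i) \<noteq> snd (p i) \<and> \<rho> (fst (p i)) i \<and> \<rho> (snd (p i)) i"
      by metis
    define b where "b = (fst \<circ> p) ` P"
    define a where "a = A' b \<inter> S"
    have bS: "\<forall>\<^sub>\<infinity>n. n \<in> A S \<longleftrightarrow> (\<exists>i\<in>S. \<rho> n i)" by (rule triv) simp
    have b_rho: "\<exists>i\<in>S. \<rho> n i" if "n \<in> b" for n
      using that p range unfolding b_def by fastforce
    have "\<forall>\<^sub>\<infinity>n. n \<in> A a \<longleftrightarrow> (\<exists>i\<in>a. \<rho> n i)" by (rule triv) (simp add: a_def)
    moreover have "\<forall>\<^sub>\<infinity>n. n \<in> A a \<longleftrightarrow> n \<in> A (A' b) \<and> n \<in> A S"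
      unfolding a_def by (rule A.Int)
    ultimately have "\<forall>\<^sub>\<infinity>n. n \<in> b \<longleftrightarrow> (\<exists>i\<in>a. \<rho> n i)"
      using right[of b] bS by eventually_elim (use b_rho in blast)
    then obtain m where m: "\<And>n. n \<ge> m \<Longrightarrow> n \<in> b \<longleftrightarrow> (\<exists>i\<in>a. \<rho> n i)"
      unfolding MOST_nat_le by blast
    \<comment> \<open>An output determines its input, so only finitely many inputs have an output
      below \<open>m\<close>.\<close>
    have "finite {i \<in> P. fst (p i) < m \<or> snd (p i) < m}"
    proof (rule finite_subset)
      show "{i \<in> P. fst (p i) < m \<or> snd (p i) < m} \<subseteq> (\<lambda>n. THE i. \<rho> n i) ` {..<m}"
      proof
        fix i assume i: "i \<in> {i \<in> P. fst (p i) < m \<or> snd (p i) < m}"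
        then obtain n where n: "n < m" "\<rho> n i" using p by blast
        then have "(THE i. \<rho> n i) = i" using func by blast
        then show "i \<in> (\<lambda>n. THE i. \<rho> n i) ` {..<m}" using n(1) by (metis imageI lessThan_iff)
      qed
    qed simp
    then have "infinite (P - {i \<in> P. fst (p i) < m \<or> snd (p i) < m})"
      using P by (rule Diff_infinite_finite)
    then obtain i where "i \<in> P - {i \<in> P. fst (p i) < m \<or> snd (p i) < m}"
      using infinite_imp_nonempty by blast
    then have i: "i \<in> P" "m \<le> fst (p i)" "m \<le> snd (p i)" by auto
    note pi = p[OF i(1)]
    have "fst (p i) \<in> b" using i(1) by (simp add: b_def)
    then have "i \<in> a" using m[OF i(2)] pi func by blast
    then have "snd (p i) \<in> b" using m[OF i(3)] pi by blast
    then obtain j where j: "j \<in> P" "snd (p i) = fst (p j)" by (auto simp: b_def)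
    then have "j = i" using p[OF j(1)] pi func by metis
    then show False using j(2) pi by simp
  qed
  define g where "g n = (if \<exists>i\<in>S - P. \<rho> n i then Some (THE i. \<rho> n i) else None)" for n
  have g: "g n = Some i \<longleftrightarrow> i \<notin> P \<and> \<rho> n i" for n i
  proof -
    have "(THE i. \<rho> n i) = j" if "\<rho> n j" for j using that func by blast
    then show ?thesis unfolding g_def using func range by (auto split: if_splits)
  qed
  have "inj_on g (dom g)"
  proof (rule inj_onI)
    fix n n' assume n: "n \<in> dom g" "g n = g n'"
    then obtain i where "g n = Some i" by blast
    then have "g n = Some i" "g n' = Some i" using n(2) by simp_all
    then have "i \<notin> P" "\<rho> n i" "\<rho> n' i" using g by auto
    then show "n = n'" by (auto simp: P_def)
  qed
  moreover have ran: "ran g = S - P - Q"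
    using range by (auto simp: ran_def g Q_def)
  moreover have "\<forall>\<^sub>\<infinity>n. n \<in> A a \<longleftrightarrow> (\<exists>i\<in>a. g n = Some i)" if a: "a \<subseteq> ran g" for a
  proof -
    have "\<forall>\<^sub>\<infinity>n. n \<in> A a \<longleftrightarrow> (\<exists>i\<in>a. \<rho> n i)" by (rule triv) (use a ran in blast)
    then show ?thesis by eventually_elim (use a ran in \<open>auto simp: g\<close>)
  qed
  ultimately have "trivialises A g" unfolding trivialises_def by blast
  moreover have "S - ran g \<subseteq> P \<union> Q" unfolding ran by blast
  then have "finite (S - ran g)" using \<open>finite P\<close> \<open>finite Q\<close> finite_subset by blast
  ultimately show thesis using that ran by blast
qed

text \<open>
  If infinitely many outputs in \<open>A a\<close> were far from \<open>a\<close>, then every bit of a subset \<open>R\<close> of some infinite set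
  could be predicted from the earlier bits: the locality of \<open>A\<close> computes enough of \<open>A R\<close>, and the locality of
  \<open>A'\<close> then recovers the next bit of \<open>R\<close>. Countably many predictors cannot be correct about all \<open>R\<close>.
\<close>

lemma two_sided_locality:
  assumes E: "locally_determined A E w Y" and E': "locally_determined A' E' w' Y'"
    and a: "a \<subseteq> E" "a \<subseteq> A' E'"
  shows "\<forall>\<^sub>\<infinity>n. n \<in> A a \<longrightarrow> (\<exists>i\<in>a. i < w n \<and> n < w' i)"
proof -
  define C where "C = {n \<in> A a \<inter> A E \<inter> E'. \<forall>i\<in>a. \<not> (i < w n \<and> n < w' i)}"
  have "finite C"
  proof (rule ccontr)
    assume C: "infinite C"
    define e where "e = a \<inter> A' C"
    have "C \<subseteq> A a" by (auto simp: C_def)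
    from A'.mono[OF this] left[of a] have "\<forall>\<^sub>\<infinity>n. n \<in> A' C \<longrightarrow> n \<in> a" by eventually_elim blast
    then have "infinite {n \<in> A' C. n \<in> a}"
      by (rule infinite_Collect_MOST[OF inverse.infinite_image[OF C]])
    moreover have "{n \<in> A' C. n \<in> a} = e" by (auto simp: e_def)
    ultimately have "infinite e" by simp
    \<comment> \<open>Cutting \<open>A R\<close> down to \<open>C\<close> keeps the argument of
      \<open>A'\<close> inside \<open>E'\<close>; it removes only finitely many points because
      \<open>R \<subseteq> A' C\<close>.\<close>
    have dec: "\<exists>k k' m. R \<in> Y k \<and> A R \<inter> C \<in> Y' k' \<and> (\<forall>i\<ge>m. i \<in> A' (A R \<inter> C) \<longleftrightarrow> i \<in> R)"
      if R: "R \<subseteq> e" for R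
    proof -
      have "R \<in> Pow E" "A R \<inter> C \<in> Pow E'" using R a(1) by (auto simp: e_def C_def)
      then obtain k k' where "R \<in> Y k" "A R \<inter> C \<in> Y' k'"
        using E[unfolded locally_determined_def, THEN conjunct1]
          E'[unfolded locally_determined_def, THEN conjunct1] by blast
      moreover have "\<forall>\<^sub>\<infinity>n. n \<in> A R \<longrightarrow> n \<in> C"
      proof -
        have "R \<subseteq> A' C" using R by (auto simp: e_def)
        from A.mono[OF this] right[of C] show ?thesis by eventually_elim blast
      qed
      then have "\<forall>\<^sub>\<infinity>n. n \<in> A R \<inter> C \<longleftrightarrow> n \<in> A R" by eventually_elim blast
      from A'.cong[OF this] left[of R] have "\<forall>\<^sub>\<infinity>i. i \<in> A' (A R \<inter> C) \<longleftrightarrow> i \<in> R"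
        by eventually_elim blast
      ultimately show ?thesis unfolding MOST_nat_le by blast
    qed
    then have "\<forall>R. \<exists>p. R \<subseteq> e \<longrightarrow> R \<in> Y (fst p) \<and> A R \<inter> C \<in> Y' (fst (snd p)) \<and>
        (\<forall>i\<ge>snd (snd p). i \<in> A' (A R \<inter> C) \<longleftrightarrow> i \<in> R)"
      by (metis fst_conv snd_conv)
    then obtain p where p: "\<forall>R. R \<subseteq> e \<longrightarrow> R \<in> Y (fst (p R)) \<and> A R \<inter> C \<in> Y' (fst (snd (p R))) \<and>
        (\<forall>i\<ge>snd (snd (p R)). i \<in> A' (A R \<inter> C) \<longleftrightarrow> i \<in> R)"
      by (rule choice[THEN exE])
    obtain R R' where RR: "R \<in> Pow e" "R' \<in> Pow e" "R \<noteq> R'"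
      "(p R, map (\<lambda>i. i \<in> R) [0..<snd (snd (p R))]) = (p R', map (\<lambda>i. i \<in> R') [0..<snd (snd (p R'))])"
      by (rule uncountable_pigeonhole[OF uncountable_Pow_infinite[OF \<open>infinite e\<close>]])
    define i where "i = (LEAST i. (i \<in> R) \<noteq> (i \<in> R'))"
    have "\<exists>i. (i \<in> R) \<noteq> (i \<in> R')" using RR(3) by blast
    then have i: "(i \<in> R) \<noteq> (i \<in> R')" unfolding i_def by (rule LeastI_ex)
    have below: "j \<in> R \<longleftrightarrow> j \<in> R'" if "j < i" for j
      using not_less_Least[of j "\<lambda>i. (i \<in> R) \<noteq> (i \<in> R')"] that unfolding i_def by blast
    have m: "snd (snd (p R)) \<le> i"
    proof (rule ccontr)
      assume "\<not> ?thesis"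
      then show False using RR(4) i by auto
    qed
    have R: "R \<subseteq> e" "R' \<subseteq> e" and pp: "p R' = p R" using RR by auto
    note pR = p[rule_format, OF R(1)] and pR' = p[rule_format, OF R(2), unfolded pp]
    have "i \<in> e" using i R by blast
    then have ia: "i \<in> a" by (simp add: e_def)
    have "n \<in> A R \<longleftrightarrow> n \<in> A R'" if n: "n \<in> C" "n < w' i" for n
    proof -
      \<comment> \<open>By the definition of \<open>C\<close>, \<open>n < w' i\<close> excludes
        \<open>i < w n\<close>. So output \<open>n\<close> reads \<open>R\<close> only below
        \<open>i\<close>, where \<open>R\<close> and \<open>R'\<close> coincide.\<close>
      have "w n \<le> i" using n ia by (auto simp: C_def)
      then have "R \<inter> {..<w n} = R' \<inter> {..<w n}" using below by auto
      moreover have "R \<subseteq> E" "R' \<subseteq> E" using R a(1) by (auto simp: e_def)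
      ultimately show ?thesis
        using E[unfolded locally_determined_def, THEN conjunct2, rule_format, of R "fst (p R)" R' n]
          pR pR' n(1) by (simp add: C_def)
    qed
    then have "(A R \<inter> C) \<inter> {..<w' i} = (A R' \<inter> C) \<inter> {..<w' i}" by auto
    moreover have "A R \<inter> C \<subseteq> E'" "A R' \<inter> C \<subseteq> E'" by (auto simp: C_def)
    moreover have "i \<in> A' E'" using ia a(2) by blast
    ultimately have "i \<in> A' (A R \<inter> C) \<longleftrightarrow> i \<in> A' (A R' \<inter> C)"
      using E'[unfolded locally_determined_def, THEN conjunct2, rule_format,
          of "A R \<inter> C" "fst (snd (p R))" "A R' \<inter> C" i] pR pR' by blast
    then show False using pR pR' m i by blast
  qed
  then have "\<forall>\<^sub>\<infinity>n. n \<notin> C" by (simp add: eventually_cofinite)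
  then show ?thesis
    using A.mono[OF a(1)] A.mono[OF a(2)] right[of E']
    by eventually_elim (auto simp: C_def)
qed

text \<open>Two-sided locality leaves each output finitely many candidate inputs and each input
  finitely many candidate outputs. Once the inputs are thinned so that no two share a candidate
  output, \<open>near\<close> is a function, and applying locality to both \<open>a\<close> and
  \<open>S' - a\<close> makes it exact.\<close>

theorem local_trivialiser:
  fixes D :: "nat \<Rightarrow> nat set"
  assumes OCA and D: "\<And>k. infinite (D k)"
  obtains g where "trivialises A g" "\<And>k. infinite (ran g \<inter> D k)"
proof -
  obtain E w Y where ED: "\<forall>k. infinite (E \<inter> D k)" and E: "locally_determined A E w Y"
    by (rule A.one_sided_locality[of D, OF \<open>OCA\<close> D])
  \<comment> \<open>\<open>E'\<close> is made to meet the images of \<open>E \<inter> D k\<close>,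
    so that pulling it back leaves an infinite part of every \<open>D k\<close>.\<close>
  have "infinite (A (E \<inter> D k))" for k
    using infinite_image ED by blast
  then obtain E' w' Y' where ED': "\<forall>k. infinite (E' \<inter> A (E \<inter> D k))" and E': "locally_determined A' E' w' Y'"
    by (rule A'.one_sided_locality[of "\<lambda>k. A (E \<inter> D k)", OF \<open>OCA\<close>])
  define near where "near i n \<longleftrightarrow> i < w n \<and> n < w' i" for i n
  have two: "\<forall>\<^sub>\<infinity>n. n \<in> A a \<longrightarrow> (\<exists>i\<in>a. near i n)" if "a \<subseteq> E" "a \<subseteq> A' E'" for a
    unfolding near_def by (rule two_sided_locality[OF E E' that])
  define S where "S = E \<inter> A' E'"
  have SD: "infinite (S \<inter> D k)" for k
  proof
    assume "finite (S \<inter> D k)"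
    then have "\<forall>\<^sub>\<infinity>n. n \<notin> S \<inter> D k" by (simp add: eventually_cofinite Int_def)
    then have "\<forall>\<^sub>\<infinity>n. n \<notin> A' (E' \<inter> A (E \<inter> D k))"
      using A'.Int[of E' "A (E \<inter> D k)"] left[of "E \<inter> D k"]
      by eventually_elim (auto simp: S_def)
    then show False using inverse.infinite_image[OF ED'[rule_format]] by (simp add: eventually_cofinite)
  qed
  define clash where "clash i j \<longleftrightarrow> (\<exists>n. near i n \<and> near j n)" for i j
  have clash_fin: "finite {j. clash i j}" for i
  proof (rule finite_subset)
    show "{j. clash i j} \<subseteq> (\<Union>n<w' i. {..<w n})" by (auto simp: clash_def near_def)
  qed simp
  \<comment> \<open>The use of \<open>prod_decode\<close> visits each \<open>D k\<close> infinitely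
    often.\<close>
  obtain g where g: "strict_mono g" "\<And>l. g l \<in> S \<inter> D (fst (prod_decode l))"
    "\<And>i j. i < j \<Longrightarrow> \<not> clash (g i) (g j)"
    by (rule sparse_choice[of "\<lambda>l. S \<inter> D (fst (prod_decode l))" clash, OF SD clash_fin]) blast
  define S' where "S' = range g"
  have S'D: "infinite (S' \<inter> D k)" for k
  proof -
    have "inj (\<lambda>l. g (prod_encode (k, l)))"
      using g(1) by (auto intro!: injI simp: strict_mono_eq)
    then have "infinite (range (\<lambda>l. g (prod_encode (k, l))))"
      using finite_imageD infinite_UNIV_nat by blast
    moreover have "range (\<lambda>l. g (prod_encode (k, l))) \<subseteq> S' \<inter> D k"
      using g(2)[of "prod_encode (k, l)" for l] by (auto simp: S'_def)
    ultimately show ?thesis using finite_subset by blast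
  qed
  have no_clash: "i = j" if ij: "i \<in> S'" "j \<in> S'" "near i n" "near j n" for i j n
  proof -
    obtain k l where kl: "i = g k" "j = g l" using ij(1,2) by (auto simp: S'_def)
    have "clash i j" "clash j i" using ij by (auto simp: clash_def)
    then show ?thesis using g(3)[of k l] g(3)[of l k] kl by (cases k l rule: linorder_cases) auto
  qed
  have S'S: "S' \<subseteq> S" using g(2) by (auto simp: S'_def)
  define \<rho> where "\<rho> n i \<longleftrightarrow> n \<in> A S' \<and> i \<in> S' \<and> near i n" for n i
  have triv: "\<forall>\<^sub>\<infinity>n. n \<in> A a \<longleftrightarrow> (\<exists>i\<in>a. \<rho> n i)" if a: "a \<subseteq> S'" for a
  proof -
    have "\<forall>\<^sub>\<infinity>n. n \<in> A a \<longrightarrow> (\<exists>i\<in>a. near i n)"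
      by (rule two) (use a S'S in \<open>auto simp: S_def\<close>)
    moreover have "\<forall>\<^sub>\<infinity>n. n \<in> A (S' - a) \<longrightarrow> (\<exists>i\<in>S' - a. near i n)"
      by (rule two) (use a S'S in \<open>auto simp: S_def\<close>)
    ultimately show ?thesis
      using A.Diff[of S' a] A.mono[OF a]
      by eventually_elim (use a no_clash in \<open>unfold \<rho>_def, blast\<close>)
  qed
  have fin: "finite {n. \<rho> n i}" for i
    by (rule finite_subset[of _ "{..<w' i}"]) (auto simp: \<rho>_def near_def)
  obtain h where h: "trivialises A h" "ran h \<subseteq> S'" "finite (S' - ran h)"
    by (rule trivialiser_of_relation[of \<rho> S', OF _ _ fin triv]) (use no_clash in \<open>auto simp: \<rho>_def\<close>)
  show thesis
  proof (rule that[OF h(1)])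
    fix k
    have "S' \<inter> D k \<subseteq> (ran h \<inter> D k) \<union> (S' - ran h)" by blast
    then show "infinite (ran h \<inter> D k)"
      using S'D[of k] h(3) by (meson finite_UnI finite_subset)
  qed
qed

end

section \<open>Automorphisms are trivial\<close>

text \<open>
  Two conditions with the same stem, the same bound \<open>m\<close> and the same finite data are compatible: mixed
  pairs inherit old witnesses, and only corresponding members need new ones.
\<close>

lemma MA_generic_sequence_pairwise:
  fixes wit :: "'h \<Rightarrow> 'h \<Rightarrow> 'v :: countable list \<Rightarrow> bool"
    and data :: "'v list \<Rightarrow> nat \<Rightarrow> 'h \<Rightarrow> 'd :: countable"
  assumes MA: MA_sigma_linked and H: "uncountable H"
    and sym: "\<And>h h' s. wit h h' s \<Longrightarrow> wit h' h s"
    and mono: "\<And>h h' s t. wit h h' s \<Longrightarrow> wit h h' (s @ t)"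
    and ex: "\<And>s F. finite F \<Longrightarrow> F \<subseteq> H \<Longrightarrow> \<exists>m. bnd s m F"
    and old: "\<And>s m F h h' g. bnd s m F \<Longrightarrow> F \<subseteq> H \<Longrightarrow> h \<in> F \<Longrightarrow> h' \<in> F \<Longrightarrow> h \<noteq> h' \<Longrightarrow> g \<in> H \<Longrightarrow>
        wit h h' s \<Longrightarrow> data s m h' = data s m g \<Longrightarrow> wit h g s"
    and new: "\<And>s m xs ys. bnd s m (set xs) \<Longrightarrow> bnd s m (set ys) \<Longrightarrow> set xs \<subseteq> H \<Longrightarrow> set ys \<subseteq> H \<Longrightarrow>
        distinct xs \<Longrightarrow> distinct ys \<Longrightarrow> length xs = length ys \<Longrightarrow>
        (\<And>i. i < length xs \<Longrightarrow> data s m (xs ! i) = data s m (ys ! i)) \<Longrightarrow>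
        \<exists>t. \<forall>i<length xs. xs ! i \<noteq> ys ! i \<longrightarrow> wit (xs ! i) (ys ! i) (s @ t)"
  obtains c H' where "H' \<subseteq> H" "uncountable H'"
    "\<And>h h'. h \<in> H' \<Longrightarrow> h' \<in> H' \<Longrightarrow> h \<noteq> h' \<Longrightarrow> \<exists>m. wit h h' (map c [0..<m])"
proof -
  define m where "m s F = (SOME m. bnd s m F)" for s F
  have m: "bnd s (m s F) F" if "finite F" "F \<subseteq> H" for s F
    unfolding m_def by (rule someI_ex[OF ex[OF that]])
  define code where "code s xs = (m s (set xs), map (data s (m s (set xs))) xs)" for s xs
  show thesis
  proof (rule MA_generic_sequence[of H wit code, OF MA H])
    fix s xs ys
    assume xs: "finite (set xs) \<and> set xs \<subseteq> H \<and> (\<forall>h\<in>set xs. \<forall>h'\<in>set xs. h \<noteq> h' \<longrightarrow> wit h h' s)"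
      and ys: "finite (set ys) \<and> set ys \<subseteq> H \<and> (\<forall>h\<in>set ys. \<forall>h'\<in>set ys. h \<noteq> h' \<longrightarrow> wit h h' s)"
      and dist: "distinct xs" "distinct ys" and code: "code s xs = code s ys"
    define k where "k = m s (set xs)"
    have k': "k = m s (set ys)" and maps: "map (data s k) xs = map (data s k) ys"
      using code by (auto simp: code_def k_def)
    have len: "length xs = length ys" using arg_cong[OF maps, of length] by simp
    have dat: "data s k (xs ! i) = data s k (ys ! i)" if "i < length xs" for i
      using arg_cong[OF maps, of "\<lambda>l. l ! i"] that len by simp
    have bx: "bnd s k (set xs)" and by': "bnd s k (set ys)"
      using m[of "set xs" s] m[of "set ys" s] xs ys k' by (simp_all add: k_def)
    have "\<exists>t. \<forall>i<length xs. xs ! i \<noteq> ys ! i \<longrightarrow> wit (xs ! i) (ys ! i) (s @ t)"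
      by (rule new[OF bx by' _ _ dist len dat]) (use xs ys in simp_all)
    then obtain t where t: "\<And>i. i < length xs \<Longrightarrow> xs ! i \<noteq> ys ! i \<Longrightarrow> wit (xs ! i) (ys ! i) (s @ t)"
      by blast
    have mixed: "wit (xs ! i) (ys ! j) (s @ t)"
      if ij: "i < length xs" "j < length xs" "xs ! i \<noteq> ys ! j" for i j
    proof (cases "i = j")
      case False
      then have "xs ! i \<noteq> xs ! j" using dist(1) ij by (simp add: nth_eq_iff_index_eq)
      then have "wit (xs ! i) (xs ! j) s" using xs ij by simp
      moreover have "ys ! j \<in> H" using ys ij(2) len by auto
      ultimately have "wit (xs ! i) (ys ! j) s"
        using old[OF bx _ _ _ \<open>xs ! i \<noteq> xs ! j\<close>] dat[OF ij(2)] xs ij by simp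
      then show ?thesis by (rule mono)
    qed (use t ij in simp)
    have "wit h h' (s @ t)" if hh: "h \<in> set xs \<union> set ys" "h' \<in> set xs \<union> set ys" "h \<noteq> h'" for h h'
    proof -
      have mix: "wit g g' (s @ t)" if "g \<in> set xs" "g' \<in> set ys" "g \<noteq> g'" for g g'
        using that mixed len unfolding in_set_conv_nth by auto
      consider "h \<in> set xs" "h' \<in> set xs" | "h \<in> set ys" "h' \<in> set ys" | "h \<in> set xs" "h' \<in> set ys"
        | "h \<in> set ys" "h' \<in> set xs" using hh by blast
      then show ?thesis
      proof cases
        case 4
        then show ?thesis using mix[of h' h] hh(3) sym by blast
      qed (use xs ys hh(3) mono mix in blast)+
    qed
    then show "\<exists>t. finite (set xs \<union> set ys) \<and> set xs \<union> set ys \<subseteq> H \<and>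
        (\<forall>h\<in>set xs \<union> set ys. \<forall>h'\<in>set xs \<union> set ys. h \<noteq> h' \<longrightarrow> wit h h' (s @ t))"
      using xs ys by (intro exI[of _ t]) simp
  next
    fix H' c
    assume "H' \<subseteq> H" "uncountable H'" "\<And>h h'. h \<in> H' \<Longrightarrow> h' \<in> H' \<Longrightarrow> h \<noteq> h' \<Longrightarrow> \<exists>m. wit h h' (map c [0..<m])"
    then show thesis by (rule that)
  qed
qed

text \<open>Each vertex has at most two neighbours, so a greedy colouring needs three colours. Four
  are allowed because a colour is then a pair of bits and a colouring a pair of sets, to which
  \<open>A\<close> can be applied.\<close>

lemma partial_injection_4_colourable:
  fixes E :: "(nat \<times> nat) set"
  assumes "finite E" and irr: "\<And>p q. (p, q) \<in> E \<Longrightarrow> p \<noteq> q"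
    and out: "\<And>p q q'. (p, q) \<in> E \<Longrightarrow> (p, q') \<in> E \<Longrightarrow> q = q'"
    and inn: "\<And>p p' q. (p, q) \<in> E \<Longrightarrow> (p', q) \<in> E \<Longrightarrow> p = p'"
  shows "\<exists>c :: nat \<Rightarrow> bool \<times> bool. \<forall>(p, q)\<in>E. c p \<noteq> c q"
proof -
  have "finite V \<Longrightarrow> \<exists>c :: nat \<Rightarrow> bool \<times> bool. \<forall>p\<in>V. \<forall>q\<in>V. (p, q) \<in> E \<longrightarrow> c p \<noteq> c q" for V
  proof (induction V rule: finite_induct)
    case (insert v V)
    then obtain c :: "nat \<Rightarrow> bool \<times> bool" where c: "\<forall>p\<in>V. \<forall>q\<in>V. (p, q) \<in> E \<longrightarrow> c p \<noteq> c q" by blast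
    have "\<exists>x. \<forall>q. (v, q) \<in> E \<longrightarrow> c q = x" using out by blast
    then obtain x where x: "\<And>q. (v, q) \<in> E \<Longrightarrow> c q = x" by blast
    have "\<exists>y. \<forall>p. (p, v) \<in> E \<longrightarrow> c p = y" using inn by blast
    then obtain y where y: "\<And>p. (p, v) \<in> E \<Longrightarrow> c p = y" by blast
    obtain z where z: "z \<noteq> x" "z \<noteq> y"
    proof -
      have "card {x, y} \<le> 2" by (simp add: card_insert_if)
      then have "{x, y} \<noteq> (UNIV :: (bool \<times> bool) set)" by (auto simp: card_UNIV_bool dest: arg_cong[of _ _ card])
      then show thesis using that by auto
    qed
    have "\<forall>p\<in>insert v V. \<forall>q\<in>insert v V. (p, q) \<in> E \<longrightarrow> (c(v := z)) p \<noteq> (c(v := z)) q"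
      using c x y z irr by auto
    then show ?case by blast
  qed simp
  from this[of "fst ` E \<union> snd ` E"] \<open>finite E\<close> obtain c :: "nat \<Rightarrow> bool \<times> bool"
    where c: "\<forall>p\<in>fst ` E \<union> snd ` E. \<forall>q\<in>fst ` E \<union> snd ` E. (p, q) \<in> E \<longrightarrow> c p \<noteq> c q" by auto
  have "c p \<noteq> c q" if "(p, q) \<in> E" for p q
    using c that by force
  then show ?thesis by blast
qed

lemma sparse_subset:
  fixes W :: "nat set"
  assumes W: "infinite W" and fin: "\<And>x. finite {y. R x y}" and sym: "\<And>x y. R x y \<Longrightarrow> R y x"
  shows "\<exists>D\<subseteq>W. infinite D \<and> (\<forall>n\<in>D. \<forall>m\<in>D. n \<noteq> m \<longrightarrow> \<not> R n m)"
proof (rule sparse_choice[of "\<lambda>_. W" R, OF W fin])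
  fix h :: "nat \<Rightarrow> nat"
  assume h: "strict_mono h" "\<And>n. h n \<in> W" "\<And>i j. i < j \<Longrightarrow> \<not> R (h i) (h j)"
  have "\<not> R (h i) (h j)" if "i \<noteq> j" for i j
    using h(3)[of i j] h(3)[of j i] sym[of "h i" "h j"] that by (cases i j rule: linorder_cases) auto
  then have "\<forall>n\<in>range h. \<forall>m\<in>range h. n \<noteq> m \<longrightarrow> \<not> R n m"
    by (metis rangeE)
  moreover have "infinite (range h)"
    by (rule range_inj_infinite[OF strict_mono_imp_inj_on[OF h(1)]])
  ultimately show ?thesis using h(2) by (intro exI[of _ "range h"]) auto
qed

section \<open>Coherence of two trivialisers up to finitely many coordinates\<close>

context almost_iso
begin

lemma trivialises_dom:
  assumes "trivialises A g"
  shows "\<forall>\<^sub>\<infinity>n. n \<in> A (ran g) \<longleftrightarrow> n \<in> dom g"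
proof -
  have "\<forall>\<^sub>\<infinity>n. n \<in> A (ran g) \<longleftrightarrow> (\<exists>i\<in>ran g. g n = Some i)"
    using assms unfolding trivialises_def by blast
  then show ?thesis by eventually_elim (auto simp: ran_def)
qed

lemma trivialises_on_dom:
  assumes "trivialises A g"
  shows "\<forall>\<^sub>\<infinity>n. \<forall>i. g n = Some i \<longrightarrow> (n \<in> A a \<longleftrightarrow> i \<in> a)"
proof -
  have "a \<inter> ran g \<subseteq> ran g" by blast
  then have "\<forall>\<^sub>\<infinity>n. n \<in> A (a \<inter> ran g) \<longleftrightarrow> (\<exists>i\<in>a \<inter> ran g. g n = Some i)"
    using assms unfolding trivialises_def by blast
  then show ?thesis
    using A.Int[of a "ran g"] trivialises_dom[OF assms]
    by eventually_elim (auto simp: ran_def)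
qed

lemma trivialises_image:
  assumes g: "trivialises A g" and D: "D \<subseteq> dom g"
  shows "\<forall>\<^sub>\<infinity>n. n \<in> A ((the \<circ> g) ` D) \<longleftrightarrow> n \<in> D"
proof -
  have "(the \<circ> g) ` D \<subseteq> ran g"
  proof
    fix i assume "i \<in> (the \<circ> g) ` D"
    then obtain d where "d \<in> D" "i = the (g d)" by auto
    then have "g d = Some i" using D by auto
    then show "i \<in> ran g" by (rule ranI)
  qed
  then have "\<forall>\<^sub>\<infinity>n. n \<in> A ((the \<circ> g) ` D) \<longleftrightarrow> (\<exists>i\<in>(the \<circ> g) ` D. g n = Some i)"
    using g unfolding trivialises_def by blast
  moreover have "(\<exists>i\<in>(the \<circ> g) ` D. g n = Some i) \<longleftrightarrow> n \<in> D" for n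
  proof
    assume "\<exists>i\<in>(the \<circ> g) ` D. g n = Some i"
    then obtain d where d: "d \<in> D" "g n = Some (the (g d))" by auto
    then have "g n = g d" "n \<in> dom g" "d \<in> dom g" using D by auto
    then have "n = d" using g unfolding trivialises_def by (auto dest: inj_onD)
    then show "n \<in> D" using d(1) by simp
  next
    assume "n \<in> D"
    then show "\<exists>i\<in>(the \<circ> g) ` D. g n = Some i" using D by force
  qed
  ultimately show ?thesis by simp
qed

text \<open>Infinitely many disagreements could be thinned to a set \<open>D\<close> on which
  \<open>g\<close> and \<open>g'\<close> read disjoint sets of inputs. Both input sets would have
  image almost \<open>D\<close>, whereas \<open>A\<close> preserves disjointness up to a finite
  set.\<close>

lemma trivialises_coherent:
  assumes g: "trivialises A g" and g': "trivialises A g'"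
  shows "\<forall>\<^sub>\<infinity>n. \<forall>i i'. g n = Some i \<longrightarrow> g' n = Some i' \<longrightarrow> i = i'"
proof -
  define W where "W = {n. \<exists>i i'. g n = Some i \<and> g' n = Some i' \<and> i \<noteq> i'}"
  have "finite W"
  proof (rule ccontr)
    assume W: "infinite W"
    have inj: "inj_on g (dom g)" "inj_on g' (dom g')" using g g' by (auto simp: trivialises_def)
    define R where "R n m \<longleftrightarrow> n \<in> W \<and> m \<in> W \<and> (g n = g' m \<or> g' n = g m)" for n m
    have fin: "finite {m. R n m}" for n
    proof (rule finite_subset)
      show "{m. R n m} \<subseteq> (g' -` {g n} \<inter> dom g') \<union> (g -` {g' n} \<inter> dom g)"
        by (auto simp: R_def W_def)
      show "finite ((g' -` {g n} \<inter> dom g') \<union> (g -` {g' n} \<inter> dom g))"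
        by (intro finite_UnI finite_vimage_IntI inj) simp_all
    qed
    have "R m n" if "R n m" for n m using that by (auto simp: R_def)
    from sparse_subset[where R = R, OF W fin this]
    obtain D where DW: "D \<subseteq> W" and "infinite D"
      and no_R: "\<And>n m. n \<in> D \<Longrightarrow> m \<in> D \<Longrightarrow> n \<noteq> m \<Longrightarrow> \<not> R n m"
      by blast
    have dom: "D \<subseteq> dom g" "D \<subseteq> dom g'" using DW by (auto simp: W_def)
    have "(the \<circ> g) ` D \<inter> (the \<circ> g') ` D = {}"
    proof (rule ccontr)
      assume "(the \<circ> g) ` D \<inter> (the \<circ> g') ` D \<noteq> {}"
      then obtain n m where nm: "n \<in> D" "m \<in> D" "the (g n) = the (g' m)" by auto
      have "g n = g' m" using nm dom by force
      moreover have "n \<noteq> m" using nm DW \<open>g n = g' m\<close> by (auto simp: W_def)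
      ultimately show False using no_R[OF nm(1,2)] nm DW by (auto simp: R_def)
    qed
    then have "\<forall>\<^sub>\<infinity>n. n \<in> A {} \<longleftrightarrow> n \<in> A ((the \<circ> g) ` D) \<and> n \<in> A ((the \<circ> g') ` D)"
      using A.Int[of "(the \<circ> g) ` D" "(the \<circ> g') ` D"] by simp
    then have "\<forall>\<^sub>\<infinity>n. n \<notin> A ((the \<circ> g) ` D) \<or> n \<notin> A ((the \<circ> g') ` D)"
      using A.image_empty by eventually_elim auto
    then have "\<forall>\<^sub>\<infinity>n. n \<notin> D"
      using trivialises_image[OF g dom(1)] trivialises_image[OF g' dom(2)] by eventually_elim auto
    then show False using \<open>infinite D\<close> by (simp add: eventually_cofinite)
  qed
  then have "\<forall>\<^sub>\<infinity>n. n \<notin> W" by (simp add: eventually_cofinite)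
  then show ?thesis by eventually_elim (auto simp: W_def)
qed

text \<open>Dually, if infinitely many inputs were read at different outputs \<open>n\<close> and
  \<open>t n\<close>, a thinned \<open>D\<close> would be disjoint from its image under
  \<open>t\<close>, yet both would be almost the image of one input set.\<close>

lemma trivialises_coherent_inverse:
  assumes g: "trivialises A g" and g': "trivialises A g'"
  shows "\<forall>\<^sub>\<infinity>n. \<forall>n' i. g n = Some i \<longrightarrow> g' n' = Some i \<longrightarrow> n = n'"
proof -
  define W where "W = {n. \<exists>n' i. g n = Some i \<and> g' n' = Some i \<and> n \<noteq> n'}"
  have "finite W"
  proof (rule ccontr)
    assume W: "infinite W"
    have inj: "inj_on g (dom g)" "inj_on g' (dom g')" using g g' by (auto simp: trivialises_def)
    have "\<forall>n\<in>W. \<exists>n'. n' \<in> dom g' \<and> g n = g' n' \<and> n \<noteq> n'" by (auto simp: W_def)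
    then obtain t where t: "\<And>n. n \<in> W \<Longrightarrow> t n \<in> dom g' \<and> g n = g' (t n) \<and> n \<noteq> t n" by metis
    have t_inj: "n = m" if "n \<in> W" "m \<in> W" "t n = t m" for n m
    proof (rule inj_onD[OF inj(1)])
      show "g n = g m" using t[OF that(1)] t[OF that(2)] that(3) by simp
    qed (use that in \<open>auto simp: W_def\<close>)
    define R where "R n m \<longleftrightarrow> n \<in> W \<and> m \<in> W \<and> (t n = m \<or> t m = n)" for n m
    have fin: "finite {m. R n m}" for n
    proof (rule finite_subset)
      show "{m. R n m} \<subseteq> insert (t n) (t -` {n} \<inter> W)" by (auto simp: R_def)
      show "finite (insert (t n) (t -` {n} \<inter> W))"
        using finite_vimage_IntI[of "{n}" t W] t_inj by (auto simp: inj_on_def)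
    qed
    have "R m n" if "R n m" for n m using that by (auto simp: R_def)
    from sparse_subset[where R = R, OF W fin this]
    obtain D where DW: "D \<subseteq> W" and "infinite D"
      and no_R: "\<And>n m. n \<in> D \<Longrightarrow> m \<in> D \<Longrightarrow> n \<noteq> m \<Longrightarrow> \<not> R n m"
      by blast
    have dom: "D \<subseteq> dom g" using DW by (auto simp: W_def)
    have dom': "t ` D \<subseteq> dom g'" using DW t by blast
    have "(the \<circ> g) ` D = (the \<circ> g') ` t ` D"
      unfolding image_image by (rule image_cong[OF refl]) (use t DW in force)
    then have "\<forall>\<^sub>\<infinity>n. n \<in> A ((the \<circ> g) ` D) \<longleftrightarrow> n \<in> t ` D"
      using trivialises_image[OF g' dom'] by simp
    then have ev: "\<forall>\<^sub>\<infinity>n. n \<in> D \<longleftrightarrow> n \<in> t ` D"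
      using trivialises_image[OF g dom] by eventually_elim auto
    have "t m \<notin> D" if "m \<in> D" for m
      using no_R[OF that, of "t m"] t[of m] DW that by (auto simp: R_def)
    then have disj: "D \<inter> t ` D = {}" by blast
    from ev have "\<forall>\<^sub>\<infinity>n. n \<notin> D" by eventually_elim (use disj in blast)
    then show False using \<open>infinite D\<close> by (simp add: eventually_cofinite)
  qed
  then have "\<forall>\<^sub>\<infinity>n. n \<notin> W" by (simp add: eventually_cofinite)
  then show ?thesis by eventually_elim (auto simp: W_def)
qed

end

section \<open>Gluing local trivialisers\<close>

context almost_iso
begin

text \<open>Beyond \<open>m\<close> the members of \<open>F\<close> are parts of one partial
  injection and read only inputs that a stem of length \<open>l\<close> has not decided.\<close>

definition coherent_beyond :: "nat \<Rightarrow> nat \<Rightarrow> (nat \<rightharpoonup> nat) set \<Rightarrow> bool" where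
  "coherent_beyond l m F \<longleftrightarrow> (\<forall>g\<in>F. \<forall>g'\<in>F. \<forall>n\<ge>m.
     (\<forall>i. g n = Some i \<longrightarrow> l \<le> i) \<and> (\<forall>i i'. g n = Some i \<longrightarrow> g' n = Some i' \<longrightarrow> i = i') \<and>
     (\<forall>n' i. g n = Some i \<longrightarrow> g' n' = Some i \<longrightarrow> n = n'))"

lemma coherent_beyondD:
  assumes "coherent_beyond l m F" "g \<in> F" "g' \<in> F" "m \<le> n" "g n = Some i"
  shows "l \<le> i" "g' n = Some i' \<Longrightarrow> i = i'" "g' n' = Some i \<Longrightarrow> n = n'"
  using assms unfolding coherent_beyond_def by blast+

lemma ex_coherent_beyond:
  assumes "finite F" "\<And>g. g \<in> F \<Longrightarrow> trivialises A g"
  shows "\<exists>m. coherent_beyond l m F"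
proof -
  define Q where "Q g g' n \<longleftrightarrow> (\<forall>i. g n = Some i \<longrightarrow> l \<le> i) \<and>
     (\<forall>i i'. g n = Some i \<longrightarrow> g' n = Some i' \<longrightarrow> i = i') \<and>
     (\<forall>n' i. g n = Some i \<longrightarrow> g' n' = Some i \<longrightarrow> n = n')" for g g' :: "nat \<rightharpoonup> nat" and n
  have coh: "coherent_beyond l m F \<longleftrightarrow> (\<forall>g\<in>F. \<forall>g'\<in>F. \<forall>n\<ge>m. Q g g' n)" for m
    unfolding coherent_beyond_def Q_def ..
  have "\<forall>\<^sub>\<infinity>n. Q g g' n" if "g \<in> F" "g' \<in> F" for g g'
    unfolding Q_def
  proof (intro eventually_conj)
    have triv: "trivialises A g" "trivialises A g'" using assms(2) that by simp_all
    then have "finite (g -` Some ` {..<l} \<inter> dom g)"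
      by (intro finite_vimage_IntI) (simp_all add: trivialises_def)
    then show "\<forall>\<^sub>\<infinity>n. \<forall>i. g n = Some i \<longrightarrow> l \<le> i"
      unfolding eventually_cofinite by (rule rev_finite_subset) (auto simp: not_le)
    show "\<forall>\<^sub>\<infinity>n. \<forall>i i'. g n = Some i \<longrightarrow> g' n = Some i' \<longrightarrow> i = i'"
      by (rule trivialises_coherent[OF triv])
    show "\<forall>\<^sub>\<infinity>n. \<forall>n' i. g n = Some i \<longrightarrow> g' n' = Some i \<longrightarrow> n = n'"
      by (rule trivialises_coherent_inverse[OF triv])
  qed
  then have "\<forall>\<^sub>\<infinity>n. \<forall>g\<in>F. \<forall>g'\<in>F. Q g g' n"
    using assms(1) by (simp add: eventually_ball_finite_distrib)
  then obtain m where "\<forall>n\<ge>m. \<forall>g\<in>F. \<forall>g'\<in>F. Q g g' n"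
    unfolding MOST_nat_le ..
  then show ?thesis unfolding coh by (intro exI[of _ m]) simp
qed

text \<open>The generic \<open>c\<close> codes two sets and separates the inputs that two
  trivialisers read at some output \<open>n\<close>. Past a common threshold, however, the bits at
  \<open>n\<close> of the images of the two sets equal the bits of \<open>c\<close> at either
  input.\<close>

lemma conflicting_trivialisers_countable:
  assumes MA_sigma_linked and triv: "\<And>g. g \<in> H \<Longrightarrow> trivialises A g"
    and conf: "\<And>g g'. g \<in> H \<Longrightarrow> g' \<in> H \<Longrightarrow> g \<noteq> g' \<Longrightarrow> \<exists>n i i'. g n = Some i \<and> g' n = Some i' \<and> i \<noteq> i'"
  shows "countable H"
proof (rule ccontr)
  assume H: "uncountable H"
  define wit where "wit g g' s \<longleftrightarrow> (\<exists>n i i'. g n = Some i \<and> g' n = Some i' \<and> i < length s \<and> i' < length s \<and>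
      s ! i \<noteq> s ! i')" for g g' :: "nat \<rightharpoonup> nat" and s :: "(bool \<times> bool) list"
  define data where "data s m g = map g [0..<m]" for s :: "(bool \<times> bool) list" and m and g :: "nat \<rightharpoonup> nat"
  define bnd where "bnd s m F \<longleftrightarrow> coherent_beyond (length s) m F" for s :: "(bool \<times> bool) list" and m F
  have data_eq: "g n = g' n" if "data s m g = data s m g'" "n < m" for s m g g' n
    using arg_cong[OF that(1), of "\<lambda>l. l ! n"] that(2) by (simp add: data_def)
  obtain c H' where H': "H' \<subseteq> H" "uncountable H'"
    "\<And>h h'. h \<in> H' \<Longrightarrow> h' \<in> H' \<Longrightarrow> h \<noteq> h' \<Longrightarrow> \<exists>m. wit h h' (map c [0..<m])"
  proof (rule MA_generic_sequence_pairwise[of H wit bnd data, OF \<open>MA_sigma_linked\<close> H])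
    show "wit h' h s" if "wit h h' s" for h h' s using that unfolding wit_def by metis
    show "wit h h' (s @ t)" if "wit h h' s" for h h' s t
      using that unfolding wit_def by (fastforce simp: nth_append)
    show "\<exists>m. bnd s m F" if "finite F" "F \<subseteq> H" for s F
      unfolding bnd_def by (rule ex_coherent_beyond) (use that triv in auto)
  next
    fix s m F h h' g
    assume *: "bnd s m F" "h \<in> F" "wit h h' s" "data s m h' = data s m g"
    obtain n i i' where n: "h n = Some i" "h' n = Some i'" "i < length s" "i' < length s" "s ! i \<noteq> s ! i'"
      using *(3) unfolding wit_def by blast
    \<comment> \<open>At or past \<open>m\<close> only inputs outside the stem are read, so old
      witnesses lie below \<open>m\<close>, where the data determine the map.\<close>
    have "n < m"
    proof (rule ccontr)
      assume "\<not> n < m"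
      then have "length s \<le> i" using coherent_beyondD(1)[OF *(1)[unfolded bnd_def] *(2,2) _ n(1)] by simp
      then show False using n(3) by simp
    qed
    then have "g n = Some i'" using data_eq[OF *(4)] n(2) by simp
    then show "wit h g s" using n unfolding wit_def by blast
  next
    fix s m xs ys
    assume bx: "bnd s m (set xs)" and by': "bnd s m (set ys)" and sub: "set xs \<subseteq> H" "set ys \<subseteq> H"
      and len: "length xs = length ys"
      and dat: "\<And>i. i < length xs \<Longrightarrow> data s m (xs ! i) = data s m (ys ! i)"
    define J where "J = {j. j < length xs \<and> xs ! j \<noteq> ys ! j}"
    have "\<forall>j\<in>J. \<exists>n p q. (xs ! j) n = Some p \<and> (ys ! j) n = Some q \<and> p \<noteq> q"
    proof
      fix j assume "j \<in> J"
      then have "xs ! j \<in> H" "ys ! j \<in> H" "xs ! j \<noteq> ys ! j" using sub len by (auto simp: J_def)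
      then show "\<exists>n p q. (xs ! j) n = Some p \<and> (ys ! j) n = Some q \<and> p \<noteq> q" by (rule conf)
    qed
    then obtain n p q where npq: "\<And>j. j \<in> J \<Longrightarrow> (xs ! j) (n j) = Some (p j)"
      "\<And>j. j \<in> J \<Longrightarrow> (ys ! j) (n j) = Some (q j)" "\<And>j. j \<in> J \<Longrightarrow> p j \<noteq> q j"
      by metis
    have n_ge: "m \<le> n j" if "j \<in> J" for j
    proof (rule ccontr)
      assume "\<not> m \<le> n j"
      then have "(xs ! j) (n j) = (ys ! j) (n j)" using data_eq[OF dat[of j]] that by (simp add: J_def)
      then show False using npq[OF that] by simp
    qed
    have mem: "xs ! j \<in> set xs" "ys ! j \<in> set ys" if "j \<in> J" for j using that len by (auto simp: J_def)
    note cx = coherent_beyondD[OF bx[unfolded bnd_def]] and cy = coherent_beyondD[OF by'[unfolded bnd_def]]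
    have ge: "length s \<le> p j" "length s \<le> q j" if "j \<in> J" for j
      by (rule cx(1)[OF mem(1,1)[OF that] n_ge[OF that] npq(1)[OF that]])
        (rule cy(1)[OF mem(2,2)[OF that] n_ge[OF that] npq(2)[OF that]])
    \<comment> \<open>In \<open>xs\<close> the input \<open>p j\<close> determines the output
      \<open>n j\<close>, which in \<open>ys\<close> determines \<open>q j\<close>, and likewise
      backwards. So the pairs of inputs to be separated form a partial injection.\<close>
    have n_p: "n j = n j'" if j: "j \<in> J" "j' \<in> J" "p j = p j'" for j j'
      by (rule cx(3)[OF mem(1)[OF j(1)] mem(1)[OF j(2)] n_ge[OF j(1)] npq(1)[OF j(1)]])
        (use npq(1)[OF j(2)] j(3) in simp)
    have n_q: "n j = n j'" if j: "j \<in> J" "j' \<in> J" "q j = q j'" for j j'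
      by (rule cy(3)[OF mem(2)[OF j(1)] mem(2)[OF j(2)] n_ge[OF j(1)] npq(2)[OF j(1)]])
        (use npq(2)[OF j(2)] j(3) in simp)
    have p_n: "p j = p j'" if j: "j \<in> J" "j' \<in> J" "n j = n j'" for j j'
      by (rule cx(2)[OF mem(1)[OF j(1)] mem(1)[OF j(2)] n_ge[OF j(1)] npq(1)[OF j(1)]])
        (use npq(1)[OF j(2)] j(3) in simp)
    have q_n: "q j = q j'" if j: "j \<in> J" "j' \<in> J" "n j = n j'" for j j'
      by (rule cy(2)[OF mem(2)[OF j(1)] mem(2)[OF j(2)] n_ge[OF j(1)] npq(2)[OF j(1)]])
        (use npq(2)[OF j(2)] j(3) in simp)
    have "finite J" by (simp add: J_def)
    have "\<exists>c :: nat \<Rightarrow> bool \<times> bool. \<forall>(x, y)\<in>(\<lambda>j. (p j, q j)) ` J. c x \<noteq> c y"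
    proof (rule partial_injection_4_colourable[of "(\<lambda>j. (p j, q j)) ` J"])
      show "finite ((\<lambda>j. (p j, q j)) ` J)" using \<open>finite J\<close> by simp
      show "x \<noteq> y" if "(x, y) \<in> (\<lambda>j. (p j, q j)) ` J" for x y using that npq(3) by auto
      show "y = y'" if xy: "(x, y) \<in> (\<lambda>j. (p j, q j)) ` J" "(x, y') \<in> (\<lambda>j. (p j, q j)) ` J" for x y y'
      proof -
        obtain j j' where j: "j \<in> J" "j' \<in> J" "x = p j" "y = q j" "x = p j'" "y' = q j'" using xy by auto
        then have "n j = n j'" by (intro n_p) simp_all
        then show ?thesis using q_n[OF j(1,2)] j by simp
      qed
      show "x = x'" if xy: "(x, y) \<in> (\<lambda>j. (p j, q j)) ` J" "(x', y) \<in> (\<lambda>j. (p j, q j)) ` J" for x x' y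
      proof -
        obtain j j' where j: "j \<in> J" "j' \<in> J" "x = p j" "y = q j" "x' = p j'" "y = q j'" using xy by auto
        then have "n j = n j'" by (intro n_q) simp_all
        then show ?thesis using p_n[OF j(1,2)] j by simp
      qed
    qed
    then obtain c :: "nat \<Rightarrow> bool \<times> bool" where c: "\<And>j. j \<in> J \<Longrightarrow> c (p j) \<noteq> c (q j)" by auto
    define L where "L = Suc (\<Sum>j\<in>J. p j + q j)"
    have less: "p j < L" "q j < L" if "j \<in> J" for j
      using member_le_sum[of j J "\<lambda>j. p j + q j"] \<open>finite J\<close> that by (auto simp: L_def)
    define t where "t = map c [length s..<L]"
    have nth: "i < length (s @ t) \<and> (s @ t) ! i = c i" if "length s \<le> i" "i < L" for i
      using that by (simp add: t_def nth_append)
    have "wit (xs ! j) (ys ! j) (s @ t)" if "j \<in> J" for j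
      unfolding wit_def
      using npq(1,2)[OF that] nth[OF ge(1)[OF that] less(1)[OF that]] nth[OF ge(2)[OF that] less(2)[OF that]]
        c[OF that]
      by (intro exI[of _ "n j"] exI[of _ "p j"] exI[of _ "q j"]) auto
    then show "\<exists>t. \<forall>i<length xs. xs ! i \<noteq> ys ! i \<longrightarrow> wit (xs ! i) (ys ! i) (s @ t)"
      by (intro exI[of _ t]) (simp add: J_def)
  next
    fix H' c
    assume "H' \<subseteq> H" "uncountable H'" "\<And>h h'. h \<in> H' \<Longrightarrow> h' \<in> H' \<Longrightarrow> h \<noteq> h' \<Longrightarrow> \<exists>m. wit h h' (map c [0..<m])"
    then show thesis by (rule that)
  qed
  have "\<exists>m. \<forall>n\<ge>m. \<forall>i. g n = Some i \<longrightarrow> (n \<in> A {i. fst (c i)} \<longleftrightarrow> fst (c i)) \<and> (n \<in> A {i. snd (c i)} \<longleftrightarrow> snd (c i))"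
    if "g \<in> H'" for g
  proof -
    have "trivialises A g" using that H'(1) triv by blast
    from trivialises_on_dom[OF this, of "{i. fst (c i)}"] trivialises_on_dom[OF this, of "{i. snd (c i)}"]
    show ?thesis unfolding MOST_nat_le[symmetric] by eventually_elim simp
  qed
  then have "\<forall>g. \<exists>m. g \<in> H' \<longrightarrow> (\<forall>n\<ge>m. \<forall>i. g n = Some i \<longrightarrow>
      (n \<in> A {i. fst (c i)} \<longleftrightarrow> fst (c i)) \<and> (n \<in> A {i. snd (c i)} \<longleftrightarrow> snd (c i)))" by blast
  then obtain m where m: "\<forall>g. g \<in> H' \<longrightarrow> (\<forall>n\<ge>m g. \<forall>i. g n = Some i \<longrightarrow>
      (n \<in> A {i. fst (c i)} \<longleftrightarrow> fst (c i)) \<and> (n \<in> A {i. snd (c i)} \<longleftrightarrow> snd (c i)))"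
    by (rule choice[THEN exE])
  obtain g g' where gg: "g \<in> H'" "g' \<in> H'" "g \<noteq> g'" "(m g, map g [0..<m g]) = (m g', map g' [0..<m g'])"
    by (rule uncountable_pigeonhole[OF H'(2)])
  obtain l where "wit g g' (map c [0..<l])" using H'(3)[OF gg(1,2,3)] by blast
  then obtain n i i' where n: "g n = Some i" "g' n = Some i'" "c i \<noteq> c i'" by (auto simp: wit_def)
  show False
  proof (cases "n < m g")
    case True
    have eq: "m g = m g'" "map g [0..<m g] = map g' [0..<m g']" using gg(4) by blast+
    then have "map g [0..<m g] ! n = map g' [0..<m g'] ! n" by argo
    then have "g n = g' n" using True eq(1) by simp
    then show False using n by simp
  next
    case False
    then have "fst (c i) = fst (c i')" "snd (c i) = snd (c i')"
      using m[rule_format, OF gg(1), of n i] m[rule_format, OF gg(2), of n i'] n(1,2) gg(4) by auto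
    then show False using n(3) by (simp add: prod_eq_iff)
  qed
qed

text \<open>Each piece consists of compatible partial functions with union \<open>f k\<close>. If
  every \<open>f k\<close> failed, a local trivialiser whose range meets the pulled back failure
  sets of all of them would lie in some piece, be part of that \<open>f k\<close>, and contradict
  its failure.\<close>

theorem global_trivialiser:
  assumes OCA MA_sigma_linked
  obtains g where "trivialises A g" "finite (- ran g)" "finite (- dom g)"
proof -
  let ?K = "\<lambda>g g' :: nat \<rightharpoonup> nat. \<exists>n i i'. g n = Some i \<and> g' n = Some i' \<and> i \<noteq> i'"
  obtain X :: "nat \<Rightarrow> (nat \<rightharpoonup> nat) set" where X: "{g. trivialises A g} = (\<Union>k. X k)"
    "\<And>k u v. u \<in> X k \<Longrightarrow> v \<in> X k \<Longrightarrow> u \<noteq> v \<Longrightarrow> \<not> ?K u v"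
  proof (rule OCA_coded[of "\<lambda>g. g" "{g. trivialises A g}" ?K, OF \<open>OCA\<close>])
    show "inj_on (\<lambda>g. g) {g. trivialises A g}" by simp
    show "?K v u" if "?K u v" for u v :: "nat \<rightharpoonup> nat" using that by metis
    show "\<exists>m. \<forall>u'\<in>{g. trivialises A g}. \<forall>v'\<in>{g. trivialises A g}. (\<forall>n<m. u' n = u n) \<longrightarrow>
        (\<forall>n<m. v' n = v n) \<longrightarrow> u' \<noteq> v' \<and> ?K u' v'" if uv: "?K u v" for u v :: "nat \<rightharpoonup> nat"
    proof -
      obtain n i i' where n: "u n = Some i" "v n = Some i'" "i \<noteq> i'" using uv by blast
      have "u' \<noteq> v' \<and> ?K u' v'" if "\<forall>j<Suc n. u' j = u j" "\<forall>j<Suc n. v' j = v j" for u' v' :: "nat \<rightharpoonup> nat"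
      proof -
        have "u' n = Some i" "v' n = Some i'" using that n by simp_all
        then show ?thesis using n(3) by (metis option.inject)
      qed
      then show ?thesis by blast
    qed
  next
    fix H assume "H \<subseteq> {g. trivialises A g}" "uncountable H" "\<And>u v. u \<in> H \<Longrightarrow> v \<in> H \<Longrightarrow> u \<noteq> v \<Longrightarrow> ?K u v"
    then show thesis
      using conflicting_trivialisers_countable[OF \<open>MA_sigma_linked\<close>, of H] by blast
  next
    fix Y :: "nat \<Rightarrow> (nat \<rightharpoonup> nat) set"
    assume "{g. trivialises A g} = (\<Union>n. Y n)" "\<And>n u v. u \<in> Y n \<Longrightarrow> v \<in> Y n \<Longrightarrow> u \<noteq> v \<Longrightarrow> \<not> ?K u v"
    then show thesis by (rule that)
  qed
  define f where "f k n = (if \<exists>g\<in>X k. n \<in> dom g then (SOME g. g \<in> X k \<and> n \<in> dom g) n else None)" for k n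
  have f: "f k n = g n" if g: "g \<in> X k" "n \<in> dom g" for k g n
  proof -
    define g' where "g' = (SOME g. g \<in> X k \<and> n \<in> dom g)"
    have g': "g' \<in> X k \<and> n \<in> dom g'" unfolding g'_def by (rule someI[of _ g]) (use g in blast)
    have "f k n = g' n" unfolding f_def g'_def using g by auto
    also have "g' n = g n"
    proof (rule ccontr)
      assume ne: "g' n \<noteq> g n"
      obtain i i' where "g' n = Some i" "g n = Some i'" using g g' by blast
      then show False using X(2)[of g' k g] g(1) g' ne by (metis option.inject)
    qed
    finally show ?thesis .
  qed
  have "\<exists>k. \<forall>a. \<forall>\<^sub>\<infinity>n. n \<in> A a \<longleftrightarrow> (\<exists>i\<in>a. f k n = Some i)"
  proof (rule ccontr)
    assume "\<not> ?thesis"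
    then have "\<forall>k. \<exists>a. \<not> (\<forall>\<^sub>\<infinity>n. n \<in> A a \<longleftrightarrow> (\<exists>i\<in>a. f k n = Some i))" by blast
    then obtain a where a: "\<forall>k. \<not> (\<forall>\<^sub>\<infinity>n. n \<in> A (a k) \<longleftrightarrow> (\<exists>i\<in>a k. f k n = Some i))"
      by (rule choice[THEN exE])
    define D where "D k = {n. \<not> (n \<in> A (a k) \<longleftrightarrow> (\<exists>i\<in>a k. f k n = Some i))}" for k
    have "infinite (D k)" for k using a by (simp add: D_def eventually_cofinite)
    then have "infinite (A' (D k))" for k by (rule inverse.infinite_image)
    then obtain g where g: "trivialises A g" "\<And>k. infinite (ran g \<inter> A' (D k))"
      by (rule local_trivialiser[of "\<lambda>k. A' (D k)", OF \<open>OCA\<close>]) blast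
    then obtain k where k: "g \<in> X k" using X(1) by blast
    have "\<forall>\<^sub>\<infinity>n. n \<notin> A (ran g \<inter> A' (D k))"
      using A.Int[of "ran g" "A' (D k)"] right[of "D k"] trivialises_dom[OF g(1)] trivialises_on_dom[OF g(1), of "a k"]
    proof eventually_elim
      case (elim n)
      show ?case
      proof
        assume "n \<in> A (ran g \<inter> A' (D k))"
        then have n: "n \<in> D k" "n \<in> dom g" using elim by auto
        then obtain i where "g n = Some i" by blast
        then have "f k n = Some i" "n \<in> A (a k) \<longleftrightarrow> i \<in> a k" using f[OF k n(2)] elim by auto
        moreover from this have "(\<exists>i\<in>a k. f k n = Some i) \<longleftrightarrow> i \<in> a k" by auto
        ultimately show False using n(1) unfolding D_def by blast
      qed
    qed
    then show False
      using infinite_image[OF g(2)[of k]] by (simp add: eventually_cofinite)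
  qed
  then obtain k where k: "\<And>a. \<forall>\<^sub>\<infinity>n. n \<in> A a \<longleftrightarrow> (\<exists>i\<in>a. f k n = Some i)" by blast
  \<comment> \<open>So far \<open>f k\<close> is only a partial function; discarding finitely many
    inputs makes it injective with cofinite range.\<close>
  obtain g where g: "trivialises A g" "ran g \<subseteq> UNIV" "finite (UNIV - ran g)"
  proof (rule trivialiser_of_relation[of "\<lambda>n i. f k n = Some i" UNIV])
    fix i
    have "\<forall>\<^sub>\<infinity>n. f k n \<noteq> Some i"
      using k[of "{i}"] A.image_finite[OF finite.insertI[OF finite.emptyI], of i] by eventually_elim auto
    then show "finite {n. f k n = Some i}" by (simp add: eventually_cofinite)
  qed (use k in auto)
  have "\<forall>\<^sub>\<infinity>n. n \<in> dom g"
  proof -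
    have "\<forall>\<^sub>\<infinity>n. n \<in> ran g \<longleftrightarrow> n \<in> - {}"
      using g(3) by (simp add: eventually_cofinite Compl_eq_Diff_UNIV[symmetric] Compl_eq)
    from A.cong[OF this] A.Compl[of "{}"] A.image_empty trivialises_dom[OF g(1)]
    show ?thesis by eventually_elim auto
  qed
  then have "finite (- dom g)" by (simp add: eventually_cofinite Compl_eq)
  then show thesis using that g by (simp add: Compl_eq_Diff_UNIV)
qed

end

section \<open>Lifts that respect coordinates\<close>

text \<open>Points chosen injectively for pairs of numbers form disjoint infinite subsets of the
  \<open>G k\<close>, on each of which \<open>a\<close> can copy its own sequence.\<close>

lemma splice:
  fixes G :: "nat \<Rightarrow> nat set" and f :: "nat \<Rightarrow> nat \<Rightarrow> 'v"
  assumes "\<And>k. infinite (G k)"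
  shows "\<exists>a G'. \<forall>k. infinite (G' k) \<and> G' k \<subseteq> G k \<and> (\<forall>n\<in>G' k. a n = f k n)"
proof -
  obtain pt :: "nat \<times> nat \<Rightarrow> nat" where inj: "inj pt" and pt: "\<And>p. pt p \<in> G (fst p)"
    by (rule injective_choice[of "\<lambda>p :: nat \<times> nat. G (fst p)"]) (use assms in auto)
  define a where "a n = f (fst (inv pt n)) n" for n
  have "infinite (range (\<lambda>i. pt (k, i)))" for k
    using inj by (intro range_inj_infinite) (auto intro!: injI dest: injD)
  moreover have "range (\<lambda>i. pt (k, i)) \<subseteq> G k" for k
    using pt[of "(k, i)" for i] by auto
  moreover have "\<forall>n\<in>range (\<lambda>i. pt (k, i)). a n = f k n" for k
    using inj by (auto simp: a_def)
  ultimately show ?thesis by (intro exI[of _ a] exI[of _ "\<lambda>k. range (\<lambda>i. pt (k, i))"]) blast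
qed

text \<open>The metric problem once the automorphism is straightened: \<open>S\<close> is the same
  on both sides, and points are replaced by numbers naming them. As different numbers may name one
  point, \<open>\<delta> n\<close> is only a pseudometric.\<close>

locale coordinate_lift =
  fixes \<delta> :: "nat \<Rightarrow> nat \<Rightarrow> nat \<Rightarrow> real" and \<Phi> :: "(nat \<Rightarrow> nat) \<Rightarrow> nat \<Rightarrow> nat"
  assumes refl [simp]: "\<delta> n i i = 0"
    and sym: "\<delta> n i j = \<delta> n j i"
    and triangle: "\<delta> n i k \<le> \<delta> n i j + \<delta> n j k"
    and respects: "(\<And>n. n \<in> S \<Longrightarrow> a n = b n) \<Longrightarrow> 0 < \<epsilon> \<Longrightarrow>
      \<forall>\<^sub>\<infinity>n. n \<in> S \<longrightarrow> \<delta> n (\<Phi> a n) (\<Phi> b n) < \<epsilon>"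
begin

definition lifts_on :: "real \<Rightarrow> nat set \<Rightarrow> (nat \<Rightarrow> nat \<Rightarrow> nat) \<Rightarrow> bool" where
  "lifts_on \<epsilon> S h \<longleftrightarrow> (\<forall>a. \<forall>\<^sub>\<infinity>n. n \<in> S \<longrightarrow> \<delta> n (\<Phi> a n) (h n (a n)) \<le> \<epsilon>)"

lemma lifts_onD: "lifts_on \<epsilon> S h \<Longrightarrow> \<forall>\<^sub>\<infinity>n. n \<in> S \<longrightarrow> \<delta> n (\<Phi> a n) (h n (a n)) \<le> \<epsilon>"
  by (simp add: lifts_on_def)

text \<open>The spliced \<open>a\<close> copies the \<open>k\<close>-th counterexample on an
  infinite part of \<open>D k\<close>, where \<open>\<Phi> a\<close> is eventually close to
  \<open>\<Phi> (f k)\<close>. The gap between \<open>\<epsilon>\<close> and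
  \<open>\<epsilon>'\<close> absorbs the difference.\<close>

lemma diagonal:
  fixes D :: "nat \<Rightarrow> nat set"
  assumes "\<epsilon> < \<epsilon>'" and inf: "\<And>k. infinite (S \<inter> D k)"
    and bad: "\<And>k n. n \<in> D k \<Longrightarrow> \<epsilon>' < \<delta> n (\<Phi> (f k) n) (h k n (f k n))"
  shows "\<exists>a. \<forall>k. \<not> (\<forall>\<^sub>\<infinity>n. n \<in> S \<longrightarrow> \<delta> n (\<Phi> a n) (h k n (a n)) \<le> \<epsilon>)"
proof -
  obtain a G where G: "\<And>k. infinite (G k)" "\<And>k. G k \<subseteq> S \<inter> D k" "\<And>k n. n \<in> G k \<Longrightarrow> a n = f k n"
    using splice[of "\<lambda>k. S \<inter> D k" f, OF inf] by blast
  have "\<not> (\<forall>\<^sub>\<infinity>n. n \<in> S \<longrightarrow> \<delta> n (\<Phi> a n) (h k n (a n)) \<le> \<epsilon>)" for k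
  proof
    assume "\<forall>\<^sub>\<infinity>n. n \<in> S \<longrightarrow> \<delta> n (\<Phi> a n) (h k n (a n)) \<le> \<epsilon>"
    moreover have "\<forall>\<^sub>\<infinity>n. n \<in> G k \<longrightarrow> \<delta> n (\<Phi> a n) (\<Phi> (f k) n) < \<epsilon>' - \<epsilon>"
      by (rule respects) (use G(3) \<open>\<epsilon> < \<epsilon>'\<close> in auto)
    ultimately have "\<forall>\<^sub>\<infinity>n. n \<notin> G k"
    proof eventually_elim
      case (elim n)
      show ?case
      proof
        assume n: "n \<in> G k"
        then have "n \<in> S" "n \<in> D k" using G(2) by auto
        then show False
          using elim n bad[of n k] G(3)[OF n] triangle[of n "\<Phi> (f k) n" "h k n (f k n)" "\<Phi> a n"]
            sym[of n "\<Phi> (f k) n" "\<Phi> a n"] by auto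
      qed
    qed
    then show False using G(1)[of k] by (simp add: eventually_cofinite)
  qed
  then show ?thesis by blast
qed

text \<open>Both lifts are tested on one sequence that takes, wherever possible, a value at which
  they are too far apart; this gives uniformity in \<open>v\<close>.\<close>

lemma lifts_coherent:
  assumes "lifts_on \<epsilon> S h" "lifts_on \<epsilon>' S' h'"
  shows "\<forall>\<^sub>\<infinity>n. n \<in> S \<inter> S' \<longrightarrow> (\<forall>v. \<delta> n (h n v) (h' n v) \<le> \<epsilon> + \<epsilon>')"
proof -
  define a where "a n = (SOME v. \<epsilon> + \<epsilon>' < \<delta> n (h n v) (h' n v))" for n
  have a: "\<delta> n (h n v) (h' n v) \<le> \<epsilon> + \<epsilon>'" if "\<delta> n (h n (a n)) (h' n (a n)) \<le> \<epsilon> + \<epsilon>'" for n v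
  proof (rule ccontr)
    assume "\<not> ?thesis"
    then have "\<epsilon> + \<epsilon>' < \<delta> n (h n v) (h' n v)" by simp
    then have "\<epsilon> + \<epsilon>' < \<delta> n (h n (a n)) (h' n (a n))"
      unfolding a_def by (rule someI)
    then show False using that by simp
  qed
  show ?thesis
    using lifts_onD[OF assms(1), of a] lifts_onD[OF assms(2), of a]
  proof eventually_elim
    case (elim n)
    show ?case
    proof (intro impI allI, rule a)
      assume "n \<in> S \<inter> S'"
      then show "\<delta> n (h n (a n)) (h' n (a n)) \<le> \<epsilon> + \<epsilon>'"
        using elim triangle[of n "h n (a n)" "h' n (a n)" "\<Phi> a n"] sym[of n "h n (a n)" "\<Phi> a n"] by auto
    qed
  qed
qed

text \<open>The generic \<open>c\<close> takes the common value of two members at one of their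
  conflict points. Past a threshold \<open>\<Phi> c\<close> is there within
  \<open>\<eta> / 2\<close> of both images, against their distance above
  \<open>\<eta>\<close>.\<close>

lemma conflicting_branches_countable:
  assumes MA_sigma_linked and tree: "tree_like T" and \<eta>: "0 < \<eta>"
    and conf: "\<And>p q. p \<in> H \<Longrightarrow> q \<in> H \<Longrightarrow> p \<noteq> q \<Longrightarrow> fst p \<noteq> fst q \<and>
      (\<exists>n\<in>T (fst p) \<inter> T (fst q). snd p n = snd q n \<and> \<eta> < \<delta> n (\<Phi> (snd p) n) (\<Phi> (snd q) n))"
  shows "countable H"
proof (rule ccontr)
  assume H: "uncountable H"
  define wit where "wit p q s \<longleftrightarrow> (\<exists>n<length s. n \<in> T (fst p) \<inter> T (fst q) \<and> snd p n = s ! n \<and> snd q n = s ! n \<and>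
    \<eta> < \<delta> n (\<Phi> (snd p) n) (\<Phi> (snd q) n))" for p q :: "(nat \<Rightarrow> bool) \<times> (nat \<Rightarrow> nat)" and s :: "nat list"
  \<comment> \<open>The first branch stays fixed because only the second member of an old pair is
    replaced, by one whose branch agrees with it below \<open>m\<close>.\<close>
  define sep where "sep m x y \<longleftrightarrow> T x \<inter> T y \<subseteq> {..<m} \<and>
    (\<forall>y'. (\<forall>i<m. y' i = y i) \<longrightarrow> T x \<inter> T y' = T x \<inter> T y)" for m :: nat and x y
  define bnd where "bnd s m F \<longleftrightarrow> length s \<le> m \<and> (\<forall>p\<in>F. \<forall>q\<in>F. fst p \<noteq> fst q \<longrightarrow> sep m (fst p) (fst q))"
    for s :: "nat list" and m and F :: "((nat \<Rightarrow> bool) \<times> (nat \<Rightarrow> nat)) set"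
  define data where "data s m p = map (\<lambda>n. (fst p n, snd p n, \<Phi> (snd p) n)) [0..<m]"
    for s :: "nat list" and m and p :: "(nat \<Rightarrow> bool) \<times> (nat \<Rightarrow> nat)"
  have data_eq: "fst p n = fst q n" "snd p n = snd q n" "\<Phi> (snd p) n = \<Phi> (snd q) n"
    if "data s m p = data s m q" "n < m" for s m p q n
    using arg_cong[OF that(1), of "\<lambda>l. l ! n"] that(2) by (simp_all add: data_def)
  obtain c H' where H': "H' \<subseteq> H" "uncountable H'"
    "\<And>h h'. h \<in> H' \<Longrightarrow> h' \<in> H' \<Longrightarrow> h \<noteq> h' \<Longrightarrow> \<exists>m. wit h h' (map c [0..<m])"
  proof (rule MA_generic_sequence_pairwise[of H wit bnd data, OF \<open>MA_sigma_linked\<close> H])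
    show "wit q p s" if "wit p q s" for p q s
      using that unfolding wit_def by (metis Int_commute sym)
    show "wit p q (s @ t)" if "wit p q s" for p q s t
      using that unfolding wit_def by (fastforce simp: nth_append)
    show "\<exists>m. bnd s m F" if "finite F" "F \<subseteq> H" for s F
    proof -
      have "\<forall>\<^sub>\<infinity>m. x \<noteq> y \<longrightarrow> sep m x y" for x y
      proof (cases "x = y")
        case False
        then obtain m where m: "T x \<inter> T y \<subseteq> {..<m}"
          "\<And>x' y'. \<forall>i<m. x' i = x i \<Longrightarrow> \<forall>i<m. y' i = y i \<Longrightarrow> T x' \<inter> T y' = T x \<inter> T y"
          using tree[unfolded tree_like_def, rule_format, OF False] by blast
        have "sep l x y" if "m \<le> l" for l
          unfolding sep_def
        proof (intro conjI allI impI)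
          show "T x \<inter> T y \<subseteq> {..<l}" using m(1) that by auto
          show "T x \<inter> T y' = T x \<inter> T y" if "\<forall>i<l. y' i = y i" for y'
            by (rule m(2)) (use that \<open>m \<le> l\<close> in auto)
        qed
        then show ?thesis unfolding MOST_nat_le by blast
      qed simp
      then have "\<forall>\<^sub>\<infinity>m. \<forall>p\<in>F. \<forall>q\<in>F. fst p \<noteq> fst q \<longrightarrow> sep m (fst p) (fst q)"
        using that(1) by (simp add: eventually_ball_finite_distrib)
      moreover have "\<forall>\<^sub>\<infinity>m. length s \<le> m" unfolding MOST_nat_le by blast
      ultimately have "\<forall>\<^sub>\<infinity>m. bnd s m F" unfolding bnd_def by (rule eventually_conj[rotated])
      then show ?thesis unfolding MOST_nat_le by blast
    qed
  next
    fix s m F p q g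
    assume *: "bnd s m F" "F \<subseteq> H" "p \<in> F" "q \<in> F" "p \<noteq> q" "wit p q s" "data s m q = data s m g"
    obtain n where n: "n < length s" "n \<in> T (fst p) \<inter> T (fst q)" "snd p n = s ! n" "snd q n = s ! n"
      "\<eta> < \<delta> n (\<Phi> (snd p) n) (\<Phi> (snd q) n)"
      using *(6) unfolding wit_def by blast
    have nm: "n < m" using n(1) *(1)[unfolded bnd_def, THEN conjunct1] by simp
    have "fst p \<noteq> fst q" by (rule conf[OF subsetD[OF *(2,3)] subsetD[OF *(2,4)] *(5), THEN conjunct1])
    then have "sep m (fst p) (fst q)" using *(1)[unfolded bnd_def] *(3,4) by blast
    then have "T (fst p) \<inter> T (fst g) = T (fst p) \<inter> T (fst q)"
      unfolding sep_def by (elim conjE allE[of _ "fst g"] impE) (simp_all add: data_eq(1)[OF *(7)])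
    then show "wit p g s"
      using n data_eq(2,3)[OF *(7) nm] unfolding wit_def by (intro exI[of _ n]) simp
  next
    fix s m xs ys
    assume bx: "bnd s m (set xs)" and by': "bnd s m (set ys)" and sub: "set xs \<subseteq> H" "set ys \<subseteq> H"
      and dist: "distinct xs" and len: "length xs = length ys"
      and dat: "\<And>i. i < length xs \<Longrightarrow> data s m (xs ! i) = data s m (ys ! i)"
    define J where "J = {j. j < length xs \<and> xs ! j \<noteq> ys ! j}"
    have "\<forall>j\<in>J. \<exists>n. n \<in> T (fst (xs ! j)) \<inter> T (fst (ys ! j)) \<and> snd (xs ! j) n = snd (ys ! j) n \<and>
        \<eta> < \<delta> n (\<Phi> (snd (xs ! j)) n) (\<Phi> (snd (ys ! j)) n)"
    proof
      fix j assume "j \<in> J"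
      then have "xs ! j \<in> H" "ys ! j \<in> H" "xs ! j \<noteq> ys ! j" using sub len by (auto simp: J_def)
      from conf[OF this, THEN conjunct2] show "\<exists>n. n \<in> T (fst (xs ! j)) \<inter> T (fst (ys ! j)) \<and>
        snd (xs ! j) n = snd (ys ! j) n \<and> \<eta> < \<delta> n (\<Phi> (snd (xs ! j)) n) (\<Phi> (snd (ys ! j)) n)" by blast
    qed
    then obtain n where n: "\<And>j. j \<in> J \<Longrightarrow> n j \<in> T (fst (xs ! j)) \<inter> T (fst (ys ! j))"
      "\<And>j. j \<in> J \<Longrightarrow> snd (xs ! j) (n j) = snd (ys ! j) (n j)"
      "\<And>j. j \<in> J \<Longrightarrow> \<eta> < \<delta> (n j) (\<Phi> (snd (xs ! j)) (n j)) (\<Phi> (snd (ys ! j)) (n j))"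
      by metis
    have n_ge: "m \<le> n j" if "j \<in> J" for j
    proof (rule ccontr)
      assume "\<not> m \<le> n j"
      then have "\<Phi> (snd (xs ! j)) (n j) = \<Phi> (snd (ys ! j)) (n j)"
        using data_eq(3)[OF dat[of j]] that by (simp add: J_def)
      then show False using n(3)[OF that] \<eta> by simp
    qed
    \<comment> \<open>Conflict points lie past \<open>m\<close> on the branches of their pair, while
      distinct branches within one condition meet only below \<open>m\<close>. Hence the points are
      distinct, and \<open>c\<close> can take the value prescribed at each.\<close>
    have n_inj: "j = j'" if j: "j \<in> J" "j' \<in> J" "n j = n j'" for j j'
    proof (rule ccontr)
      assume "j \<noteq> j'"
      then have mem: "xs ! j \<in> set xs" "xs ! j' \<in> set xs" "xs ! j \<noteq> xs ! j'"
        using j(1,2) dist by (auto simp: J_def nth_eq_iff_index_eq)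
      then have "fst (xs ! j) \<noteq> fst (xs ! j')" 
        by (intro conf[OF subsetD[OF sub(1)] subsetD[OF sub(1)], THEN conjunct1])
      then have "sep m (fst (xs ! j)) (fst (xs ! j'))"
        using bx[unfolded bnd_def] mem(1,2) by blast
      then have "T (fst (xs ! j)) \<inter> T (fst (xs ! j')) \<subseteq> {..<m}" by (simp only: sep_def)
      moreover have "n j \<in> T (fst (xs ! j)) \<inter> T (fst (xs ! j'))"
        using n(1)[OF j(1)] n(1)[OF j(2)] j(3) by simp
      ultimately have "n j < m" by blast
      then show False using n_ge[OF j(1)] by simp
    qed
    define c where "c i = snd (xs ! (inv_into J n i)) i" for i
    have c: "c (n j) = snd (xs ! j) (n j)" if "j \<in> J" for j
      using n_inj that by (simp add: c_def inv_into_f_f inj_on_def)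
    define L where "L = Suc (\<Sum>j\<in>J. n j)"
    have less: "n j < L" if "j \<in> J" for j
      using member_le_sum[of j J n] that by (simp add: L_def J_def)
    define t where "t = map c [length s..<L]"
    have "wit (xs ! j) (ys ! j) (s @ t)" if "j \<in> J" for j
    proof -
      have "length s \<le> n j" using n_ge[OF that] bx[unfolded bnd_def, THEN conjunct1] by simp
      then have "n j < length (s @ t)" "(s @ t) ! n j = c (n j)"
        using less[OF that] by (simp_all add: t_def nth_append)
      then show ?thesis
        unfolding wit_def using n[OF that] c[OF that] by (intro exI[of _ "n j"]) simp
    qed
    then show "\<exists>t. \<forall>i<length xs. xs ! i \<noteq> ys ! i \<longrightarrow> wit (xs ! i) (ys ! i) (s @ t)"
      by (intro exI[of _ t]) (simp add: J_def)
  next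
    fix H' c
    assume "H' \<subseteq> H" "uncountable H'" "\<And>h h'. h \<in> H' \<Longrightarrow> h' \<in> H' \<Longrightarrow> h \<noteq> h' \<Longrightarrow> \<exists>m. wit h h' (map c [0..<m])"
    then show thesis by (rule that)
  qed
  have "\<exists>m. \<forall>n\<ge>m. snd p n = c n \<longrightarrow> \<delta> n (\<Phi> (snd p) n) (\<Phi> c n) < \<eta> / 2" for p :: "(nat \<Rightarrow> bool) \<times> (nat \<Rightarrow> nat)"
    using respects[of "{n. snd p n = c n}" "snd p" c "\<eta> / 2"] \<eta> unfolding MOST_nat_le by simp
  then have "\<forall>p. \<exists>m. \<forall>n\<ge>m. snd p n = c n \<longrightarrow> \<delta> n (\<Phi> (snd (p :: (nat \<Rightarrow> bool) \<times> (nat \<Rightarrow> nat))) n) (\<Phi> c n) < \<eta> / 2"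
    by blast
  then obtain m where m: "\<forall>p. \<forall>n\<ge>m p. snd p n = c n \<longrightarrow>
      \<delta> n (\<Phi> (snd (p :: (nat \<Rightarrow> bool) \<times> (nat \<Rightarrow> nat))) n) (\<Phi> c n) < \<eta> / 2"
    by (rule choice[THEN exE])
  obtain p q where pq: "p \<in> H'" "q \<in> H'" "p \<noteq> q"
    "(m p, map (\<Phi> (snd p)) [0..<m p]) = (m q, map (\<Phi> (snd q)) [0..<m q])"
    by (rule uncountable_pigeonhole[OF H'(2)])
  obtain l where "wit p q (map c [0..<l])" using H'(3)[OF pq(1,2,3)] by blast
  then obtain n where n: "snd p n = c n" "snd q n = c n" "\<eta> < \<delta> n (\<Phi> (snd p) n) (\<Phi> (snd q) n)"
    by (auto simp: wit_def)
  have eq: "m p = m q" "map (\<Phi> (snd p)) [0..<m p] = map (\<Phi> (snd q)) [0..<m q]" using pq(4) by blast+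
  show False
  proof (cases "n < m p")
    case True
    from eq(2) have "map (\<Phi> (snd p)) [0..<m p] ! n = map (\<Phi> (snd q)) [0..<m q] ! n" by argo
    then have "\<Phi> (snd p) n = \<Phi> (snd q) n" using True eq(1) by simp
    then show False using n(3) \<eta> by simp
  next
    case False
    then have "\<delta> n (\<Phi> (snd p) n) (\<Phi> c n) < \<eta> / 2" "\<delta> n (\<Phi> (snd q) n) (\<Phi> c n) < \<eta> / 2"
      using m[rule_format, of p n] m[rule_format, of q n] n(1,2) eq(1) by simp_all
    then show False
      using n(3) triangle[of n "\<Phi> (snd p) n" "\<Phi> (snd q) n" "\<Phi> c n"] sym[of n "\<Phi> c n" "\<Phi> (snd q) n"] by simp
  qed
qed

end

section \<open>Approximate lifts and their gluing\<close>

context coordinate_lift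
begin

text \<open>Within a piece, \<open>a n\<close> determines \<open>\<Phi> a n\<close> up to
  \<open>\<eta>\<close> as soon as another branch through \<open>n\<close> carries a sequence of the
  piece with the same value at \<open>n\<close>. A triple of piece, coordinate and value can lack
  this for one branch only, so all but countably many branches are served.\<close>

lemma local_lift:
  fixes D :: "nat \<Rightarrow> nat set"
  assumes OCA MA_sigma_linked "0 < \<epsilon>" and D: "\<And>k. infinite (D k)"
  shows "\<exists>S h. (\<forall>k. infinite (S \<inter> D k)) \<and> lifts_on \<epsilon> S h"
proof -
  obtain T where T: "tree_like T" and T_inf: "\<And>x k. infinite (T x \<inter> D k)"
    using tree_like_family[of D, OF D] by blast
  \<comment> \<open>The pieces use half of the tolerance; the other half is the gap for
    \<open>diagonal\<close>.\<close>
  define \<eta> where "\<eta> = \<epsilon> / 2"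
  have \<eta>: "0 < \<eta>" "\<eta> < \<epsilon>" using \<open>0 < \<epsilon>\<close> by (simp_all add: \<eta>_def)
  define K where "K p q \<longleftrightarrow> fst p \<noteq> fst q \<and>
      (\<exists>n\<in>T (fst p) \<inter> T (fst q). snd p n = snd q n \<and> \<eta> < \<delta> n (\<Phi> (snd p) n) (\<Phi> (snd q) n))"
    for p q :: "(nat \<Rightarrow> bool) \<times> (nat \<Rightarrow> nat)"
  define e where "e p n = (fst p n, snd p n, \<Phi> (snd p) n)" for p :: "(nat \<Rightarrow> bool) \<times> (nat \<Rightarrow> nat)" and n
  have inj: "inj_on e UNIV"
  proof (rule injI)
    fix p q assume "e p = e q"
    then have "e p n = e q n" for n by simp
    then have "fst p n = fst q n \<and> snd p n = snd q n" for n by (simp add: e_def)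
    then show "p = q" by (intro prod_eqI ext) simp_all
  qed
  have K_sym: "K q p" if "K p q" for p q
  proof -
    have "T (fst q) \<inter> T (fst p) = T (fst p) \<inter> T (fst q)" by blast
    then show ?thesis using that sym unfolding K_def by metis
  qed
  have K_loc: "\<exists>m. \<forall>p'\<in>UNIV. \<forall>q'\<in>UNIV. (\<forall>n<m. e p' n = e p n) \<longrightarrow> (\<forall>n<m. e q' n = e q n) \<longrightarrow>
      p' \<noteq> q' \<and> K p' q'" if pq: "K p q" for p q
  proof -
    have ne: "fst p \<noteq> fst q" using pq by (simp add: K_def)
    obtain n where n: "n \<in> T (fst p) \<inter> T (fst q)" "snd p n = snd q n"
      "\<eta> < \<delta> n (\<Phi> (snd p) n) (\<Phi> (snd q) n)"
      using pq unfolding K_def by blast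
    obtain d where d: "fst p d \<noteq> fst q d" using ne by auto
    obtain m where m: "\<And>x' y'. \<forall>i<m. x' i = fst p i \<Longrightarrow> \<forall>i<m. y' i = fst q i \<Longrightarrow>
        T x' \<inter> T y' = T (fst p) \<inter> T (fst q)"
      using T[unfolded tree_like_def, rule_format, OF ne] by blast
    define l where "l = max m (max (Suc n) (Suc d))"
    have l: "m \<le> l" "n < l" "d < l" by (auto simp: l_def)
    have "p' \<noteq> q' \<and> K p' q'" if ag: "\<forall>n<l. e p' n = e p n" "\<forall>n<l. e q' n = e q n" for p' q'
    proof -
      have p': "fst p' i = fst p i" "snd p' i = snd p i" "\<Phi> (snd p') i = \<Phi> (snd p) i" if "i < l" for i
        using ag(1)[rule_format, OF that] by (simp_all add: e_def)
      have q': "fst q' i = fst q i" "snd q' i = snd q i" "\<Phi> (snd q') i = \<Phi> (snd q) i" if "i < l" for i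
        using ag(2)[rule_format, OF that] by (simp_all add: e_def)
      have "fst p' \<noteq> fst q'" using d p'(1)[OF l(3)] q'(1)[OF l(3)] by auto
      moreover have "T (fst p') \<inter> T (fst q') = T (fst p) \<inter> T (fst q)"
        by (rule m) (use p'(1) q'(1) l(1) in auto)
      ultimately show ?thesis
        unfolding K_def using n p'(2,3)[OF l(2)] q'(2,3)[OF l(2)] by (auto intro!: bexI[of _ n])
    qed
    then show ?thesis by (intro exI[of _ l]) blast
  qed
  obtain X :: "nat \<Rightarrow> ((nat \<Rightarrow> bool) \<times> (nat \<Rightarrow> nat)) set" where X: "UNIV = (\<Union>k. X k)"
    "\<And>k p q. p \<in> X k \<Longrightarrow> q \<in> X k \<Longrightarrow> p \<noteq> q \<Longrightarrow> \<not> K p q"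
  proof (rule OCA_coded[of e UNIV K, OF \<open>OCA\<close> inj K_sym K_loc])
    fix H assume "uncountable H" "\<And>p q. p \<in> H \<Longrightarrow> q \<in> H \<Longrightarrow> p \<noteq> q \<Longrightarrow> K p q"
    then show thesis
      using conflicting_branches_countable[OF \<open>MA_sigma_linked\<close> T \<eta>(1), of H] unfolding K_def by blast
  next
    fix Y :: "nat \<Rightarrow> ((nat \<Rightarrow> bool) \<times> (nat \<Rightarrow> nat)) set"
    assume "UNIV = (\<Union>k. Y k)" "\<And>k p q. p \<in> Y k \<Longrightarrow> q \<in> Y k \<Longrightarrow> p \<noteq> q \<Longrightarrow> \<not> K p q"
    then show thesis by (rule that)
  qed
  have "\<exists>x. \<forall>k n v. n \<in> T x \<longrightarrow> (\<exists>a. (x, a) \<in> X k \<and> a n = v) \<longrightarrow>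
      (\<exists>y b. (y, b) \<in> X k \<and> y \<noteq> x \<and> n \<in> T y \<and> b n = v)"
  proof (rule ccontr)
    assume "\<not> ?thesis"
    then have "\<forall>x. \<exists>p. fst (snd p) \<in> T x \<and> (\<exists>a. (x, a) \<in> X (fst p) \<and> a (fst (snd p)) = snd (snd p)) \<and>
      \<not> (\<exists>y b. (y, b) \<in> X (fst p) \<and> y \<noteq> x \<and> fst (snd p) \<in> T y \<and> b (fst (snd p)) = snd (snd p))"
      by simp
    then obtain p where p: "\<forall>x. fst (snd (p x)) \<in> T x \<and>
      (\<exists>a. (x, a) \<in> X (fst (p x)) \<and> a (fst (snd (p x))) = snd (snd (p x))) \<and>
      \<not> (\<exists>y b. (y, b) \<in> X (fst (p x)) \<and> y \<noteq> x \<and> fst (snd (p x)) \<in> T y \<and> b (fst (snd (p x))) = snd (snd (p x)))"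
      by (rule choice[THEN exE])
    obtain x y where xy: "x \<noteq> y" "p x = p y"
      by (rule uncountable_pigeonhole[OF uncountable_Cantor_space, of p])
    obtain b where "(y, b) \<in> X (fst (p y))" "b (fst (snd (p y))) = snd (snd (p y))" "fst (snd (p y)) \<in> T y"
      using p[rule_format, of y] by blast
    then show False using p[rule_format, of x] xy by metis
  qed
  then obtain x where x: "\<And>k n v a. n \<in> T x \<Longrightarrow> (x, a) \<in> X k \<Longrightarrow> a n = v \<Longrightarrow>
      \<exists>y b. (y, b) \<in> X k \<and> y \<noteq> x \<and> n \<in> T y \<and> b n = v" by blast
  \<comment> \<open>The partner must lie on another branch, since sequences on the same branch never
    conflict in the sense of \<open>K\<close>.\<close>
  define h where "h k n v = \<Phi> (snd (SOME q. q \<in> X k \<and> fst q \<noteq> x \<and> n \<in> T (fst q) \<and> snd q n = v)) n" for k n v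
  have h: "\<delta> n (\<Phi> a n) (h k n (a n)) \<le> \<eta>" if a: "(x, a) \<in> X k" "n \<in> T x" for k n a
  proof -
    define q where "q = (SOME q. q \<in> X k \<and> fst q \<noteq> x \<and> n \<in> T (fst q) \<and> snd q n = a n)"
    have "\<exists>q. q \<in> X k \<and> fst q \<noteq> x \<and> n \<in> T (fst q) \<and> snd q n = a n"
      using x[OF a(2,1) HOL.refl] by auto
    then have q: "q \<in> X k \<and> fst q \<noteq> x \<and> n \<in> T (fst q) \<and> snd q n = a n"
      unfolding q_def by (rule someI_ex)
    then have "(x, a) \<noteq> q" by auto
    then have "\<not> K (x, a) q" using X(2)[OF a(1)] q by blast
    then have "\<delta> n (\<Phi> a n) (\<Phi> (snd q) n) \<le> \<eta>" using q a(2) unfolding K_def by (auto simp: not_less)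
    then show ?thesis by (simp add: h_def q_def)
  qed
  have "\<exists>k. lifts_on \<epsilon> (T x) (h k)"
  proof (rule ccontr)
    assume "\<not> ?thesis"
    then have "\<forall>k. \<exists>a. \<not> (\<forall>\<^sub>\<infinity>n. n \<in> T x \<longrightarrow> \<delta> n (\<Phi> a n) (h k n (a n)) \<le> \<epsilon>)"
      unfolding lifts_on_def by blast
    then obtain f where f: "\<forall>k. \<not> (\<forall>\<^sub>\<infinity>n. n \<in> T x \<longrightarrow> \<delta> n (\<Phi> (f k) n) (h k n (f k n)) \<le> \<epsilon>)"
      by (rule choice[THEN exE])
    define B where "B k = {n. \<epsilon> < \<delta> n (\<Phi> (f k) n) (h k n (f k n))}" for k
    have B_inf: "infinite (T x \<inter> B k)" for k
      using f[rule_format, of k] by (simp add: B_def eventually_cofinite not_le Int_def)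
    have "\<exists>a. \<forall>k. \<not> (\<forall>\<^sub>\<infinity>n. n \<in> T x \<longrightarrow> \<delta> n (\<Phi> a n) (h k n (a n)) \<le> \<eta>)"
      by (rule diagonal[where D = B and f = f, OF \<eta>(2) B_inf]) (simp add: B_def)
    then obtain a where a: "\<And>k. \<not> (\<forall>\<^sub>\<infinity>n. n \<in> T x \<longrightarrow> \<delta> n (\<Phi> a n) (h k n (a n)) \<le> \<eta>)"
      by blast
    obtain k where "(x, a) \<in> X k" using X(1) by blast
    then show False using a[of k] h by simp
  qed
  then show ?thesis using T_inf by blast
qed

text \<open>Two lifts within \<open>\<epsilon>\<close> of \<open>\<Phi> c\<close> cannot be more
  than \<open>2 * \<epsilon>\<close> apart at \<open>c n\<close>, so such a gap is the witness.
  Several pairs may share a conflict point, where \<open>c\<close> has only one value; the gap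
  \<open>6 * \<epsilon>\<close> of one pair then passes to the others through coherence, which costs
  \<open>2 * \<epsilon>\<close> on each side.\<close>

lemma conflicting_lifts_countable:
  fixes hs :: "nat set \<Rightarrow> nat \<Rightarrow> nat \<Rightarrow> nat"
  assumes MA_sigma_linked and \<epsilon>: "0 < \<epsilon>"
    and lift: "\<And>p. p \<in> H \<Longrightarrow> lifts_on \<epsilon> (fst p) (hs (fst p))"
    and conf: "\<And>p q. p \<in> H \<Longrightarrow> q \<in> H \<Longrightarrow> p \<noteq> q \<Longrightarrow> \<exists>n\<in>fst p \<inter> fst q. snd p n = snd q n \<and>
      6 * \<epsilon> < \<delta> n (hs (fst p) n (snd p n)) (hs (fst q) n (snd q n))"
  shows "countable H"
proof (rule ccontr)
  assume H: "uncountable H"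
  define wit where "wit p q s \<longleftrightarrow> (\<exists>n<length s. n \<in> fst p \<and> n \<in> fst q \<and>
    2 * \<epsilon> < \<delta> n (hs (fst p) n (s ! n)) (hs (fst q) n (s ! n)))"
    for p q :: "nat set \<times> (nat \<Rightarrow> nat)" and s :: "nat list"
  define close where "close m p q \<longleftrightarrow> (\<forall>n\<ge>m. n \<in> fst p \<inter> fst q \<longrightarrow>
    (\<forall>v. \<delta> n (hs (fst p) n v) (hs (fst q) n v) \<le> 2 * \<epsilon>))" for m :: nat and p q :: "nat set \<times> (nat \<Rightarrow> nat)"
  define bnd where "bnd s m F \<longleftrightarrow> length s \<le> m \<and> (\<forall>p\<in>F. \<forall>q\<in>F. close m p q)"
    for s :: "nat list" and m and F :: "(nat set \<times> (nat \<Rightarrow> nat)) set"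
  \<comment> \<open>Old witnesses are evaluated at stem values and conflicts at the member's own
    value, so the lift is recorded at both; \<open>0\<close> is a filler beyond the stem.\<close>
  define d where "d s p n = (n \<in> fst p, hs (fst p) n (snd p n), hs (fst p) n (if n < length s then s ! n else 0))"
    for s :: "nat list" and p :: "nat set \<times> (nat \<Rightarrow> nat)" and n
  define data where "data s m p = map (d s p) [0..<m]"
    for s :: "nat list" and m and p :: "nat set \<times> (nat \<Rightarrow> nat)"
  have data_eq: "n \<in> fst p \<longleftrightarrow> n \<in> fst q" "hs (fst p) n (snd p n) = hs (fst q) n (snd q n)"
    "n < length s \<Longrightarrow> hs (fst p) n (s ! n) = hs (fst q) n (s ! n)"
    if "data s m p = data s m q" "n < m" for s m p q n
  proof -
    have "d s p n = d s q n"
      using arg_cong[OF that(1), of "\<lambda>l. l ! n"] that(2) by (simp add: data_def)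
    then show "n \<in> fst p \<longleftrightarrow> n \<in> fst q" "hs (fst p) n (snd p n) = hs (fst q) n (snd q n)"
      "n < length s \<Longrightarrow> hs (fst p) n (s ! n) = hs (fst q) n (s ! n)"
      unfolding d_def by (simp_all split: if_splits)
  qed
  obtain c H' where H': "H' \<subseteq> H" "uncountable H'"
    "\<And>h h'. h \<in> H' \<Longrightarrow> h' \<in> H' \<Longrightarrow> h \<noteq> h' \<Longrightarrow> \<exists>m. wit h h' (map c [0..<m])"
  proof (rule MA_generic_sequence_pairwise[of H wit bnd data, OF \<open>MA_sigma_linked\<close> H])
    show "wit q p s" if "wit p q s" for p q s
      using that unfolding wit_def by (metis sym)
    show "wit p q (s @ t)" if "wit p q s" for p q s t
      using that unfolding wit_def by (fastforce simp: nth_append)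
    show "\<exists>m. bnd s m F" if F: "finite F" "F \<subseteq> H" for s F
    proof -
      have "\<forall>\<^sub>\<infinity>m. close m p q" if pq: "p \<in> F" "q \<in> F" for p q
      proof -
        have "p \<in> H" "q \<in> H" using F(2) pq by blast+
        from lifts_coherent[OF lift[OF this(1)] lift[OF this(2)]]
        obtain m where m: "\<forall>n\<ge>m. n \<in> fst p \<inter> fst q \<longrightarrow>
            (\<forall>v. \<delta> n (hs (fst p) n v) (hs (fst q) n v) \<le> \<epsilon> + \<epsilon>)"
          unfolding MOST_nat_le by blast
        have "close l p q" if "m \<le> l" for l
          unfolding close_def using m that by simp
        then show ?thesis unfolding MOST_nat_le by blast
      qed
      then have "\<forall>\<^sub>\<infinity>m. \<forall>p\<in>F. \<forall>q\<in>F. close m p q"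
        using F(1) by (simp add: eventually_ball_finite_distrib)
      moreover have "\<forall>\<^sub>\<infinity>m. length s \<le> m" unfolding MOST_nat_le by blast
      ultimately have "\<forall>\<^sub>\<infinity>m. bnd s m F" unfolding bnd_def by (rule eventually_conj[rotated])
      then show ?thesis unfolding MOST_nat_le by blast
    qed
  next
    fix s m F p q g
    assume *: "bnd s m F" "wit p q s" "data s m q = data s m g"
    obtain n where n: "n < length s" "n \<in> fst p" "n \<in> fst q"
      "2 * \<epsilon> < \<delta> n (hs (fst p) n (s ! n)) (hs (fst q) n (s ! n))"
      using *(2) unfolding wit_def by blast
    have nm: "n < m" using n(1) *(1)[unfolded bnd_def, THEN conjunct1] by simp
    show "wit p g s"
      using n data_eq(1)[OF *(3) nm] data_eq(3)[OF *(3) nm n(1)] unfolding wit_def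
      by (intro exI[of _ n]) simp
  next
    fix s m xs ys
    assume bx: "bnd s m (set xs)" and by': "bnd s m (set ys)" and sub: "set xs \<subseteq> H" "set ys \<subseteq> H"
      and len: "length xs = length ys"
      and dat: "\<And>i. i < length xs \<Longrightarrow> data s m (xs ! i) = data s m (ys ! i)"
    define J where "J = {j. j < length xs \<and> xs ! j \<noteq> ys ! j}"
    have "\<forall>j\<in>J. \<exists>n. n \<in> fst (xs ! j) \<inter> fst (ys ! j) \<and> snd (xs ! j) n = snd (ys ! j) n \<and>
        6 * \<epsilon> < \<delta> n (hs (fst (xs ! j)) n (snd (xs ! j) n)) (hs (fst (ys ! j)) n (snd (ys ! j) n))"
    proof
      fix j assume "j \<in> J"
      then have "xs ! j \<in> H" "ys ! j \<in> H" "xs ! j \<noteq> ys ! j" using sub len by (auto simp: J_def)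
      from conf[OF this] show "\<exists>n. n \<in> fst (xs ! j) \<inter> fst (ys ! j) \<and> snd (xs ! j) n = snd (ys ! j) n \<and>
        6 * \<epsilon> < \<delta> n (hs (fst (xs ! j)) n (snd (xs ! j) n)) (hs (fst (ys ! j)) n (snd (ys ! j) n))" by blast
    qed
    then obtain n where n: "\<And>j. j \<in> J \<Longrightarrow> n j \<in> fst (xs ! j) \<inter> fst (ys ! j)"
      "\<And>j. j \<in> J \<Longrightarrow> snd (xs ! j) (n j) = snd (ys ! j) (n j)"
      "\<And>j. j \<in> J \<Longrightarrow> 6 * \<epsilon> < \<delta> (n j) (hs (fst (xs ! j)) (n j) (snd (xs ! j) (n j)))
        (hs (fst (ys ! j)) (n j) (snd (ys ! j) (n j)))"
      by metis
    have n_ge: "m \<le> n j" if "j \<in> J" for j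
    proof (rule ccontr)
      assume "\<not> m \<le> n j"
      then have "hs (fst (xs ! j)) (n j) (snd (xs ! j) (n j)) = hs (fst (ys ! j)) (n j) (snd (ys ! j) (n j))"
        using data_eq(2)[OF dat[of j]] that by (simp add: J_def)
      then show False using n(3)[OF that] \<epsilon> by simp
    qed
    have mem: "xs ! j \<in> set xs" "ys ! j \<in> set ys" if "j \<in> J" for j using that len by (auto simp: J_def)
    \<comment> \<open>One pair is selected for each conflict point and dictates the value of
      \<open>c\<close> there.\<close>
    define pick where "pick i = inv_into J n i" for i
    define c where "c i = snd (xs ! pick i) i" for i
    have c: "2 * \<epsilon> < \<delta> (n j) (hs (fst (xs ! j)) (n j) (c (n j))) (hs (fst (ys ! j)) (n j) (c (n j)))"
      if j: "j \<in> J" for j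
    proof -
      define i where "i = pick (n j)"
      have i: "i \<in> J" "n i = n j"
        using inv_into_into[of "n j" n J] f_inv_into_f[of "n j" n J] j by (simp_all add: i_def pick_def)
      have big: "6 * \<epsilon> < \<delta> (n j) (hs (fst (xs ! i)) (n j) (c (n j))) (hs (fst (ys ! i)) (n j) (c (n j)))"
        using n(2,3)[OF i(1)] i(2) by (simp add: c_def i_def)
      have "close m (xs ! i) (xs ! j)" "close m (ys ! i) (ys ! j)"
        using bx[unfolded bnd_def] by'[unfolded bnd_def] mem[OF i(1)] mem[OF j] by blast+
      then have "\<delta> (n j) (hs (fst (xs ! i)) (n j) (c (n j))) (hs (fst (xs ! j)) (n j) (c (n j))) \<le> 2 * \<epsilon>"
        "\<delta> (n j) (hs (fst (ys ! i)) (n j) (c (n j))) (hs (fst (ys ! j)) (n j) (c (n j))) \<le> 2 * \<epsilon>"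
        using n(1)[OF i(1)] n(1)[OF j] n_ge[OF j] i(2) unfolding close_def by auto
      then show ?thesis
        using big
          triangle[of "n j" "hs (fst (xs ! i)) (n j) (c (n j))" "hs (fst (ys ! i)) (n j) (c (n j))"
            "hs (fst (xs ! j)) (n j) (c (n j))"]
          triangle[of "n j" "hs (fst (xs ! j)) (n j) (c (n j))" "hs (fst (ys ! i)) (n j) (c (n j))"
            "hs (fst (ys ! j)) (n j) (c (n j))"]
          sym[of "n j" "hs (fst (ys ! i)) (n j) (c (n j))" "hs (fst (ys ! j)) (n j) (c (n j))"]
        by linarith
    qed
    define L where "L = Suc (\<Sum>j\<in>J. n j)"
    have less: "n j < L" if "j \<in> J" for j
      using member_le_sum[of j J n] that by (simp add: L_def J_def)
    define t where "t = map c [length s..<L]"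
    have "wit (xs ! j) (ys ! j) (s @ t)" if "j \<in> J" for j
    proof -
      have "length s \<le> n j" using n_ge[OF that] bx[unfolded bnd_def, THEN conjunct1] by simp
      then have "n j < length (s @ t)" "(s @ t) ! n j = c (n j)"
        using less[OF that] by (simp_all add: t_def nth_append)
      then show ?thesis
        unfolding wit_def using n(1)[OF that] c[OF that] by (intro exI[of _ "n j"]) simp
    qed
    then show "\<exists>t. \<forall>i<length xs. xs ! i \<noteq> ys ! i \<longrightarrow> wit (xs ! i) (ys ! i) (s @ t)"
      by (intro exI[of _ t]) (simp add: J_def)
  next
    fix H' c
    assume "H' \<subseteq> H" "uncountable H'" "\<And>h h'. h \<in> H' \<Longrightarrow> h' \<in> H' \<Longrightarrow> h \<noteq> h' \<Longrightarrow> \<exists>m. wit h h' (map c [0..<m])"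
    then show thesis by (rule that)
  qed
  have "\<forall>p. \<exists>m. p \<in> H' \<longrightarrow> (\<forall>n\<ge>m. n \<in> fst p \<longrightarrow> \<delta> n (\<Phi> c n) (hs (fst p) n (c n)) \<le> \<epsilon>)"
  proof
    fix p
    show "\<exists>m. p \<in> H' \<longrightarrow> (\<forall>n\<ge>m. n \<in> fst p \<longrightarrow> \<delta> n (\<Phi> c n) (hs (fst p) n (c n)) \<le> \<epsilon>)"
      using lifts_onD[OF lift[of p], of c] H'(1) unfolding MOST_nat_le by blast
  qed
  then obtain m where m: "\<forall>p. p \<in> H' \<longrightarrow> (\<forall>n\<ge>m p. n \<in> fst p \<longrightarrow> \<delta> n (\<Phi> c n) (hs (fst p) n (c n)) \<le> \<epsilon>)"
    by (rule choice[THEN exE])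
  obtain p q where pq: "p \<in> H'" "q \<in> H'" "p \<noteq> q"
    "(m p, map (\<lambda>n. hs (fst p) n (c n)) [0..<m p]) = (m q, map (\<lambda>n. hs (fst q) n (c n)) [0..<m q])"
    by (rule uncountable_pigeonhole[OF H'(2)])
  obtain l where "wit p q (map c [0..<l])" using H'(3)[OF pq(1,2,3)] by blast
  then obtain n where n: "n \<in> fst p" "n \<in> fst q" "2 * \<epsilon> < \<delta> n (hs (fst p) n (c n)) (hs (fst q) n (c n))"
    by (auto simp: wit_def)
  have eq: "m p = m q" "map (\<lambda>n. hs (fst p) n (c n)) [0..<m p] = map (\<lambda>n. hs (fst q) n (c n)) [0..<m q]"
    using pq(4) by blast+
  show False
  proof (cases "n < m p")
    case True
    from eq(2) have "map (\<lambda>n. hs (fst p) n (c n)) [0..<m p] ! n = map (\<lambda>n. hs (fst q) n (c n)) [0..<m q] ! n"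
      by argo
    then have "hs (fst p) n (c n) = hs (fst q) n (c n)" using True eq(1) by simp
    then show False using n(3) \<epsilon> by simp
  next
    case False
    then have "\<delta> n (\<Phi> c n) (hs (fst p) n (c n)) \<le> \<epsilon>" "\<delta> n (\<Phi> c n) (hs (fst q) n (c n)) \<le> \<epsilon>"
      using m[rule_format, OF pq(1), of n] m[rule_format, OF pq(2), of n] n(1,2) eq(1) by simp_all
    then show False
      using n(3) triangle[of n "hs (fst p) n (c n)" "hs (fst q) n (c n)" "\<Phi> c n"]
        sym[of n "hs (fst p) n (c n)" "\<Phi> c n"] by linarith
  qed
qed

text \<open>If \<open>(S, a)\<close> lies in piece \<open>k\<close>, then on \<open>S\<close> the
  candidate \<open>g k\<close> is within \<open>6 * \<epsilon>\<close> of the lift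
  \<open>hs S\<close> at \<open>a\<close>, which is eventually within \<open>\<epsilon>\<close> of
  \<open>\<Phi> a\<close>. This gives \<open>7 * \<epsilon>\<close>; the bound
  \<open>8 * \<epsilon>\<close> provides the strict gap for \<open>diagonal\<close>.\<close>

lemma global_lift_approx:
  assumes OCA MA_sigma_linked "0 < \<epsilon>"
  shows "\<exists>h. lifts_on (8 * \<epsilon>) UNIV h"
proof -
  \<comment> \<open>A lift at \<open>n\<close> is a whole function of \<open>v\<close>, too much for
    a countable code. An object is therefore a set with a fixed lift, together with a sequence
    naming the values to compare.\<close>
  define hs where "hs S = (SOME h. lifts_on \<epsilon> S h)" for S
  define V where "V = {p :: nat set \<times> (nat \<Rightarrow> nat). \<exists>h. lifts_on \<epsilon> (fst p) h}"
  have hs: "lifts_on \<epsilon> (fst p) (hs (fst p))" if "p \<in> V" for p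
    using that someI_ex[of "lifts_on \<epsilon> (fst p)"] by (simp add: V_def hs_def)
  define K where "K p q \<longleftrightarrow> (\<exists>n\<in>fst p \<inter> fst q. snd p n = snd q n \<and>
      6 * \<epsilon> < \<delta> n (hs (fst p) n (snd p n)) (hs (fst q) n (snd q n)))" for p q :: "nat set \<times> (nat \<Rightarrow> nat)"
  define e where "e p n = (n \<in> fst p, snd p n, hs (fst p) n (snd p n))" for p :: "nat set \<times> (nat \<Rightarrow> nat)" and n
  have inj: "inj_on e V"
  proof (rule inj_onI)
    fix p q assume "e p = e q"
    then have "e p n = e q n" for n by simp
    then have *: "(n \<in> fst p \<longleftrightarrow> n \<in> fst q) \<and> snd p n = snd q n" for n by (simp add: e_def)
    then have "fst p = fst q" by blast
    then show "p = q" using * by (intro prod_eqI ext) simp_all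
  qed
  have K_sym: "K q p" if "K p q" for p q
  proof -
    have "fst q \<inter> fst p = fst p \<inter> fst q" by blast
    then show ?thesis using that sym unfolding K_def by metis
  qed
  have K_loc: "\<exists>m. \<forall>p'\<in>V. \<forall>q'\<in>V. (\<forall>n<m. e p' n = e p n) \<longrightarrow> (\<forall>n<m. e q' n = e q n) \<longrightarrow>
      p' \<noteq> q' \<and> K p' q'" if pq: "K p q" for p q
  proof -
    obtain n where n: "n \<in> fst p \<inter> fst q" "snd p n = snd q n"
      "6 * \<epsilon> < \<delta> n (hs (fst p) n (snd p n)) (hs (fst q) n (snd q n))"
      using pq unfolding K_def by blast
    have "p' \<noteq> q' \<and> K p' q'" if ag: "\<forall>i<Suc n. e p' i = e p i" "\<forall>i<Suc n. e q' i = e q i" for p' q'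
    proof -
      have "e p' n = e p n" "e q' n = e q n" using ag by simp_all
      then have p': "n \<in> fst p' \<longleftrightarrow> n \<in> fst p" "snd p' n = snd p n"
          "hs (fst p') n (snd p' n) = hs (fst p) n (snd p n)"
        and q': "n \<in> fst q' \<longleftrightarrow> n \<in> fst q" "snd q' n = snd q n"
          "hs (fst q') n (snd q' n) = hs (fst q) n (snd q n)"
        unfolding e_def prod.inject by blast+
      have "n \<in> fst p' \<inter> fst q'" "snd p' n = snd q' n" using n p'(1,2) q'(1,2) by simp_all
      moreover have "6 * \<epsilon> < \<delta> n (hs (fst p') n (snd p' n)) (hs (fst q') n (snd q' n))"
        unfolding p'(3) q'(3) by (rule n(3))
      moreover from this have "p' \<noteq> q'" using \<open>0 < \<epsilon>\<close> by auto
      ultimately show ?thesis unfolding K_def by blast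
    qed
    then show ?thesis by (intro exI[of _ "Suc n"]) blast
  qed
  obtain X :: "nat \<Rightarrow> (nat set \<times> (nat \<Rightarrow> nat)) set" where X: "V = (\<Union>k. X k)"
    "\<And>k p q. p \<in> X k \<Longrightarrow> q \<in> X k \<Longrightarrow> p \<noteq> q \<Longrightarrow> \<not> K p q"
  proof (rule OCA_coded[of e V K, OF \<open>OCA\<close> inj K_sym K_loc])
    fix H assume "H \<subseteq> V" "uncountable H" "\<And>p q. p \<in> H \<Longrightarrow> q \<in> H \<Longrightarrow> p \<noteq> q \<Longrightarrow> K p q"
    then show thesis
      using conflicting_lifts_countable[OF \<open>MA_sigma_linked\<close> \<open>0 < \<epsilon>\<close>, of H hs] hs unfolding K_def by blast
  next
    fix Y :: "nat \<Rightarrow> (nat set \<times> (nat \<Rightarrow> nat)) set"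
    assume "V = (\<Union>k. Y k)" "\<And>k p q. p \<in> Y k \<Longrightarrow> q \<in> Y k \<Longrightarrow> p \<noteq> q \<Longrightarrow> \<not> K p q"
    then show thesis by (rule that)
  qed
  define g where "g k n v = hs (fst (SOME q. q \<in> X k \<and> n \<in> fst q \<and> snd q n = v)) n v" for k n v
  have g: "\<delta> n (hs S n (a n)) (g k n (a n)) \<le> 6 * \<epsilon>" if a: "(S, a) \<in> X k" "n \<in> S" for S a k n
  proof -
    define q where "q = (SOME q. q \<in> X k \<and> n \<in> fst q \<and> snd q n = a n)"
    have "\<exists>q. q \<in> X k \<and> n \<in> fst q \<and> snd q n = a n" using a by force
    then have q: "q \<in> X k \<and> n \<in> fst q \<and> snd q n = a n" unfolding q_def by (rule someI_ex)
    have "\<delta> n (hs S n (a n)) (hs (fst q) n (a n)) \<le> 6 * \<epsilon>"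
    proof (cases "q = (S, a)")
      case True
      then show ?thesis using \<open>0 < \<epsilon>\<close> by simp
    next
      case False
      then have "\<not> K (S, a) q" using X(2)[OF a(1)] q by metis
      moreover have "K (S, a) q" if "6 * \<epsilon> < \<delta> n (hs S n (a n)) (hs (fst q) n (a n))"
        unfolding K_def by (rule bexI[of _ n]) (use that q a(2) in simp_all)
      ultimately show ?thesis by (meson not_le)
    qed
    then show ?thesis by (simp add: g_def q_def)
  qed
  have "\<exists>k. lifts_on (8 * \<epsilon>) UNIV (g k)"
  proof (rule ccontr)
    assume "\<not> ?thesis"
    then have "\<forall>k. \<exists>a. \<not> (\<forall>\<^sub>\<infinity>n. \<delta> n (\<Phi> a n) (g k n (a n)) \<le> 8 * \<epsilon>)"
      unfolding lifts_on_def by simp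
    then obtain f where f: "\<forall>k. \<not> (\<forall>\<^sub>\<infinity>n. \<delta> n (\<Phi> (f k) n) (g k n (f k n)) \<le> 8 * \<epsilon>)"
      by (rule choice[THEN exE])
    define B where "B k = {n. 8 * \<epsilon> < \<delta> n (\<Phi> (f k) n) (g k n (f k n))}" for k
    have "infinite (B k)" for k
      using f[rule_format, of k] by (simp add: B_def eventually_cofinite not_le)
    from local_lift[of \<epsilon> B, OF assms this]
    obtain S h where S: "\<forall>k. infinite (S \<inter> B k)" "lifts_on \<epsilon> S h" by blast
    have "\<exists>a. \<forall>k. \<not> (\<forall>\<^sub>\<infinity>n. n \<in> S \<longrightarrow> \<delta> n (\<Phi> a n) (g k n (a n)) \<le> 7 * \<epsilon>)"
      by (rule diagonal[where D = B and f = f and \<epsilon>' = "8 * \<epsilon>"]) (use S(1) \<open>0 < \<epsilon>\<close> in \<open>simp_all add: B_def\<close>)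
    then obtain a where a: "\<And>k. \<not> (\<forall>\<^sub>\<infinity>n. n \<in> S \<longrightarrow> \<delta> n (\<Phi> a n) (g k n (a n)) \<le> 7 * \<epsilon>)"
      by blast
    have "(S, a) \<in> V" using S(2) by (auto simp: V_def)
    then obtain k where k: "(S, a) \<in> X k" using X(1) by blast
    have "\<forall>\<^sub>\<infinity>n. n \<in> S \<longrightarrow> \<delta> n (\<Phi> a n) (g k n (a n)) \<le> 7 * \<epsilon>"
      using lifts_onD[OF hs[OF \<open>(S, a) \<in> V\<close>], of a]
    proof eventually_elim
      case (elim n)
      show ?case
        using elim g[OF k, of n] triangle[of n "\<Phi> a n" "g k n (a n)" "hs S n (a n)"] by auto
    qed
    then show False using a by blast
  qed
  then show ?thesis by blast
qed

text \<open>At \<open>n\<close> the finest lift is used that is coherent there with all coarser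
  ones, for all values at once because the choice may not depend on \<open>a\<close>. Each lift
  qualifies at almost all \<open>n\<close>, so \<open>J n\<close> tends to infinity. The error is at
  most \<open>\<epsilon> i\<close> from \<open>\<Phi> a\<close> to \<open>g i\<close>, plus
  \<open>\<epsilon> i + \<epsilon> (J n)\<close> from \<open>g i\<close> to
  \<open>h\<close>.\<close>

theorem global_lift:
  assumes OCA MA_sigma_linked
  obtains h where "\<And>a. (\<lambda>n. \<delta> n (\<Phi> a n) (h n (a n))) \<longlonglongrightarrow> 0"
proof -
  define \<epsilon> where "\<epsilon> i = 1 / real (Suc i)" for i
  have \<epsilon>: "0 < \<epsilon> i" for i by (simp add: \<epsilon>_def)
  have \<epsilon>_mono: "\<epsilon> j \<le> \<epsilon> i" if "i \<le> j" for i j using that by (simp add: \<epsilon>_def divide_simps)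
  have "\<exists>h. lifts_on (\<epsilon> i) UNIV h" for i
    using global_lift_approx[OF assms, of "\<epsilon> i / 8"] \<epsilon>[of i] by simp
  then obtain g where g: "\<And>i. lifts_on (\<epsilon> i) UNIV (g i)" by metis
  \<comment> \<open>The clause \<open>j \<le> n\<close> bounds the admissible indices, so that a
    largest one exists.\<close>
  define ok where "ok n j \<longleftrightarrow> j \<le> n \<and> (\<forall>i\<le>j. \<forall>v. \<delta> n (g i n v) (g j n v) \<le> \<epsilon> i + \<epsilon> j)" for n j
  have ok_ev: "\<forall>\<^sub>\<infinity>n. ok n j" for j
  proof -
    have "\<forall>\<^sub>\<infinity>n. \<forall>v. \<delta> n (g i n v) (g j n v) \<le> \<epsilon> i + \<epsilon> j" for i
      using lifts_coherent[OF g[of i] g[of j]] by simp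
    then have "\<forall>\<^sub>\<infinity>n. \<forall>i\<in>{..j}. \<forall>v. \<delta> n (g i n v) (g j n v) \<le> \<epsilon> i + \<epsilon> j"
      by (intro eventually_ball_finite) auto
    moreover have "\<forall>\<^sub>\<infinity>n. j \<le> n" unfolding MOST_nat_le by blast
    ultimately show ?thesis by eventually_elim (simp add: ok_def)
  qed
  have ok_0: "ok n 0" for n using \<epsilon>[of 0] by (simp add: ok_def)
  define J where "J n = Max {j. ok n j}" for n
  have fin: "finite {j. ok n j}" for n
    by (rule finite_subset[of _ "{..n}"]) (auto simp: ok_def)
  have J: "ok n (J n)" for n
    using Max_in[OF fin[of n]] ok_0[of n] unfolding J_def by blast
  have J_ge: "j \<le> J n" if "ok n j" for j n
    unfolding J_def by (rule Max_ge[OF fin]) (use that in simp)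
  define h where "h n = g (J n) n" for n
  show thesis
  proof (rule that[of h])
    fix a
    have nonneg: "0 \<le> \<delta> n i j" for n i j
      using triangle[of n i i j] sym[of n i j] by simp
    show "(\<lambda>n. \<delta> n (\<Phi> a n) (h n (a n))) \<longlonglongrightarrow> 0"
    proof (rule LIMSEQ_I)
      fix r :: real assume "0 < r"
      then obtain i where i: "inverse (real (Suc i)) < r / 3"
        using reals_Archimedean[of "r / 3"] by auto
      have "\<forall>\<^sub>\<infinity>n. \<delta> n (\<Phi> a n) (h n (a n)) < r"
        using ok_ev[of i] lifts_onD[OF g[of i], of a]
      proof eventually_elim
        case (elim n)
        have "\<delta> n (g i n (a n)) (h n (a n)) \<le> \<epsilon> i + \<epsilon> (J n)"
          using J[of n] J_ge[OF elim(1)] unfolding ok_def h_def by blast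
        then show ?case
          using elim(2) \<epsilon>_mono[OF J_ge[OF elim(1)]] i
            triangle[of n "\<Phi> a n" "h n (a n)" "g i n (a n)"]
          by (simp add: \<epsilon>_def inverse_eq_divide)
      qed
      then show "\<exists>m. \<forall>n\<ge>m. norm (\<delta> n (\<Phi> a n) (h n (a n)) - 0) < r"
        unfolding MOST_nat_le using nonneg by simp
    qed
  qed
qed

end

section \<open>Reduced products\<close>

lemma mod_fin_eq_iff: "mod_fin S = mod_fin T \<longleftrightarrow> (\<forall>\<^sub>\<infinity>n. n \<in> S \<longleftrightarrow> n \<in> T)"
proof -
  have "{n. (n \<in> S) \<noteq> (n \<in> T)} = sym_diff S T" by blast
  then show ?thesis by (simp add: nat_set_mod_fin.abs_eq_iff eventually_cofinite)
qed

lemma mod_fin_rep: "mod_fin (rep_mod_fin x) = x"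
  by (rule Quotient3_abs_rep[OF Quotient3_nat_set_mod_fin])

lemma boolean_automorphism_inv:
  fixes \<alpha> :: "'b :: boolean_algebra \<Rightarrow> 'b"
  assumes "boolean_automorphism \<alpha>"
  shows "boolean_automorphism (inv \<alpha>)"
proof -
  have bij: "bij \<alpha>" using assms by (simp add: boolean_automorphism_def)
  have surj: "\<alpha> (inv \<alpha> x) = x" for x using bij by (simp add: bij_is_surj surj_f_inv_f)
  have inj: "inv \<alpha> x = y" if "x = \<alpha> y" for x y using bij that by (simp add: bij_is_inj)
  show ?thesis
    using assms unfolding boolean_automorphism_def
    by (intro conjI allI bij_imp_bij_inv[OF bij] inj) (simp_all add: surj)
qed

definition set_lift :: "(nat_set_mod_fin \<Rightarrow> nat_set_mod_fin) \<Rightarrow> nat set \<Rightarrow> nat set" where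
  "set_lift \<alpha> S = rep_mod_fin (\<alpha> (mod_fin S))"

lemma mod_fin_set_lift: "mod_fin (set_lift \<alpha> S) = \<alpha> (mod_fin S)"
  by (simp add: set_lift_def mod_fin_rep)

lemma almost_hom_set_lift:
  assumes "boolean_automorphism \<alpha>"
  shows "almost_hom (set_lift \<alpha>)"
proof
  have \<alpha>: "\<alpha> (inf S T) = inf (\<alpha> S) (\<alpha> T)" "\<alpha> (- S) = - \<alpha> S" for S T
    using assms by (simp_all add: boolean_automorphism_def)
  show "\<forall>\<^sub>\<infinity>n. n \<in> set_lift \<alpha> X \<longleftrightarrow> n \<in> set_lift \<alpha> Y" if "\<forall>\<^sub>\<infinity>n. n \<in> X \<longleftrightarrow> n \<in> Y" for X Y
    using that by (simp add: mod_fin_eq_iff[symmetric] mod_fin_set_lift)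
  have "mod_fin (set_lift \<alpha> (X \<inter> Y)) = mod_fin (set_lift \<alpha> X \<inter> set_lift \<alpha> Y)" for X Y
    by (simp add: mod_fin_set_lift \<alpha> inf_nat_set_mod_fin.abs_eq[symmetric])
  then show "\<forall>\<^sub>\<infinity>n. n \<in> set_lift \<alpha> (X \<inter> Y) \<longleftrightarrow> n \<in> set_lift \<alpha> X \<and> n \<in> set_lift \<alpha> Y" for X Y
    by (simp add: mod_fin_eq_iff)
  have "mod_fin (set_lift \<alpha> (- X)) = mod_fin (- set_lift \<alpha> X)" for X
    by (simp add: mod_fin_set_lift \<alpha> uminus_nat_set_mod_fin.abs_eq[symmetric])
  then show "\<forall>\<^sub>\<infinity>n. n \<in> set_lift \<alpha> (- X) \<longleftrightarrow> n \<notin> set_lift \<alpha> X" for X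
    by (simp add: mod_fin_eq_iff)
qed

lemma almost_iso_set_lift:
  assumes "boolean_automorphism \<alpha>"
  shows "almost_iso (set_lift \<alpha>) (set_lift (inv \<alpha>))"
proof -
  have bij: "bij \<alpha>" using assms by (simp add: boolean_automorphism_def)
  interpret A: almost_hom "set_lift \<alpha>" by (rule almost_hom_set_lift[OF assms])
  interpret A': almost_hom "set_lift (inv \<alpha>)"
    by (rule almost_hom_set_lift[OF boolean_automorphism_inv[OF assms]])
  show ?thesis
  proof
    show "\<forall>\<^sub>\<infinity>n. n \<in> set_lift (inv \<alpha>) (set_lift \<alpha> X) \<longleftrightarrow> n \<in> X" for X
      using bij by (simp add: mod_fin_eq_iff[symmetric] mod_fin_set_lift bij_is_inj)
    show "\<forall>\<^sub>\<infinity>n. n \<in> set_lift \<alpha> (set_lift (inv \<alpha>) X) \<longleftrightarrow> n \<in> X" for X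
      using bij by (simp add: mod_fin_eq_iff[symmetric] mod_fin_set_lift bij_is_surj surj_f_inv_f)
  qed
qed

lemma eq_on_if_agree:
  assumes "a \<in> seq_product M" "b \<in> seq_product M" and eq: "\<And>n. n \<in> S \<Longrightarrow> a n = b n"
  shows "eq_on M (mod_fin S) (null_class M a) (null_class M b)"
proof -
  have "seq_dist_on M (mod_fin S) a b = 0"
  proof (cases "finite S")
    case False
    let ?F = "inf sequentially (principal S)"
    have "?F \<noteq> bot"
      using False unfolding trivial_limit_def eventually_inf_principal eventually_sequentially
      by (metis infinite_nat_iff_unbounded_le)
    moreover have "eventually (\<lambda>n. ereal (mdist (M n) (a n) (b n)) = 0) ?F"
      unfolding eventually_inf_principal
      by (intro always_eventually) (use assms in \<open>auto simp: seq_product_def zero_ereal_def\<close>)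
    then have "Limsup ?F (\<lambda>n. ereal (mdist (M n) (a n) (b n))) = Limsup ?F (\<lambda>n. 0)"
      by (rule Limsup_eq)
    ultimately show ?thesis using False by (simp add: seq_dist_on_mod_fin Limsup_const)
  qed (simp add: seq_dist_on_mod_fin)
  then show ?thesis by (simp add: eq_on_def dist_on_classes assms)
qed

lemma eq_on_imp_eventually_less:
  assumes "a \<in> seq_product M" "b \<in> seq_product M"
    and eq: "eq_on M (mod_fin S) (null_class M a) (null_class M b)" and "0 < \<epsilon>"
  shows "\<forall>\<^sub>\<infinity>n. n \<in> S \<longrightarrow> mdist (M n) (a n) (b n) < \<epsilon>"
proof (cases "finite S")
  case True
  then have "\<forall>\<^sub>\<infinity>n. n \<notin> S" by (simp add: eventually_cofinite)
  then show ?thesis by eventually_elim simp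
next
  case False
  let ?F = "inf sequentially (principal S)"
  have "Limsup ?F (\<lambda>n. ereal (mdist (M n) (a n) (b n))) = 0"
    using eq False by (simp add: eq_on_def dist_on_classes assms(1,2) seq_dist_on_mod_fin)
  then have "Limsup ?F (\<lambda>n. ereal (mdist (M n) (a n) (b n))) < ereal \<epsilon>" using \<open>0 < \<epsilon>\<close> by simp
  then have "eventually (\<lambda>n. ereal (mdist (M n) (a n) (b n)) < ereal \<epsilon>) ?F" by (rule Limsup_lessD)
  then show ?thesis by (simp add: eventually_inf_principal cofinite_eq_sequentially)
qed

lemma separable_dense_sequence:
  assumes "separable_space (mtopology_of m)" "mspace m \<noteq> {}" "0 < \<epsilon>"
  shows "\<exists>q :: nat \<Rightarrow> 'a. (\<forall>i. q i \<in> mspace m) \<and> (\<forall>x\<in>mspace m. \<exists>i. mdist m x (q i) < \<epsilon>)"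
proof -
  interpret Metric_space "mspace m" "mdist m" by (rule Metric_space_mspace_mdist)
  have top: "mtopology_of m = mtopology" by (simp add: mtopology_of_def)
  obtain C where C: "countable C" "C \<subseteq> mspace m" "mtopology closure_of C = mspace m"
    using assms(1) unfolding top by (auto simp: separable_space_def)
  then have "C \<noteq> {}" using assms(2) by auto
  have "\<exists>i. mdist m x (from_nat_into C i) < \<epsilon>" if "x \<in> mspace m" for x
  proof -
    have "x \<in> mtopology closure_of C" using C(3) that by simp
    then obtain c where "c \<in> C" "mdist m x c < \<epsilon>"
      unfolding metric_closure_of using \<open>0 < \<epsilon>\<close> by (auto simp: in_mball)
    then show ?thesis
      using from_nat_into_surj[OF C(1)] by metis
  qed
  then show ?thesis
    using from_nat_into[OF \<open>C \<noteq> {}\<close>] C(2) by (intro exI[of _ "from_nat_into C"]) auto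
qed

lemma null_class_eq_iff:
  assumes "a \<in> seq_product M" "b \<in> seq_product M"
  shows "null_class M a = null_class M b \<longleftrightarrow> (\<lambda>n. mdist (M n) (a n) (b n)) \<longlonglongrightarrow> 0"
  using eq_equiv_class_iff[OF equiv_null_rel assms] assms by (simp add: null_rel_def)

text \<open>An empty factor of \<open>M\<close> leaves no sequence to test, but coordinate maps must
  still be exhibited; constant ones exist because each \<open>N n\<close> has a point.\<close>

lemma trivial_map_empty:
  assumes "mspace (M k) = {}" "\<And>n. mspace (N n) \<noteq> {}"
  shows "trivial_map M N \<phi>"
  unfolding trivial_map_def
proof (intro exI conjI)
  show "almost_permutation UNIV (\<lambda>n. n)" by (simp add: almost_permutation_def)
  show "\<forall>n\<in>UNIV. (\<lambda>_. SOME y. y \<in> mspace (N n)) \<in> mspace (M n) \<rightarrow> mspace (N n)"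
    using assms(2) by (simp add: some_in_eq)
  have "a k \<in> mspace (M k)" if "a \<in> seq_product M" for a
    using that unfolding seq_product_def by blast
  then show "\<forall>a\<in>seq_product M. \<exists>b\<in>seq_product N.
      (\<forall>n\<in>UNIV. b n = (SOME y. y \<in> mspace (N n))) \<and> \<phi> (null_class M a) = null_class N b"
    using assms(1) by blast
qed

text \<open>Nonempty \<open>N n\<close> guarantee that coordinate maps exist: if just one factor of
  \<open>M\<close> and all factors of \<open>N\<close> were empty, both products would be empty, yet
  a nonempty factor of \<open>M\<close> has no map into an empty one.\<close>

theorem theorem2p3:
  fixes M :: "nat \<Rightarrow> 'a metric" and N :: "nat \<Rightarrow> 'b metric"
    and \<phi> :: "(nat \<Rightarrow> 'a) set \<Rightarrow> (nat \<Rightarrow> 'b) set"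
  assumes "OCA" and "MA_sigma_linked"
    and "\<And>n. separable_space (mtopology_of (M n))"
    and "\<And>n. separable_space (mtopology_of (N n))"
    and "uniformly_bounded_diameter M" and "uniformly_bounded_diameter N"
    and "\<And>n. mspace (N n) \<noteq> {}"
    and "\<phi> \<in> reduced_product M \<rightarrow> reduced_product N"
    and "coordinate_respecting M N \<phi>"
  shows "trivial_map M N \<phi>"
proof (cases "\<exists>k. mspace (M k) = {}")
  case True
  then show ?thesis using trivial_map_empty assms(7) by blast
next
  case False
  then have M_ne: "mspace (M n) \<noteq> {}" for n by blast
  obtain \<alpha> where \<alpha>: "boolean_automorphism \<alpha>"
    and resp: "\<And>S a b. a \<in> reduced_product M \<Longrightarrow> b \<in> reduced_product M \<Longrightarrow> eq_on M S a b \<Longrightarrow>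
      eq_on N (\<alpha> S) (\<phi> a) (\<phi> b)"
    using assms(9) unfolding coordinate_respecting_def by blast
  interpret almost_iso "set_lift \<alpha>" "set_lift (inv \<alpha>)" by (rule almost_iso_set_lift[OF \<alpha>])
  obtain g where g: "trivialises (set_lift \<alpha>) g" "finite (- ran g)" "finite (- dom g)"
    by (rule global_trivialiser[OF assms(1,2)])
  define f where "f = the \<circ> g"
  have gf: "g n = Some (f n)" if "n \<in> dom g" for n using that by (auto simp: f_def)
  have inj: "inj_on f (dom g)"
  proof (rule inj_onI)
    fix n n' assume n: "n \<in> dom g" "n' \<in> dom g" "f n = f n'"
    then have "g n = g n'" using gf by simp
    then show "n = n'" using g(1) n(1,2) unfolding trivialises_def by (auto dest: inj_onD)
  qed
  have ran: "f ` dom g = ran g"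
    by (auto simp: f_def ran_def image_iff) force
  have perm: "almost_permutation (dom g) f"
    using g(2,3) inj by (simp add: almost_permutation_def ran)
  have recip_lim: "(\<lambda>n. 1 / real (Suc n)) \<longlonglongrightarrow> 0"
    using LIMSEQ_Suc[OF lim_1_over_n[where 'a = real]] by simp
  \<comment> \<open>The nets become finer along the coordinates, so rounding a sequence to net
    points does not change its class.\<close>
  define \<epsilon> where "\<epsilon> n = 1 / real (Suc n)" for n
  have \<epsilon>: "0 < \<epsilon> n" for n by (simp add: \<epsilon>_def)
  have "\<forall>n. \<exists>q :: nat \<Rightarrow> 'a. (\<forall>i. q i \<in> mspace (M n)) \<and> (\<forall>x\<in>mspace (M n). \<exists>i. mdist (M n) x (q i) < \<epsilon> n)"
    using separable_dense_sequence[OF assms(3) M_ne \<epsilon>] by blast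
  then obtain q :: "nat \<Rightarrow> nat \<Rightarrow> 'a" where q: "\<forall>n. (\<forall>i. q n i \<in> mspace (M n)) \<and> (\<forall>x\<in>mspace (M n). \<exists>i. mdist (M n) x (q n i) < \<epsilon> n)"
    by (rule choice[THEN exE])
  have "\<forall>n. \<exists>q :: nat \<Rightarrow> 'b. (\<forall>i. q i \<in> mspace (N n)) \<and> (\<forall>x\<in>mspace (N n). \<exists>i. mdist (N n) x (q i) < \<epsilon> n)"
    using separable_dense_sequence[OF assms(4) assms(7) \<epsilon>] by blast
  then obtain r :: "nat \<Rightarrow> nat \<Rightarrow> 'b" where r: "\<forall>n. (\<forall>i. r n i \<in> mspace (N n)) \<and> (\<forall>x\<in>mspace (N n). \<exists>i. mdist (N n) x (r n i) < \<epsilon> n)"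
    by (rule choice[THEN exE])
  have q_mem: "q n i \<in> mspace (M n)" and r_mem: "r n i \<in> mspace (N n)" for n i using q r by blast+
  define qi where "qi n x = (SOME i. mdist (M n) x (q n i) < \<epsilon> n)" for n x
  have qi: "mdist (M n) x (q n (qi n x)) < \<epsilon> n" if "x \<in> mspace (M n)" for n x
    unfolding qi_def by (rule someI_ex) (use q that in blast)
  define ri where "ri n x = (SOME i. mdist (N n) x (r n i) < \<epsilon> n)" for n x
  have ri: "mdist (N n) x (r n (ri n x)) < \<epsilon> n" if "x \<in> mspace (N n)" for n x
    unfolding ri_def by (rule someI_ex) (use r that in blast)
  \<comment> \<open>Indices sit at output coordinates and are carried to inputs along
    \<open>f\<close>, which makes the automorphism act as the identity on sets of coordinates. The
    filler \<open>0\<close> concerns only the finitely many inputs outside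
    \<open>ran g\<close>.\<close>
  define enc where "enc a j = q j (if j \<in> ran g then a (inv_into (dom g) f j) else 0)" for a :: "nat \<Rightarrow> nat" and j
  have enc_mem: "enc a \<in> seq_product M" for a using q_mem by (simp add: seq_product_def enc_def)
  have null_class_mem: "null_class M a \<in> reduced_product M" if "a \<in> seq_product M" for a
    unfolding reduced_product_def by (rule quotientI[OF that])
  have "\<exists>b. b \<in> seq_product N \<and> \<phi> (null_class M (enc a)) = null_class N b" for a
  proof -
    have "\<phi> (null_class M (enc a)) \<in> reduced_product N"
      using assms(8) null_class_mem[OF enc_mem] by blast
    then show ?thesis unfolding reduced_product_def by (auto elim: quotientE)
  qed
  then obtain \<Phi>0 where \<Phi>0: "\<And>a. \<Phi>0 a \<in> seq_product N" "\<And>a. \<phi> (null_class M (enc a)) = null_class N (\<Phi>0 a)"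
    by metis
  have \<Phi>0_mem: "\<Phi>0 a n \<in> mspace (N n)" for a n using \<Phi>0(1)[of a] by (simp add: seq_product_def)
  define \<Phi> where "\<Phi> a n = ri n (\<Phi>0 a n)" for a n
  have \<Phi>: "mdist (N n) (\<Phi>0 a n) (r n (\<Phi> a n)) < \<epsilon> n" for a n
    unfolding \<Phi>_def by (rule ri[OF \<Phi>0_mem])
  define \<delta> where "\<delta> n i j = mdist (N n) (r n i) (r n j)" for n i j
  interpret coordinate_lift \<delta> \<Phi>
  proof
    show "\<delta> n i i = 0" "\<delta> n i j = \<delta> n j i" "\<delta> n i k \<le> \<delta> n i j + \<delta> n j k" for n i j k
      using r_mem by (auto simp: \<delta>_def mdist_commute intro: mdist_triangle)
    fix S and a b :: "nat \<Rightarrow> nat" and e :: real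
    assume S: "\<And>n. n \<in> S \<Longrightarrow> a n = b n" and "0 < e"
    \<comment> \<open>These are the inputs read at outputs in \<open>S\<close>; since
      \<open>g\<close> trivialises the automorphism, the image of \<open>T\<close> is
      \<open>S\<close> up to finitely many points.\<close>
    define T where "T = f ` (S \<inter> dom g)"
    have "enc a j = enc b j" if j: "j \<in> T" for j
    proof -
      obtain n where n: "n \<in> S" "n \<in> dom g" "j = f n" using j by (auto simp: T_def)
      then have "inv_into (dom g) f j = n" using inj by simp
      then show ?thesis using S[OF n(1)] by (simp add: enc_def)
    qed
    then have "eq_on M (mod_fin T) (null_class M (enc a)) (null_class M (enc b))"
      by (rule eq_on_if_agree[OF enc_mem enc_mem])
    from resp[OF null_class_mem[OF enc_mem] null_class_mem[OF enc_mem] this]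
    have "eq_on N (mod_fin (set_lift \<alpha> T)) (null_class N (\<Phi>0 a)) (null_class N (\<Phi>0 b))"
      by (simp add: mod_fin_set_lift \<Phi>0(2))
    \<comment> \<open>One third for the distance of the images and one for each of the two
      roundings.\<close>
    from eq_on_imp_eventually_less[OF \<Phi>0(1) \<Phi>0(1) this, of "e / 3"]
    have "\<forall>\<^sub>\<infinity>n. n \<in> set_lift \<alpha> T \<longrightarrow> mdist (N n) (\<Phi>0 a n) (\<Phi>0 b n) < e / 3" using \<open>0 < e\<close> by simp
    moreover have "\<forall>\<^sub>\<infinity>n. n \<in> set_lift \<alpha> T \<longleftrightarrow> n \<in> S \<inter> dom g"
      unfolding T_def f_def by (rule trivialises_image[OF g(1)]) simp
    moreover have "\<forall>\<^sub>\<infinity>n. n \<in> dom g" using g(3) by (simp add: eventually_cofinite Compl_eq)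
    moreover have "\<forall>\<^sub>\<infinity>n. \<epsilon> n < e / 3"
      using order_tendstoD(2)[OF recip_lim, of "e / 3"] \<open>0 < e\<close> by (simp add: \<epsilon>_def cofinite_eq_sequentially)
    ultimately show "\<forall>\<^sub>\<infinity>n. n \<in> S \<longrightarrow> \<delta> n (\<Phi> a n) (\<Phi> b n) < e"
    proof eventually_elim
      case (elim n)
      show ?case
      proof
        assume "n \<in> S"
        then have "mdist (N n) (\<Phi>0 a n) (\<Phi>0 b n) < e / 3" using elim by blast
        then show "\<delta> n (\<Phi> a n) (\<Phi> b n) < e"
          using \<Phi>[of n a] \<Phi>[of n b] elim(4)
            mdist_triangle[OF r_mem[of n "\<Phi> a n"] \<Phi>0_mem[of a n] r_mem[of n "\<Phi> b n"]]
            mdist_triangle[OF \<Phi>0_mem[of a n] \<Phi>0_mem[of b n] r_mem[of n "\<Phi> b n"]]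
            mdist_commute[of "N n" "r n (\<Phi> a n)" "\<Phi>0 a n"]
          unfolding \<delta>_def by linarith
      qed
    qed
  qed
  obtain h where h: "\<And>a. (\<lambda>n. \<delta> n (\<Phi> a n) (h n (a n))) \<longlonglongrightarrow> 0"
    by (rule global_lift[OF assms(1,2)]) blast
  define H where "H n x = r n (h n (qi (f n) x))" for n x
  show ?thesis
    unfolding trivial_map_def
  proof (intro exI[of _ "dom g"] exI[of _ f] exI[of _ H] conjI perm ballI)
    show "H n \<in> mspace (M (f n)) \<rightarrow> mspace (N n)" for n using r_mem by (simp add: H_def)
    fix a assume a: "a \<in> seq_product M"
    then have a_mem: "a n \<in> mspace (M n)" for n by (simp add: seq_product_def)
    \<comment> \<open>The index sequence whose encoding rounds \<open>a\<close> at almost all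
      coordinates, so that \<open>enc a'\<close> represents the class of \<open>a\<close>.\<close>
    define a' where "a' n = qi (f n) (a (f n))" for n
    have "\<forall>\<^sub>\<infinity>n. n \<in> ran g" using g(2) by (simp add: eventually_cofinite Compl_eq)
    then have "\<forall>\<^sub>\<infinity>j. mdist (M j) (a j) (enc a' j) \<le> \<epsilon> j"
    proof eventually_elim
      case (elim j)
      then obtain n where n: "n \<in> dom g" "j = f n" unfolding ran[symmetric] by blast
      then have "inv_into (dom g) f j = n" using inj by simp
      then have "enc a' j = q j (qi j (a j))" using elim n(2) by (simp add: enc_def a'_def)
      then show ?case using qi[OF a_mem[of j]] by simp
    qed
    then have ev: "\<forall>\<^sub>F j in sequentially. mdist (M j) (a j) (enc a' j) \<le> \<epsilon> j"
      by (simp add: cofinite_eq_sequentially)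
    have "(\<lambda>j. mdist (M j) (a j) (enc a' j)) \<longlonglongrightarrow> 0"
      by (rule tendsto_sandwich[OF _ ev tendsto_const recip_lim[folded \<epsilon>_def]]) simp
    then have "null_class M a = null_class M (enc a')"
      using null_class_eq_iff[OF a enc_mem] by blast
    then have \<phi>a: "\<phi> (null_class M a) = null_class N (\<Phi>0 a')" by (simp add: \<Phi>0(2))
    define b where "b n = r n (h n (a' n))" for n
    have b: "b \<in> seq_product N" using r_mem by (simp add: b_def seq_product_def)
    have "\<forall>\<^sub>F n in sequentially. mdist (N n) (\<Phi>0 a' n) (b n) \<le> \<epsilon> n + \<delta> n (\<Phi> a' n) (h n (a' n))"
    proof (rule always_eventually, rule allI)
      fix n
      show "mdist (N n) (\<Phi>0 a' n) (b n) \<le> \<epsilon> n + \<delta> n (\<Phi> a' n) (h n (a' n))"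
        using \<Phi>[of n a'] mdist_triangle[OF \<Phi>0_mem[of a' n] r_mem[of n "\<Phi> a' n"] r_mem[of n "h n (a' n)"]]
        unfolding \<delta>_def b_def by simp
    qed
    moreover have "(\<lambda>n. \<epsilon> n + \<delta> n (\<Phi> a' n) (h n (a' n))) \<longlonglongrightarrow> 0"
      using tendsto_add[OF recip_lim[folded \<epsilon>_def] h[of a']] by simp
    ultimately have "(\<lambda>n. mdist (N n) (\<Phi>0 a' n) (b n)) \<longlonglongrightarrow> 0"
      by (rule tendsto_sandwich[OF _ _ tendsto_const, rotated]) simp
    then have "\<phi> (null_class M a) = null_class N b"
      unfolding \<phi>a using null_class_eq_iff[OF \<Phi>0(1) b] by blast
    moreover have "\<forall>n\<in>dom g. b n = H n (a (f n))" by (simp add: b_def H_def a'_def)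
    ultimately show "\<exists>b\<in>seq_product N. (\<forall>n\<in>dom g. b n = H n (a (f n))) \<and> \<phi> (null_class M a) = null_class N b"
      using b by blast
  qed
qed

end
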